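(* Let $(R,\mathfrak{m})$ be a noetherian local ring and let $M$ be an $R$-module. Then $M$ is (Matlis-)reflexive if and only if $\mu(\mathfrak{p},M)=\mu(\mathfrak{p},M^{\circ\circ})$ for all prime ideals $\mathfrak{p}$ of $R$.
   Context: Rings are commutative with unit. $(R,\mathfrak{m})$ is a noetherian local ring with residue field $k=R/\mathfrak{m}$, and $E$ is the injective hull of $k$ as an $R$-module. For an $R$-module $M$ (not assumed finitely generated), $M^\circ=\operatorname{Hom}_R(M,E)$ is the Matlis dual, $M^{\circ\circ}=(M^\circ)^\circ$, and $\varphi:M\to M^{\circ\circ}$, $\varphi(x)(f)=f(x)$, is the canonical map, which is always injective. $M$ is called (Matlis-)reflexive if $\varphi$ is surjective. For a prime ideal $\mathfrak{p}$ with residue field $\kappa(\mathfrak{p})=R_\mathfrak{p}/\mathfrak{p}R_\mathfrak{p}$, the (zeroth) Bass number of $M$ with respect to $\mathfrak{p}$ is $\mu(\mathfrak{p},M)=\dim_{\kappa(\mathfrak{p})}\big(\operatorname{Hom}_R(R/\mathfrak{p},M)_\mathfrak{p}\big)$, a possibly infinite cardinal number; equality of Bass numbers means equality of cardinals. *)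

theory Defs
  imports
    "HOL-Algebra.Ring_Divisibility"
    "HOL-Algebra.QuotRing"
    "Jordan_Normal_Form.Missing_VectorSpace"
begin

text \<open>
  Modules are those of HOL-Algebra: the fields \<open>mult\<close> and \<open>one\<close> of a module record
  play no role. Homomorphisms (\<open>module_hom\<close>) and bases (\<open>vectorspace.basis\<close>) are the
  ones of the theory \<open>VectorSpace\<close>, which comes with \<open>Missing_VectorSpace\<close>.
\<close>

locale noetherian_local_ring = cring R + noetherian_ring R for R (structure) and \<mm> +
  assumes maximal: "maximalideal \<mm> R"
    and unique_maximal: "maximalideal \<nn> R \<Longrightarrow> \<nn> = \<mm>"

definition regular_module :: "('r, 'b) ring_scheme \<Rightarrow> ('r, 'r) module" where
  "regular_module R =
    \<lparr>carrier = carrier R, mult = mult R, one = one R, zero = zero R, add = add R, smult = mult R\<rparr>"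

lemma regular_module_module:
  fixes R (structure)
  assumes "cring R"
  shows "module R (regular_module R)"
proof -
  interpret cring R by (rule assms)
  have "abelian_group (regular_module R)"
  proof (rule abelian_groupI)
    fix x assume "x \<in> carrier (regular_module R)"
    hence "\<ominus> x \<in> carrier (regular_module R) \<and> \<ominus> x \<oplus>\<^bsub>regular_module R\<^esub> x = \<zero>\<^bsub>regular_module R\<^esub>"
      by (simp add: regular_module_def l_neg)
    thus "\<exists>y\<in>carrier (regular_module R). y \<oplus>\<^bsub>regular_module R\<^esub> x = \<zero>\<^bsub>regular_module R\<^esub>"
      by blast
  qed (simp_all add: regular_module_def a_ac)
  thus ?thesis
    by (rule moduleI[OF assms]) (simp_all add: regular_module_def l_distr r_distr m_assoc)
qed

definition quotient_module :: "('r, 'b) ring_scheme \<Rightarrow> 'r set \<Rightarrow> ('r, 'r set) module" where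
  "quotient_module R I =
    \<lparr>carrier = carrier (R Quot I), mult = mult (R Quot I), one = one (R Quot I),
     zero = zero (R Quot I), add = add (R Quot I),
     smult = (\<lambda>r X. (I +>\<^bsub>R\<^esub> r) \<otimes>\<^bsub>R Quot I\<^esub> X)\<rparr>"

text \<open>Homomorphisms are normalised to be \<open>undefined\<close> outside the domain, so that equality in the
  module of homomorphisms is equality of functions on the carrier.\<close>

definition hom_module ::
  "('r, 'b) ring_scheme \<Rightarrow> ('r, 'm, 'c) module_scheme \<Rightarrow> ('r, 'n, 'd) module_scheme \<Rightarrow> ('r, 'm \<Rightarrow> 'n) module"
where
  "hom_module R M N =
    \<lparr>carrier = module_hom R M N \<inter> extensional (carrier M), mult = undefined, one = undefined,
     zero = (\<lambda>x\<in>carrier M. \<zero>\<^bsub>N\<^esub>),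
     add = (\<lambda>f g. \<lambda>x\<in>carrier M. f x \<oplus>\<^bsub>N\<^esub> g x),
     smult = (\<lambda>r f. \<lambda>x\<in>carrier M. r \<odot>\<^bsub>N\<^esub> f x)\<rparr>"


section \<open>Injective hulls\<close>

text \<open>\<open>'u\<close> is the type that carries the test modules. By Baer's criterion (proved below as
  \<open>injective_module_universe\<close>), injectivity against test modules in the type of the ring
  elements implies injectivity against test modules in every type.\<close>

definition injective_module ::
  "'u itself \<Rightarrow> ('r, 'b) ring_scheme \<Rightarrow> ('r, 'e, 'c) module_scheme \<Rightarrow> bool"
where
  "injective_module (_ :: 'u itself) R E \<longleftrightarrow> module R E \<and>
    (\<forall>(A :: ('r, 'u) module) (B :: ('r, 'u) module) i f.
       module R A \<and> module R B \<and> i \<in> module_hom R A B \<and> inj_on i (carrier A) \<and> f \<in> module_hom R A E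
       \<longrightarrow> (\<exists>g \<in> module_hom R B E. \<forall>x \<in> carrier A. g (i x) = f x))"

definition essential_submodule ::
  "('r, 'b) ring_scheme \<Rightarrow> 'e set \<Rightarrow> ('r, 'e, 'c) module_scheme \<Rightarrow> bool"
where
  "essential_submodule R H E \<longleftrightarrow> Module.submodule H R E \<and>
    (\<forall>N. Module.submodule N R E \<and> N \<noteq> {\<zero>\<^bsub>E\<^esub>} \<longrightarrow> N \<inter> H \<noteq> {\<zero>\<^bsub>E\<^esub>})"

definition injective_hull ::
  "('r, 'b) ring_scheme \<Rightarrow> ('r, 'k, 'c) module_scheme \<Rightarrow> ('r, 'e, 'd) module_scheme \<Rightarrow> bool"
where
  "injective_hull R K E \<longleftrightarrow> module R K \<and> injective_module TYPE('r) R E \<and>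
    (\<exists>\<iota> \<in> module_hom R K E. inj_on \<iota> (carrier K) \<and> essential_submodule R (\<iota> ` carrier K) E)"

lemma injective_module_universe:
  fixes R :: "('r, 'b) ring_scheme" and E :: "('r, 'e, 'c) module_scheme"
  assumes inj: "injective_module TYPE('r) R E"
  shows "injective_module TYPE('u) R E"
proof -
  have modE: "module R E"
    using inj by (simp add: injective_module_def)
  interpret E: module R E by (rule modE)
  have "\<exists>g \<in> module_hom R B E. \<forall>x \<in> carrier A. g (i x) = f x"
    if modA: "module R A" and modB: "module R B" and i: "i \<in> module_hom R A B"
      and i_inj: "inj_on i (carrier A)" and f: "f \<in> module_hom R A E"
    for A B :: "('r, 'u) module" and i f
  proof -
    interpret A: module R A by (rule modA)
    interpret B: module R B by (rule modB)
    interpret i: mod_hom R A B i by unfold_locales (rule i)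
    interpret f: mod_hom R A E f by unfold_locales (rule f)
    have i_closed: "i x \<in> carrier B" if "x \<in> carrier A" for x
      using i that by (auto simp: module_hom_def)
    have f_closed: "f x \<in> carrier E" if "x \<in> carrier A" for x
      using f that by (auto simp: module_hom_def)
    define lin where "lin G \<longleftrightarrow> G \<subseteq> carrier B \<times> carrier E \<and>
        (\<forall>x y x' y'. (x, y) \<in> G \<longrightarrow> (x', y') \<in> G \<longrightarrow> (x \<oplus>\<^bsub>B\<^esub> x', y \<oplus>\<^bsub>E\<^esub> y') \<in> G) \<and>
        (\<forall>r x y. r \<in> carrier R \<longrightarrow> (x, y) \<in> G \<longrightarrow> (r \<odot>\<^bsub>B\<^esub> x, r \<odot>\<^bsub>E\<^esub> y) \<in> G) \<and>
        (\<forall>y. (\<zero>\<^bsub>B\<^esub>, y) \<in> G \<longrightarrow> y = \<zero>\<^bsub>E\<^esub>)" for G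
    define G0 where "G0 = (\<lambda>x. (i x, f x)) ` carrier A"
    have lin_sub: "x \<in> carrier B \<and> y \<in> carrier E" if "lin G" "(x, y) \<in> G" for G x y
      using that by (auto simp: lin_def)
    have lin_add: "(x \<oplus>\<^bsub>B\<^esub> x', y \<oplus>\<^bsub>E\<^esub> y') \<in> G" if "lin G" "(x, y) \<in> G" "(x', y') \<in> G" for G x y x' y'
      using that unfolding lin_def by blast
    have lin_smult: "(r \<odot>\<^bsub>B\<^esub> x, r \<odot>\<^bsub>E\<^esub> y) \<in> G" if "lin G" "r \<in> carrier R" "(x, y) \<in> G" for G r x y
      using that unfolding lin_def by blast
    have lin_zero: "y = \<zero>\<^bsub>E\<^esub>" if "lin G" "(\<zero>\<^bsub>B\<^esub>, y) \<in> G" for G y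
      using that unfolding lin_def by blast
    have lin_minus: "(\<ominus>\<^bsub>B\<^esub> x, \<ominus>\<^bsub>E\<^esub> y) \<in> G" if "lin G" "(x, y) \<in> G" for G x y
    proof -
      have "((\<ominus>\<^bsub>R\<^esub> \<one>\<^bsub>R\<^esub>) \<odot>\<^bsub>B\<^esub> x, (\<ominus>\<^bsub>R\<^esub> \<one>\<^bsub>R\<^esub>) \<odot>\<^bsub>E\<^esub> y) \<in> G"
        using that by (intro lin_smult) auto
      thus ?thesis
        using lin_sub[OF that] by (simp add: B.smult_l_minus E.smult_l_minus)
    qed
    have lin_unique: "y = y'" if "lin G" "(x, y) \<in> G" "(x, y') \<in> G" for G x y y'
    proof -
      have c: "x \<in> carrier B" "y \<in> carrier E" "y' \<in> carrier E"
        using lin_sub that by blast+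
      have "(x \<oplus>\<^bsub>B\<^esub> \<ominus>\<^bsub>B\<^esub> x, y \<oplus>\<^bsub>E\<^esub> \<ominus>\<^bsub>E\<^esub> y') \<in> G"
        using that by (intro lin_add lin_minus)
      hence "y \<oplus>\<^bsub>E\<^esub> \<ominus>\<^bsub>E\<^esub> y' = \<zero>\<^bsub>E\<^esub>"
        using lin_zero[OF that(1)] c by (simp add: B.M.r_neg)
      thus ?thesis
        using c by (metis E.M.minus_equality E.M.minus_minus E.M.a_inv_closed E.M.a_comm)
    qed
    have lin0: "lin G0"
      unfolding lin_def
    proof (intro conjI allI impI)
      show "G0 \<subseteq> carrier B \<times> carrier E"
        using i_closed f_closed by (auto simp: G0_def)
    next
      fix x y x' y' assume "(x, y) \<in> G0" "(x', y') \<in> G0"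
      then obtain a a' where a: "a \<in> carrier A" "a' \<in> carrier A"
        and e: "x = i a" "y = f a" "x' = i a'" "y' = f a'"
        by (auto simp: G0_def)
      have "(i (a \<oplus>\<^bsub>A\<^esub> a'), f (a \<oplus>\<^bsub>A\<^esub> a')) \<in> G0"
        using a by (auto simp: G0_def simp del: i.f_add f.f_add)
      thus "(x \<oplus>\<^bsub>B\<^esub> x', y \<oplus>\<^bsub>E\<^esub> y') \<in> G0"
        using a e by simp
    next
      fix r x y assume r: "r \<in> carrier R" and "(x, y) \<in> G0"
      then obtain a where a: "a \<in> carrier A" and e: "x = i a" "y = f a"
        by (auto simp: G0_def)
      have "(i (r \<odot>\<^bsub>A\<^esub> a), f (r \<odot>\<^bsub>A\<^esub> a)) \<in> G0"
        using a r by (auto simp: G0_def simp del: i.f_smult f.f_smult)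
      thus "(r \<odot>\<^bsub>B\<^esub> x, r \<odot>\<^bsub>E\<^esub> y) \<in> G0"
        using a r e by simp
    next
      fix y assume "(\<zero>\<^bsub>B\<^esub>, y) \<in> G0"
      then obtain a where a: "a \<in> carrier A" and e: "i a = \<zero>\<^bsub>B\<^esub>" "y = f a"
        by (auto simp: G0_def)
      have "i a = i \<zero>\<^bsub>A\<^esub>" using e by simp
      from inj_onD[OF i_inj this a A.M.zero_closed] have "a = \<zero>\<^bsub>A\<^esub>" .
      thus "y = \<zero>\<^bsub>E\<^esub>" using e by simp
    qed
    have "\<exists>G\<in>{G. lin G \<and> G0 \<subseteq> G}. \<forall>G'\<in>{G. lin G \<and> G0 \<subseteq> G}. G \<subseteq> G' \<longrightarrow> G' = G"
    proof (rule subset_Zorn_nonempty)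
      show "{G. lin G \<and> G0 \<subseteq> G} \<noteq> {}" using lin0 by blast
    next
      fix C assume ne: "C \<noteq> {}" and ch: "subset.chain {G. lin G \<and> G0 \<subseteq> G} C"
      have C: "\<And>G. G \<in> C \<Longrightarrow> lin G \<and> G0 \<subseteq> G"
        using ch by (auto simp: subset_chain_def)
      have two: "\<exists>G\<in>C. p \<in> G \<and> q \<in> G" if "p \<in> \<Union>C" "q \<in> \<Union>C" for p q
        using that ch unfolding subset_chain_def by blast
      have "lin (\<Union>C)"
        unfolding lin_def
      proof (intro conjI allI impI)
        show "\<Union>C \<subseteq> carrier B \<times> carrier E"
          using C by (auto dest: lin_sub)
      next
        fix x y x' y' assume "(x, y) \<in> \<Union>C" "(x', y') \<in> \<Union>C"
        from two[OF this] show "(x \<oplus>\<^bsub>B\<^esub> x', y \<oplus>\<^bsub>E\<^esub> y') \<in> \<Union>C"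
          using C lin_add by blast
      next
        fix r x y assume "r \<in> carrier R" "(x, y) \<in> \<Union>C"
        thus "(r \<odot>\<^bsub>B\<^esub> x, r \<odot>\<^bsub>E\<^esub> y) \<in> \<Union>C"
          using C lin_smult by blast
      next
        fix y assume "(\<zero>\<^bsub>B\<^esub>, y) \<in> \<Union>C"
        thus "y = \<zero>\<^bsub>E\<^esub>" using C lin_zero by blast
      qed
      moreover have "G0 \<subseteq> \<Union>C" using ne C by blast
      ultimately show "\<Union>C \<in> {G. lin G \<and> G0 \<subseteq> G}" by blast
    qed
    then obtain G where G: "lin G" "G0 \<subseteq> G"
      and max: "\<And>G'. lin G' \<Longrightarrow> G \<subseteq> G' \<Longrightarrow> G' = G"
      by (metis (mono_tags, lifting) mem_Collect_eq subset_trans)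
    have zeroG: "(\<zero>\<^bsub>B\<^esub>, \<zero>\<^bsub>E\<^esub>) \<in> G"
    proof -
      have "(i \<zero>\<^bsub>A\<^esub>, f \<zero>\<^bsub>A\<^esub>) \<in> G0"
        unfolding G0_def by (rule imageI) simp
      thus ?thesis using G by auto
    qed
    have total: "b \<in> Domain G" if b: "b \<in> carrier B" for b
    proof -
      define I where "I = {r \<in> carrier R. r \<odot>\<^bsub>B\<^esub> b \<in> Domain G}"
      define h where "h r = (THE e. (r \<odot>\<^bsub>B\<^esub> b, e) \<in> G)" for r
      have h_eq: "h r = e" if "(r \<odot>\<^bsub>B\<^esub> b, e) \<in> G" for r e
        unfolding h_def using that lin_unique[OF G(1)] by blast
      have h_in: "(r \<odot>\<^bsub>B\<^esub> b, h r) \<in> G" if "r \<in> I" for r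
        using that h_eq unfolding I_def by fastforce
      define RR where "RR = regular_module R"
      define J where "J = RR\<lparr>carrier := I\<rparr>"
      have modRR: "module R RR"
        unfolding RR_def by (rule regular_module_module) (rule E.R.is_cring)
      have I_add: "r \<oplus>\<^bsub>R\<^esub> s \<in> I" "h (r \<oplus>\<^bsub>R\<^esub> s) = h r \<oplus>\<^bsub>E\<^esub> h s" if "r \<in> I" "s \<in> I" for r s
      proof -
        have c: "r \<in> carrier R" "s \<in> carrier R" using that by (auto simp: I_def)
        have "((r \<oplus>\<^bsub>R\<^esub> s) \<odot>\<^bsub>B\<^esub> b, h r \<oplus>\<^bsub>E\<^esub> h s) \<in> G"
          using lin_add[OF G(1) h_in[OF that(1)] h_in[OF that(2)]] b c by (simp add: B.smult_l_distr)
        thus "r \<oplus>\<^bsub>R\<^esub> s \<in> I" "h (r \<oplus>\<^bsub>R\<^esub> s) = h r \<oplus>\<^bsub>E\<^esub> h s"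
          using c h_eq by (auto simp: I_def)
      qed
      have I_mult: "r \<otimes>\<^bsub>R\<^esub> s \<in> I" "h (r \<otimes>\<^bsub>R\<^esub> s) = r \<odot>\<^bsub>E\<^esub> h s" if "r \<in> carrier R" "s \<in> I" for r s
      proof -
        have c: "s \<in> carrier R" using that by (auto simp: I_def)
        have "((r \<otimes>\<^bsub>R\<^esub> s) \<odot>\<^bsub>B\<^esub> b, r \<odot>\<^bsub>E\<^esub> h s) \<in> G"
          using lin_smult[OF G(1) that(1) h_in[OF that(2)]] b c that by (simp add: B.smult_assoc1)
        thus "r \<otimes>\<^bsub>R\<^esub> s \<in> I" "h (r \<otimes>\<^bsub>R\<^esub> s) = r \<odot>\<^bsub>E\<^esub> h s"
          using c that h_eq by (auto simp: I_def)
      qed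
      have "LinearCombinations.submodule R I RR"
      proof (rule LinearCombinations.submodule.intro[OF modRR])
        show "I \<subseteq> carrier RR" by (auto simp: I_def RR_def regular_module_def)
        show "\<zero>\<^bsub>RR\<^esub> \<in> I"
          using zeroG b by (auto simp: I_def RR_def regular_module_def)
      qed (auto simp: RR_def regular_module_def I_add I_mult)
      hence modJ: "module R J"
        unfolding J_def by (rule module.submodule_is_module[OF modRR])
      have "id \<in> module_hom R J RR"
        by (auto simp: module_hom_def J_def RR_def regular_module_def I_def)
      moreover have "h \<in> module_hom R J E"
        using h_in lin_sub[OF G(1)]
        by (auto simp: module_hom_def J_def RR_def regular_module_def I_add I_mult)
      moreover have "inj_on id (carrier J)" by simp
      ultimately have "\<exists>g \<in> module_hom R RR E. \<forall>r \<in> carrier J. g (id r) = h r"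
        using inj[unfolded injective_module_def, THEN conjunct2, rule_format, of J RR id h] modJ modRR
        by simp
      then obtain g where g: "g \<in> module_hom R RR E" and gh: "\<And>r. r \<in> carrier J \<Longrightarrow> g (id r) = h r"
        by blast
      define e0 where "e0 = g \<one>\<^bsub>R\<^esub>"
      have e0: "e0 \<in> carrier E"
        using g by (auto simp: e0_def module_hom_def RR_def regular_module_def)
      have h_e0: "h r = r \<odot>\<^bsub>E\<^esub> e0" if "r \<in> I" for r
      proof -
        have r: "r \<in> carrier R" using that by (simp add: I_def)
        have "g (r \<otimes>\<^bsub>R\<^esub> \<one>\<^bsub>R\<^esub>) = r \<odot>\<^bsub>E\<^esub> g \<one>\<^bsub>R\<^esub>"
          using g r by (simp add: module_hom_def RR_def regular_module_def del: E.R.r_one)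
        thus ?thesis using gh[of r] that r by (simp add: J_def e0_def)
      qed
      define G' where "G' = {(x \<oplus>\<^bsub>B\<^esub> r \<odot>\<^bsub>B\<^esub> b, y \<oplus>\<^bsub>E\<^esub> r \<odot>\<^bsub>E\<^esub> e0) | x y r. (x, y) \<in> G \<and> r \<in> carrier R}"
      have "lin G'"
        unfolding lin_def
      proof (intro conjI allI impI)
        show "G' \<subseteq> carrier B \<times> carrier E"
          using b e0 lin_sub[OF G(1)] by (auto simp: G'_def)
      next
        fix u v u' v' assume "(u, v) \<in> G'" "(u', v') \<in> G'"
        then obtain x y r x' y' r' where q: "(x, y) \<in> G" "(x', y') \<in> G" "r \<in> carrier R" "r' \<in> carrier R"
          and e: "u = x \<oplus>\<^bsub>B\<^esub> r \<odot>\<^bsub>B\<^esub> b" "v = y \<oplus>\<^bsub>E\<^esub> r \<odot>\<^bsub>E\<^esub> e0"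
            "u' = x' \<oplus>\<^bsub>B\<^esub> r' \<odot>\<^bsub>B\<^esub> b" "v' = y' \<oplus>\<^bsub>E\<^esub> r' \<odot>\<^bsub>E\<^esub> e0"
          unfolding G'_def by blast
        have c: "x \<in> carrier B" "x' \<in> carrier B" "y \<in> carrier E" "y' \<in> carrier E"
          using q lin_sub[OF G(1)] by blast+
        have "u \<oplus>\<^bsub>B\<^esub> u' = (x \<oplus>\<^bsub>B\<^esub> x') \<oplus>\<^bsub>B\<^esub> (r \<oplus>\<^bsub>R\<^esub> r') \<odot>\<^bsub>B\<^esub> b"
          using c b q by (simp add: e B.smult_l_distr B.M.a_ac)
        moreover have "v \<oplus>\<^bsub>E\<^esub> v' = (y \<oplus>\<^bsub>E\<^esub> y') \<oplus>\<^bsub>E\<^esub> (r \<oplus>\<^bsub>R\<^esub> r') \<odot>\<^bsub>E\<^esub> e0"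
          using c e0 q by (simp add: e E.smult_l_distr E.M.a_ac)
        moreover have "(x \<oplus>\<^bsub>B\<^esub> x', y \<oplus>\<^bsub>E\<^esub> y') \<in> G" "r \<oplus>\<^bsub>R\<^esub> r' \<in> carrier R"
          using q lin_add[OF G(1)] by auto
        ultimately show "(u \<oplus>\<^bsub>B\<^esub> u', v \<oplus>\<^bsub>E\<^esub> v') \<in> G'"
          unfolding G'_def by blast
      next
        fix s u v assume s: "s \<in> carrier R" and "(u, v) \<in> G'"
        then obtain x y r where q: "(x, y) \<in> G" "r \<in> carrier R"
          and e: "u = x \<oplus>\<^bsub>B\<^esub> r \<odot>\<^bsub>B\<^esub> b" "v = y \<oplus>\<^bsub>E\<^esub> r \<odot>\<^bsub>E\<^esub> e0"
          unfolding G'_def by blast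
        have c: "x \<in> carrier B" "y \<in> carrier E"
          using q lin_sub[OF G(1)] by blast+
        have "s \<odot>\<^bsub>B\<^esub> u = s \<odot>\<^bsub>B\<^esub> x \<oplus>\<^bsub>B\<^esub> (s \<otimes>\<^bsub>R\<^esub> r) \<odot>\<^bsub>B\<^esub> b"
          using c b q s by (simp add: e B.smult_r_distr B.smult_assoc1)
        moreover have "s \<odot>\<^bsub>E\<^esub> v = s \<odot>\<^bsub>E\<^esub> y \<oplus>\<^bsub>E\<^esub> (s \<otimes>\<^bsub>R\<^esub> r) \<odot>\<^bsub>E\<^esub> e0"
          using c e0 q s by (simp add: e E.smult_r_distr E.smult_assoc1)
        moreover have "(s \<odot>\<^bsub>B\<^esub> x, s \<odot>\<^bsub>E\<^esub> y) \<in> G" "s \<otimes>\<^bsub>R\<^esub> r \<in> carrier R"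
          using q s lin_smult[OF G(1)] by auto
        ultimately show "(s \<odot>\<^bsub>B\<^esub> u, s \<odot>\<^bsub>E\<^esub> v) \<in> G'"
          unfolding G'_def by blast
      next
        fix v assume "(\<zero>\<^bsub>B\<^esub>, v) \<in> G'"
        then obtain x y r where q: "(x, y) \<in> G" "r \<in> carrier R"
          and e: "\<zero>\<^bsub>B\<^esub> = x \<oplus>\<^bsub>B\<^esub> r \<odot>\<^bsub>B\<^esub> b" "v = y \<oplus>\<^bsub>E\<^esub> r \<odot>\<^bsub>E\<^esub> e0"
          unfolding G'_def by blast
        have c: "x \<in> carrier B" "y \<in> carrier E"
          using q lin_sub[OF G(1)] by blast+
        have "r \<odot>\<^bsub>B\<^esub> b = \<ominus>\<^bsub>B\<^esub> x"
          using e(1) c b q by (metis B.M.minus_equality B.M.a_comm B.smult_closed)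
        hence rb: "(r \<odot>\<^bsub>B\<^esub> b, \<ominus>\<^bsub>E\<^esub> y) \<in> G"
          using lin_minus[OF G(1) q(1)] by simp
        hence "r \<in> I" using q by (auto simp: I_def)
        hence "r \<odot>\<^bsub>E\<^esub> e0 = \<ominus>\<^bsub>E\<^esub> y"
          using h_eq[OF rb] h_e0 by simp
        thus "v = \<zero>\<^bsub>E\<^esub>" using e(2) c by (simp add: E.M.r_neg)
      qed
      moreover have "G \<subseteq> G'"
      proof (rule subrelI)
        fix x y assume xy: "(x, y) \<in> G"
        have "x = x \<oplus>\<^bsub>B\<^esub> \<zero>\<^bsub>R\<^esub> \<odot>\<^bsub>B\<^esub> b" "y = y \<oplus>\<^bsub>E\<^esub> \<zero>\<^bsub>R\<^esub> \<odot>\<^bsub>E\<^esub> e0"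
          using lin_sub[OF G(1) xy] b e0 by simp_all
        thus "(x, y) \<in> G'" using xy unfolding G'_def by blast
      qed
      ultimately have "G' = G" by (rule max)
      moreover have "(b, e0) \<in> G'"
      proof -
        have "b = \<zero>\<^bsub>B\<^esub> \<oplus>\<^bsub>B\<^esub> \<one>\<^bsub>R\<^esub> \<odot>\<^bsub>B\<^esub> b" "e0 = \<zero>\<^bsub>E\<^esub> \<oplus>\<^bsub>E\<^esub> \<one>\<^bsub>R\<^esub> \<odot>\<^bsub>E\<^esub> e0"
          using b e0 by simp_all
        thus ?thesis using zeroG unfolding G'_def by blast
      qed
      ultimately show ?thesis by blast
    qed
    define g where "g b = (THE e. (b, e) \<in> G)" for b
    have g_eq: "g b = e" if "(b, e) \<in> G" for b e
      unfolding g_def using that lin_unique[OF G(1)] by blast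
    have g_in: "(b, g b) \<in> G" if "b \<in> carrier B" for b
      using total[OF that] g_eq by auto
    have "g \<in> module_hom R B E"
      using lin_sub[OF G(1) g_in] lin_add[OF G(1) g_in g_in] lin_smult[OF G(1) _ g_in]
      by (auto simp: module_hom_def intro!: g_eq)
    moreover have "g (i x) = f x" if "x \<in> carrier A" for x
      using that G(2) by (intro g_eq) (auto simp: G0_def)
    ultimately show ?thesis by blast
  qed
  thus ?thesis
    unfolding injective_module_def using modE by blast
qed


section \<open>Matlis duality\<close>

definition matlis_dual ::
  "('r, 'b) ring_scheme \<Rightarrow> ('r, 'e, 'c) module_scheme \<Rightarrow> ('r, 'm, 'd) module_scheme \<Rightarrow> ('r, 'm \<Rightarrow> 'e) module"
where
  "matlis_dual R E M = hom_module R M E"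

definition matlis_bidual ::
  "('r, 'b) ring_scheme \<Rightarrow> ('r, 'e, 'c) module_scheme \<Rightarrow> ('r, 'm, 'd) module_scheme \<Rightarrow> ('r, ('m \<Rightarrow> 'e) \<Rightarrow> 'e) module"
where
  "matlis_bidual R E M = matlis_dual R E (matlis_dual R E M)"

definition matlis_map ::
  "('r, 'b) ring_scheme \<Rightarrow> ('r, 'e, 'c) module_scheme \<Rightarrow> ('r, 'm, 'd) module_scheme \<Rightarrow> 'm \<Rightarrow> ('m \<Rightarrow> 'e) \<Rightarrow> 'e"
where
  "matlis_map R E M x = (\<lambda>f\<in>carrier (matlis_dual R E M). f x)"

definition matlis_reflexive ::
  "('r, 'b) ring_scheme \<Rightarrow> ('r, 'e, 'c) module_scheme \<Rightarrow> ('r, 'm, 'd) module_scheme \<Rightarrow> bool"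
where
  "matlis_reflexive R E M \<longleftrightarrow> matlis_map R E M ` carrier M = carrier (matlis_bidual R E M)"


section \<open>Localization\<close>

text \<open>\<open>fraction R S N x s\<close> is the fraction \<open>x/s\<close>, as an equivalence class of pairs.\<close>

definition fraction_rel ::
  "('r, 'b) ring_scheme \<Rightarrow> 'r set \<Rightarrow> ('r, 'n, 'c) module_scheme \<Rightarrow> (('n \<times> 'r) \<times> ('n \<times> 'r)) set"
where
  "fraction_rel R S N =
    {((x, s), (y, t)). x \<in> carrier N \<and> y \<in> carrier N \<and> s \<in> S \<and> t \<in> S \<and>
       (\<exists>u\<in>S. u \<odot>\<^bsub>N\<^esub> (t \<odot>\<^bsub>N\<^esub> x \<ominus>\<^bsub>N\<^esub> s \<odot>\<^bsub>N\<^esub> y) = \<zero>\<^bsub>N\<^esub>)}"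

definition fraction ::
  "('r, 'b) ring_scheme \<Rightarrow> 'r set \<Rightarrow> ('r, 'n, 'c) module_scheme \<Rightarrow> 'n \<Rightarrow> 'r \<Rightarrow> ('n \<times> 'r) set"
where
  "fraction R S N x s = fraction_rel R S N `` {(x, s)}"

text \<open>The scalars are elements \<open>a/s\<close> of \<open>localization_ring R S\<close> below. The unions are
  over representatives, on which the fraction does not depend.\<close>

definition localization_module ::
  "('r, 'b) ring_scheme \<Rightarrow> 'r set \<Rightarrow> ('r, 'n, 'c) module_scheme \<Rightarrow> (('r \<times> 'r) set, ('n \<times> 'r) set) module"
where
  "localization_module R S N =
    \<lparr>carrier = (carrier N \<times> S) // fraction_rel R S N, mult = undefined, one = undefined,
     zero = fraction R S N \<zero>\<^bsub>N\<^esub> \<one>\<^bsub>R\<^esub>,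
     add = (\<lambda>X Y. \<Union>(x, s)\<in>X. \<Union>(y, t)\<in>Y. fraction R S N (t \<odot>\<^bsub>N\<^esub> x \<oplus>\<^bsub>N\<^esub> s \<odot>\<^bsub>N\<^esub> y) (s \<otimes>\<^bsub>R\<^esub> t)),
     smult = (\<lambda>A X. \<Union>(a, s)\<in>A. \<Union>(x, t)\<in>X. fraction R S N (a \<odot>\<^bsub>N\<^esub> x) (s \<otimes>\<^bsub>R\<^esub> t))\<rparr>"

definition localization_ring ::
  "('r, 'b) ring_scheme \<Rightarrow> 'r set \<Rightarrow> ('r \<times> 'r) set ring"
where
  "localization_ring R S =
    \<lparr>carrier = carrier (localization_module R S (regular_module R)),
     mult = smult (localization_module R S (regular_module R)),
     one = fraction R S (regular_module R) \<one>\<^bsub>R\<^esub> \<one>\<^bsub>R\<^esub>,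
     zero = zero (localization_module R S (regular_module R)),
     add = add (localization_module R S (regular_module R))\<rparr>"


section \<open>Bass numbers\<close>

definition extended_prime :: "('r, 'b) ring_scheme \<Rightarrow> 'r set \<Rightarrow> ('r \<times> 'r) set set" where
  "extended_prime R \<pp> =
    Idl\<^bsub>localization_ring R (carrier R - \<pp>)\<^esub>
      ((\<lambda>a. fraction R (carrier R - \<pp>) (regular_module R) a \<one>\<^bsub>R\<^esub>) ` \<pp>)"

definition residue_field :: "('r, 'b) ring_scheme \<Rightarrow> 'r set \<Rightarrow> ('r \<times> 'r) set set ring" where
  "residue_field R \<pp> = localization_ring R (carrier R - \<pp>) Quot extended_prime R \<pp>"

text \<open>A module annihilated by an ideal, as a module over the quotient ring: a coset acts
  through any of its elements.\<close>

definition coset_scalars :: "('l, 'n, 'c) module_scheme \<Rightarrow> ('l set, 'n) module" where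
  "coset_scalars N =
    \<lparr>carrier = carrier N, mult = undefined, one = undefined, zero = \<zero>\<^bsub>N\<^esub>, add = add N,
     smult = (\<lambda>X v. THE w. \<exists>a\<in>X. w = a \<odot>\<^bsub>N\<^esub> v)\<rparr>"

definition bass_space ::
  "('r, 'b) ring_scheme \<Rightarrow> 'r set \<Rightarrow> ('r, 'm, 'c) module_scheme \<Rightarrow>
   (('r \<times> 'r) set set, (('r set \<Rightarrow> 'm) \<times> 'r) set) module"
where
  "bass_space R \<pp> M =
    coset_scalars (localization_module R (carrier R - \<pp>) (hom_module R (quotient_module R \<pp>) M))"

text \<open>The dimension of an arbitrary vector space, as a cardinal in the sense of
  \<open>HOL.BNF_Cardinal_Order_Relation\<close>, to be compared by \<open>=o\<close>; \<open>vectorspace.dim\<close> is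
  a natural number and only meaningful in finite dimension.\<close>

definition cardinal_dim :: "('k, 'b) ring_scheme \<Rightarrow> ('k, 'v, 'c) module_scheme \<Rightarrow> 'v rel" where
  "cardinal_dim K V = card_of (SOME B. vectorspace.basis K V B)"

definition bass_number ::
  "('r, 'b) ring_scheme \<Rightarrow> 'r set \<Rightarrow> ('r, 'm, 'c) module_scheme \<Rightarrow> (('r set \<Rightarrow> 'm) \<times> 'r) set rel"
where
  "bass_number R \<pp> M = cardinal_dim (residue_field R \<pp>) (bass_space R \<pp> M)"

unbundle cardinal_syntax

end

theory Submission
  imports Defs "HOL-Algebra.Free_Abelian_Groups"
begin

text \<open>
  Write \<open>DD\<close> for the bidual of \<open>M\<close> and \<open>\<phi>: M \<rightarrow> DD\<close> for the canonical map. If \<open>M\<close> is reflexive then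
  \<open>\<phi>\<close> is an isomorphism, and isomorphic modules have the same Bass numbers. For the converse,
  assume that all Bass numbers agree; it is enough that \<open>DD/\<phi>(M)\<close> has no associated prime.

  Suppose that \<open>\<pp>\<close> is the annihilator of the class of some \<open>z \<in> DD\<close>. Since \<open>E\<close> is an injective
  cogenerator, \<open>\<phi>\<close> is pure (\<open>matlis_map_pure\<close>): the finitely many equations \<open>a z \<in> \<phi>(M)\<close>, with
  \<open>a\<close> running through generators of \<open>\<pp>\<close>, are solved simultaneously by one \<open>x \<in> M\<close>. Replacing \<open>z\<close>
  by \<open>w = z - \<phi>(x)\<close> changes neither the class nor its annihilator, and now \<open>\<pp> w = 0\<close>. So it
  remains to find an \<open>r \<notin> \<pp>\<close> with \<open>r w \<in> \<phi>(M)\<close>; this is where \<open>\<mu>(\<pp>, M) = \<mu>(\<pp>, DD)\<close> enters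
  (\<open>bass_number_eq_imp_multiple_in_range\<close>).

  The Bass number \<open>\<mu>(\<pp>, M)\<close> is the rank over \<open>R/\<pp>\<close> of the submodule \<open>{y \<in> M. \<pp> y = 0}\<close>, that is, the
  greatest cardinality of a family in it which is linearly independent over \<open>R/\<pp>\<close>
  (\<open>independent_mod_ordLeq_bass_number\<close>, \<open>exists_independent_mod_bass_number\<close>). Take such a family
  \<open>(x i)\<close>, indexed by \<open>I\<close>, of the greatest cardinality in \<open>M\<close>.

  If \<open>I\<close> is finite, then the elements \<open>\<phi>(x i)\<close> together with \<open>w\<close> are too many to be independent in
  \<open>DD\<close>, and the dependence gives \<open>r\<close>. If \<open>I\<close> is infinite, then the rank of the
  bidual is strictly larger, a contradiction (\<open>independent_mod_bidual_Pow\<close>): for every \<open>J \<subseteq> I\<close>, the partial sum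
  \<open>f \<mapsto> \<Sum>i\<in>J. f (x i)\<close> is defined for those \<open>f\<close> in the dual which vanish at almost all \<open>x i\<close>;
  it extends to an element of \<open>DD\<close> by injectivity of \<open>E\<close>, and letting \<open>J\<close> run through an independent
  family of \<open>2^|I|\<close> subsets of \<open>I\<close> gives \<open>2^|I|\<close> elements of \<open>DD\<close> independent over \<open>R/\<pp>\<close>.
\<close>

section \<open>Vector spaces of arbitrary dimension\<close>

context vectorspace
begin

lemma lin_indpt_subset:
  assumes "lin_indpt S" "T \<subseteq> S"
  shows "lin_indpt T"
  using assms unfolding lin_dep_def by blast

lemma basis_exists: "\<exists>B. basis B"
proof -
  let ?I = "{S. S \<subseteq> carrier V \<and> lin_indpt S}"
  have "\<exists>B\<in>?I. \<forall>X\<in>?I. B \<subseteq> X \<longrightarrow> X = B"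
  proof (rule subset_Zorn_nonempty)
    have "{} \<in> ?I" by (simp add: lin_dep_def)
    thus "?I \<noteq> {}" by blast
  next
    fix C assume ne: "C \<noteq> {}" and ch: "subset.chain ?I C"
    have C: "C \<subseteq> ?I" using ch by (auto simp: subset_chain_def)
    have "lin_indpt (\<Union>C)"
    proof
      assume "lin_dep (\<Union>C)"
      then obtain A a v where A: "finite A" "A \<subseteq> \<Union>C" "a \<in> A \<rightarrow> carrier K"
        "lincomb a A = \<zero>\<^bsub>V\<^esub>" "v \<in> A" "a v \<noteq> \<zero>\<^bsub>K\<^esub>"
        unfolding lin_dep_def by blast
      obtain S where S: "S \<in> C" "A \<subseteq> S"
        using finite_subset_Union_chain[OF A(1,2) ne ch] by blast
      hence "lin_dep S" using A unfolding lin_dep_def by blast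
      thus False using S C by blast
    qed
    thus "\<Union>C \<in> ?I" using C by blast
  qed
  then obtain B where B: "B \<in> ?I" "\<forall>X\<in>?I. B \<subseteq> X \<longrightarrow> X = B" by (rule bexE)
  hence "maximal B (\<lambda>S. S \<subseteq> carrier V \<and> lin_indpt S)"
    by (simp add: maximal_def)
  thus ?thesis using max_li_is_basis by blast
qed

lemma lin_indpt_card_le:
  assumes "finite F" "F \<subseteq> carrier V" "lin_indpt L" "L \<subseteq> span F"
  shows "finite L" "card L \<le> card F"
proof -
  have le: "card A \<le> card F" if "finite A" "A \<subseteq> L" for A
  proof -
    have "lin_indpt A" "A \<subseteq> span F" using that assms lin_indpt_subset by blast+
    from replacement[OF that(1) assms(1,2) this] show ?thesis by linarith
  qed
  show "finite L"
  proof (rule ccontr)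
    assume "infinite L"
    then obtain A where "finite A" "card A = Suc (card F)" "A \<subseteq> L"
      using infinite_arbitrarily_large by blast
    thus False using le[of A] by simp
  qed
  thus "card L \<le> card F" using le by blast
qed

text \<open>For infinite \<open>B\<close> the exchange argument is replaced by counting: every element of \<open>L\<close> lies in
  the span of a finite subset of \<open>B\<close>, each such span contains only finitely many elements of \<open>L\<close>, and
  \<open>B\<close> has only \<open>|B|\<close> finite subsets.\<close>
lemma lin_indpt_ordLeq_basis:
  assumes B: "basis B" and L: "lin_indpt L" "L \<subseteq> carrier V"
  shows "|L| \<le>o |B|"
proof (cases "finite B")
  case True
  have "finite L" "card L \<le> card B"
    using lin_indpt_card_le[of B L] True B L by (auto simp: basis_def)
  hence "\<exists>f. inj_on f L \<and> f ` L \<subseteq> B"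
    using inj_on_iff_card_le[of L B] True by simp
  thus ?thesis by (simp only: card_of_ordLeq)
next
  case False
  have "\<exists>F. F \<in> Fpow B \<and> v \<in> span F" if "v \<in> L" for v
  proof -
    have "v \<in> span B" using that B L by (auto simp: basis_def)
    then obtain a A where A: "v = lincomb a A" "finite A" "A \<subseteq> B" "a \<in> A \<rightarrow> carrier K"
      unfolding span_def by blast
    hence "v \<in> span A" unfolding span_def by blast
    thus ?thesis using A by (auto simp: Fpow_def)
  qed
  then obtain F where F: "\<And>v. v \<in> L \<Longrightarrow> F v \<in> Fpow B \<and> v \<in> span (F v)" by metis
  have fib: "finite {v \<in> L. F v = G}" if "G \<in> Fpow B" for G
  proof (rule lin_indpt_card_le(1)[of G])
    show "finite G" "G \<subseteq> carrier V" using that B by (auto simp: Fpow_def basis_def)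
    show "lin_indpt {v \<in> L. F v = G}" using L lin_indpt_subset by (metis Collect_restrict)
    show "{v \<in> L. F v = G} \<subseteq> span G" using F by blast
  qed
  have "|L| \<le>o |\<Union>G\<in>Fpow B. {v \<in> L. F v = G}|"
    by (rule card_of_mono1) (use F in blast)
  also have "|\<Union>G\<in>Fpow B. {v \<in> L. F v = G}| \<le>o |B|"
  proof (rule card_of_UNION_ordLeq_infinite[OF False])
    show "|Fpow B| \<le>o |B|" by (rule ordIso_imp_ordLeq[OF card_of_Fpow_infinite[OF False]])
    show "\<forall>G\<in>Fpow B. |{v \<in> L. F v = G}| \<le>o |B|"
      by (intro ballI ordLess_imp_ordLeq finite_ordLess_infinite2 fib False)
  qed
  finally show ?thesis .
qed

lemma lin_dep_obtain_span:
  assumes "lin_dep S" "S \<subseteq> carrier V"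
  obtains v where "v \<in> S" "v \<in> span (S - {v})"
proof -
  obtain A a v where A: "finite A" "A \<subseteq> S" "a \<in> A \<rightarrow> carrier K" "lincomb a A = \<zero>\<^bsub>V\<^esub>" "v \<in> A" "a v \<noteq> \<zero>\<^bsub>K\<^esub>"
    using assms(1) unfolding lin_dep_def by blast
  have "v \<in> span (A - {v})"
    by (rule lincomb_isolate(2)[OF A(1) _ A(3,5,6,4)]) (use A assms in blast)
  moreover have "span (A - {v}) \<subseteq> span (S - {v})"
    by (rule span_is_monotone) (use A in blast)
  ultimately show ?thesis using that A by blast
qed

lemma lin_indpt_not_in_span:
  assumes "lin_indpt S" "S \<subseteq> carrier V" "v \<in> S"
  shows "v \<notin> span (S - {v})"
proof -
  have "lin_indpt (S - {v})" using assms lin_indpt_subset by blast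
  from lin_dep_iff_in_span[OF _ this, of v] assms show ?thesis
    by (simp add: insert_absorb) blast
qed

end

section \<open>Extending homomorphisms into an injective module\<close>
lemma module_hom_zero:
  assumes "module R M" "module R N" "f \<in> module_hom R M N"
  shows "f \<zero>\<^bsub>M\<^esub> = \<zero>\<^bsub>N\<^esub>"
proof -
  interpret mod_hom R M N f using assms by (simp add: mod_hom_def mod_hom_axioms_def)
  show ?thesis by simp
qed

lemma module_hom_diff:
  assumes "module R M" "module R N" "f \<in> module_hom R M N" "x \<in> carrier M" "y \<in> carrier M"
  shows "f (x \<ominus>\<^bsub>M\<^esub> y) = f x \<ominus>\<^bsub>N\<^esub> f y"
proof -
  interpret mod_hom R M N f using assms by (simp add: mod_hom_def mod_hom_axioms_def)
  show ?thesis using assms by simp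
qed

lemma (in module) smult_diff_distr:
  "\<lbrakk>a \<in> carrier R; b \<in> carrier R; x \<in> carrier M\<rbrakk> \<Longrightarrow> (a \<ominus>\<^bsub>R\<^esub> b) \<odot>\<^bsub>M\<^esub> x = a \<odot>\<^bsub>M\<^esub> x \<ominus>\<^bsub>M\<^esub> b \<odot>\<^bsub>M\<^esub> x"
  by (simp only: a_minus_def smult_l_distr smult_l_minus R.a_inv_closed)

lemma (in module) smult_diff_distr_r:
  "\<lbrakk>a \<in> carrier R; y \<in> carrier M; x \<in> carrier M\<rbrakk> \<Longrightarrow> a \<odot>\<^bsub>M\<^esub> (y \<ominus>\<^bsub>M\<^esub> x) = a \<odot>\<^bsub>M\<^esub> y \<ominus>\<^bsub>M\<^esub> a \<odot>\<^bsub>M\<^esub> x"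
  by (simp only: a_minus_def smult_r_distr smult_r_minus M.a_inv_closed)

lemma submodule_minus:
  assumes "submodule R N M" "x \<in> N" "y \<in> N"
  shows "x \<ominus>\<^bsub>M\<^esub> y \<in> N"
proof -
  interpret N: submodule R N M by (rule assms)
  interpret module R M by (rule N.module)
  have y: "y \<in> carrier M" using assms(3) N.subset by blast
  have "(\<ominus>\<^bsub>R\<^esub> \<one>\<^bsub>R\<^esub>) \<odot>\<^bsub>M\<^esub> y \<in> N" using assms(3) by (intro N.smult_closed) simp_all
  hence "\<ominus>\<^bsub>M\<^esub> y \<in> N" unfolding smult_minus_1[OF y] .
  thus ?thesis using assms(2) unfolding a_minus_def by blast
qed

lemma submodule_mod_eq:
  assumes "submodule R N M" "x \<in> carrier M" "y \<in> N" "x \<oplus>\<^bsub>M\<^esub> y \<in> N"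
  shows "x \<in> N"
proof -
  interpret N: submodule R N M by (rule assms)
  interpret module R M by (rule N.module)
  have y: "y \<in> carrier M" using assms N.subset by auto
  have "(x \<oplus>\<^bsub>M\<^esub> y) \<ominus>\<^bsub>M\<^esub> y = x" using assms(2) y by (simp add: a_minus_def M.add.m_assoc M.r_neg)
  thus ?thesis using submodule_minus[OF assms(1,4,3)] by simp
qed

lemma module_cong:
  assumes "module R B" "carrier B' = carrier B" "ring.add B' = ring.add B" "ring.zero B' = ring.zero B"
    "smult B' = smult B"
  shows "module R B'"
proof -
  interpret module R B by (rule assms)
  have "abelian_group B'"
  proof (rule abelian_groupI)
    fix x assume "x \<in> carrier B'"
    thus "\<exists>y\<in>carrier B'. y \<oplus>\<^bsub>B'\<^esub> x = \<zero>\<^bsub>B'\<^esub>"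
      using M.l_neg M.a_inv_closed unfolding assms by blast
  qed (simp_all add: assms M.a_ac)
  thus ?thesis
    by (rule moduleI[OF is_cring])
      (simp_all add: assms smult_l_distr smult_r_distr smult_assoc1)
qed

text \<open>Injectivity, restated for a submodule of a module with an arbitrary record extension.\<close>
lemma extend_hom:
  fixes R :: "('r, 'b) ring_scheme" and B :: "('r, 'u, 'd) module_scheme"
  assumes inj: "injective_module TYPE('r) R E" and B: "module R B" and N: "submodule R N B"
    and f: "f \<in> module_hom R (B\<lparr>carrier := N\<rparr>) E"
  shows "\<exists>g \<in> module_hom R B E. \<forall>x \<in> N. g x = f x"
proof -
  have inj': "injective_module TYPE('u) R E" using inj by (rule injective_module_universe)
  define B' where "B' = module.truncate B"
  define A' where "A' = module.truncate (B\<lparr>carrier := N\<rparr>)"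
  have NB: "N \<subseteq> carrier B" using N by (simp add: submodule_def)
  have "module R B'" by (rule module_cong[OF B]) (simp_all add: B'_def module.defs)
  moreover have "module R A'"
    by (rule module_cong[OF module.submodule_is_module[OF B N]]) (simp_all add: A'_def module.defs)
  moreover have "id \<in> module_hom R A' B'" "f \<in> module_hom R A' E"
    using NB f by (auto simp: module_hom_def A'_def B'_def module.defs)
  ultimately obtain g where "g \<in> module_hom R B' E" "\<forall>x \<in> carrier A'. g (id x) = f x"
    using inj'[unfolded injective_module_def, THEN conjunct2, rule_format, of A' B' id f] by auto
  thus ?thesis by (auto simp: module_hom_def A'_def B'_def module.defs)
qed

text \<open>On \<open>N + R b\<close> the rule \<open>n + r b \<mapsto> r e\<close> is well defined exactly because the annihilator of \<open>b\<close>
  modulo \<open>N\<close> kills \<open>e\<close>. All homomorphisms into \<open>E\<close> with prescribed values below come from this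
  lemma.\<close>
lemma extend_hom_point:
  fixes R :: "('r, 'b) ring_scheme" and B :: "('r, 'u, 'd) module_scheme"
  assumes inj: "injective_module TYPE('r) R E" and N: "submodule R N B"
    and b: "b \<in> carrier B" and e: "e \<in> carrier E"
    and ann: "\<And>r. r \<in> carrier R \<Longrightarrow> r \<odot>\<^bsub>B\<^esub> b \<in> N \<Longrightarrow> r \<odot>\<^bsub>E\<^esub> e = \<zero>\<^bsub>E\<^esub>"
  shows "\<exists>g \<in> module_hom R B E. (\<forall>x \<in> N. g x = \<zero>\<^bsub>E\<^esub>) \<and> g b = e"
proof -
  interpret N: submodule R N B by (rule N)
  interpret B: module R B by (rule N.module)
  interpret E: module R E using inj by (simp add: injective_module_def)
  define P where "P y r \<longleftrightarrow> r \<in> carrier R \<and> (\<exists>n\<in>N. y = n \<oplus>\<^bsub>B\<^esub> r \<odot>\<^bsub>B\<^esub> b)" for y r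
  define N' where "N' = {y. \<exists>r. P y r}"
  define f where "f y = (SOME r. P y r) \<odot>\<^bsub>E\<^esub> e" for y
  have f_eq: "f y = r \<odot>\<^bsub>E\<^esub> e" if Pr: "P y r" for y r
  proof -
    define s where "s = (SOME r. P y r)"
    have Ps: "P y s" unfolding s_def by (rule someI[of _ r]) (rule Pr)
    then obtain n n' where n: "n \<in> N" "n' \<in> N" "r \<in> carrier R" "s \<in> carrier R"
      "y = n \<oplus>\<^bsub>B\<^esub> r \<odot>\<^bsub>B\<^esub> b" "y = n' \<oplus>\<^bsub>B\<^esub> s \<odot>\<^bsub>B\<^esub> b"
      using Pr Ps unfolding P_def by blast
    have c: "n \<in> carrier B" "n' \<in> carrier B" using n N.subset by auto
    have "(s \<ominus>\<^bsub>R\<^esub> r) \<odot>\<^bsub>B\<^esub> b = n \<ominus>\<^bsub>B\<^esub> n'"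
    proof -
      have "s \<odot>\<^bsub>B\<^esub> b = (n' \<oplus>\<^bsub>B\<^esub> s \<odot>\<^bsub>B\<^esub> b) \<ominus>\<^bsub>B\<^esub> n'"
        using c n(3,4) b by (simp add: a_minus_def B.M.a_ac B.M.r_neg1 B.M.r_neg2)
      also have "\<dots> = (n \<oplus>\<^bsub>B\<^esub> r \<odot>\<^bsub>B\<^esub> b) \<ominus>\<^bsub>B\<^esub> n'" using n(5,6) by simp
      finally show ?thesis
        unfolding B.smult_diff_distr[OF n(4,3) b] using c n(3,4) b
        by (simp add: a_minus_def B.M.a_ac B.M.r_neg B.M.r_neg1 B.M.r_neg2)
    qed
    also have "\<dots> \<in> N" using N n by (intro submodule_minus)
    finally have "(s \<ominus>\<^bsub>R\<^esub> r) \<odot>\<^bsub>E\<^esub> e = \<zero>\<^bsub>E\<^esub>" using ann n by simp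
    hence "s \<odot>\<^bsub>E\<^esub> e = r \<odot>\<^bsub>E\<^esub> e"
      using n e by (simp add: E.smult_diff_distr)
    thus ?thesis by (simp add: f_def s_def)
  qed
  have P_add: "P (y \<oplus>\<^bsub>B\<^esub> y') (r \<oplus>\<^bsub>R\<^esub> r')" if PP: "P y r" "P y' r'" for y y' r r'
  proof -
    obtain n n' where n: "n \<in> N" "n' \<in> N" "y = n \<oplus>\<^bsub>B\<^esub> r \<odot>\<^bsub>B\<^esub> b" "y' = n' \<oplus>\<^bsub>B\<^esub> r' \<odot>\<^bsub>B\<^esub> b"
      and r: "r \<in> carrier R" "r' \<in> carrier R" using PP unfolding P_def by blast
    have c: "n \<in> carrier B" "n' \<in> carrier B" using n N.subset by auto
    have "y \<oplus>\<^bsub>B\<^esub> y' = (n \<oplus>\<^bsub>B\<^esub> n') \<oplus>\<^bsub>B\<^esub> (r \<oplus>\<^bsub>R\<^esub> r') \<odot>\<^bsub>B\<^esub> b"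
      using n(3,4) c r b by (simp add: B.smult_l_distr B.M.a_ac)
    thus ?thesis using n r unfolding P_def by auto
  qed
  have P_smult: "P (s \<odot>\<^bsub>B\<^esub> y) (s \<otimes>\<^bsub>R\<^esub> r)" if Pr: "P y r" and s: "s \<in> carrier R" for y r s
  proof -
    obtain n where n: "n \<in> N" "y = n \<oplus>\<^bsub>B\<^esub> r \<odot>\<^bsub>B\<^esub> b"
      and r: "r \<in> carrier R" using Pr unfolding P_def by blast
    have c: "n \<in> carrier B" using n N.subset by auto
    have "s \<odot>\<^bsub>B\<^esub> y = s \<odot>\<^bsub>B\<^esub> n \<oplus>\<^bsub>B\<^esub> (s \<otimes>\<^bsub>R\<^esub> r) \<odot>\<^bsub>B\<^esub> b"
      using n(2) c r b s by (simp add: B.smult_r_distr B.smult_assoc1)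
    thus ?thesis using n r s unfolding P_def by auto
  qed
  have P_N: "P x \<zero>\<^bsub>R\<^esub>" if "x \<in> N" for x
    using that b N.subset unfolding P_def by (auto intro!: bexI[of _ x])
  have P_b: "P b \<one>\<^bsub>R\<^esub>"
    using b unfolding P_def by (auto intro!: bexI[of _ "\<zero>\<^bsub>B\<^esub>"])
  have P_closed: "y \<in> carrier B \<and> r \<in> carrier R" if "P y r" for y r
    using that N.subset b unfolding P_def by auto
  have "submodule R N' B"
  proof (rule submodule.intro[OF N.module])
    show "N' \<subseteq> carrier B" using P_closed by (auto simp: N'_def)
    show "\<zero>\<^bsub>B\<^esub> \<in> N'" using P_N[OF N.zero_closed] by (auto simp: N'_def)
  qed (use P_add P_smult in \<open>unfold N'_def, blast+\<close>)
  moreover have "f \<in> module_hom R (B\<lparr>carrier := N'\<rparr>) E"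
    unfolding module_hom_def
  proof (intro CollectI conjI allI impI)
    show "f \<in> carrier (B\<lparr>carrier := N'\<rparr>) \<rightarrow> carrier E"
      using P_closed e f_eq by (auto simp: N'_def)
    fix y y' assume "y \<in> carrier (B\<lparr>carrier := N'\<rparr>) \<and> y' \<in> carrier (B\<lparr>carrier := N'\<rparr>)"
    then obtain r r' where r: "P y r" "P y' r'" by (auto simp: N'_def)
    show "f (y \<oplus>\<^bsub>B\<lparr>carrier := N'\<rparr>\<^esub> y') = f y \<oplus>\<^bsub>E\<^esub> f y'"
      using f_eq[OF r(1)] f_eq[OF r(2)] f_eq[OF P_add[OF r]] P_closed[OF r(1)] P_closed[OF r(2)] e
      by (simp add: E.smult_l_distr)
  next
    fix s y assume a: "s \<in> carrier R \<and> y \<in> carrier (B\<lparr>carrier := N'\<rparr>)"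
    then obtain r where r: "P y r" by (auto simp: N'_def)
    show "f (s \<odot>\<^bsub>B\<lparr>carrier := N'\<rparr>\<^esub> y) = s \<odot>\<^bsub>E\<^esub> f y"
      using f_eq[OF r] f_eq[OF P_smult[OF r]] a P_closed[OF r] e
      by (simp add: E.smult_assoc1)
  qed
  ultimately obtain g where g: "g \<in> module_hom R B E" "\<forall>x \<in> N'. g x = f x"
    using extend_hom[OF inj N.module] by blast
  have "g x = \<zero>\<^bsub>E\<^esub>" if "x \<in> N" for x
    using g(2) f_eq[OF P_N[OF that]] P_N[OF that] e by (auto simp: N'_def)
  moreover have "g b = e"
    using g(2) f_eq[OF P_b] P_b e by (auto simp: N'_def)
  ultimately show ?thesis using g(1) by blast
qed

section \<open>Powers and modules of homomorphisms\<close>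

definition power_module ::
  "'i set \<Rightarrow> ('r, 'n, 'd) module_scheme \<Rightarrow> ('r, 'i \<Rightarrow> 'n) module" where
  "power_module I N =
    \<lparr>carrier = I \<rightarrow>\<^sub>E carrier N, mult = undefined, one = undefined,
     ring.zero = (\<lambda>i\<in>I. \<zero>\<^bsub>N\<^esub>),
     ring.add = (\<lambda>f g. \<lambda>i\<in>I. f i \<oplus>\<^bsub>N\<^esub> g i),
     smult = (\<lambda>r f. \<lambda>i\<in>I. r \<odot>\<^bsub>N\<^esub> f i)\<rparr>"

lemma power_module_module:
  assumes "module R N"
  shows "module R (power_module I N)"
proof -
  interpret N: module R N by (rule assms)
  have ext: "f = g" if "f \<in> I \<rightarrow>\<^sub>E carrier N" "g \<in> extensional I" "\<And>i. i \<in> I \<Longrightarrow> f i = g i" for f g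
    using that by (auto simp: PiE_def intro!: extensionalityI)
  have "abelian_group (power_module I N)"
  proof (rule abelian_groupI)
    fix f assume f: "f \<in> carrier (power_module I N)"
    show "\<exists>g\<in>carrier (power_module I N). g \<oplus>\<^bsub>power_module I N\<^esub> f = \<zero>\<^bsub>power_module I N\<^esub>"
      by (rule bexI[of _ "\<lambda>i\<in>I. \<ominus>\<^bsub>N\<^esub> f i"])
        (use f in \<open>auto simp: power_module_def N.M.l_neg PiE_iff intro!: restrict_ext\<close>)
    show "\<zero>\<^bsub>power_module I N\<^esub> \<oplus>\<^bsub>power_module I N\<^esub> f = f"
      using f by (auto simp: power_module_def PiE_iff extensional_def fun_eq_iff)
  qed (auto simp: power_module_def PiE_iff N.M.a_ac intro!: restrict_ext)
  thus ?thesis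
  proof (rule moduleI[OF N.is_cring])
    fix f assume f: "f \<in> carrier (power_module I N)"
    show "\<one>\<^bsub>R\<^esub> \<odot>\<^bsub>power_module I N\<^esub> f = f"
      using f by (auto simp: power_module_def PiE_iff extensional_def fun_eq_iff)
  qed (auto simp: power_module_def PiE_iff N.smult_l_distr N.smult_r_distr N.smult_assoc1
      intro!: restrict_ext)
qed

lemma hom_module_module:
  assumes "module R M" "module R N"
  shows "module R (hom_module R M N)"
proof -
  interpret M: module R M by (rule assms)
  interpret N: module R N by (rule assms)
  let ?P = "power_module (carrier M) N"
  let ?H = "module_hom R M N \<inter> extensional (carrier M)"
  have P: "module R ?P" by (rule power_module_module[OF assms(2)])
  have eq: "hom_module R M N = ?P\<lparr>carrier := ?H\<rparr>"
    by (simp add: hom_module_def power_module_def)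
  have "submodule R ?H ?P"
    by (rule submodule.intro[OF P])
      (auto simp: power_module_def module_hom_def N.M.a_ac N.smult_r_distr PiE_def Pi_def
        N.smult_assoc1[symmetric] M.m_comm)
  thus ?thesis unfolding eq by (rule module.submodule_is_module[OF P])
qed

section \<open>Noetherian and local rings\<close>

lemma (in noetherian_ring) maximal_ideal_in_family:
  assumes "\<I> \<noteq> {}" "\<And>I. I \<in> \<I> \<Longrightarrow> ideal I R"
  shows "\<exists>I\<in>\<I>. \<forall>J\<in>\<I>. I \<subseteq> J \<longrightarrow> J = I"
proof (rule subset_Zorn_nonempty[OF assms(1)])
  fix C assume C: "C \<noteq> {}" "subset.chain \<I> C"
  hence "subset.chain {I. ideal I R} C" using assms(2) by (auto simp: subset_chain_def)
  from ideal_chain_is_trivial[OF C(1) this] show "\<Union>C \<in> \<I>"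
    using C(2) by (auto simp: subset_chain_def)
qed

lemma (in noetherian_local_ring) nonunit_in_maximal:
  assumes r: "r \<in> carrier R" "r \<notin> Units R"
  shows "r \<in> \<mm>"
proof -
  let ?F = "{I. ideal I R \<and> r \<in> I \<and> \<one> \<notin> I}"
  have "\<one> \<notin> PIdl r"
  proof
    assume "\<one> \<in> PIdl r"
    then obtain x where "x \<in> carrier R" "\<one> = x \<otimes> r" by (auto simp: cgenideal_def)
    hence "r \<in> Units R" using r by (auto simp: Units_def m_comm intro!: bexI[of _ x])
    thus False using r by simp
  qed
  hence "PIdl r \<in> ?F" using cgenideal_ideal cgenideal_self r by blast
  hence ne: "?F \<noteq> {}" by blast
  obtain J where J: "J \<in> ?F" "\<forall>I\<in>?F. J \<subseteq> I \<longrightarrow> I = J"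
    using maximal_ideal_in_family[OF ne] by auto
  have "maximalideal J R"
  proof (rule maximalidealI)
    show "ideal J R" using J by simp
    show "carrier R \<noteq> J" using J by auto
    fix I assume I: "ideal I R" "J \<subseteq> I" "I \<subseteq> carrier R"
    show "I = J \<or> I = carrier R"
    proof (cases "\<one> \<in> I")
      case True
      thus ?thesis using ideal.one_imp_carrier[OF I(1)] by simp
    next
      case False
      hence "I \<in> ?F" using I J by auto
      thus ?thesis using J I by blast
    qed
  qed
  thus ?thesis using unique_maximal J by auto
qed

definition colon_ideal ::
  "('r, 'b) ring_scheme \<Rightarrow> 'n set \<Rightarrow> ('r, 'n, 'c) module_scheme \<Rightarrow> 'n \<Rightarrow> 'r set" where
  "colon_ideal R N M z = {r \<in> carrier R. r \<odot>\<^bsub>M\<^esub> z \<in> N}"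

lemma colon_ideal_ideal:
  assumes N: "submodule R N M" and z: "z \<in> carrier M"
  shows "ideal (colon_ideal R N M z) R"
proof -
  interpret N: submodule R N M by (rule N)
  interpret module R M by (rule N.module)
  show ?thesis
  proof (rule idealI[OF R.ring_axioms])
    show "subgroup (colon_ideal R N M z) (add_monoid R)"
    proof (rule R.add.subgroupI)
      fix a assume a: "a \<in> colon_ideal R N M z"
      have "(\<zero>\<^bsub>R\<^esub> \<ominus>\<^bsub>R\<^esub> a) \<odot>\<^bsub>M\<^esub> z \<in> N"
        using a z by (simp add: colon_ideal_def smult_diff_distr submodule_minus[OF N])
      thus "\<ominus>\<^bsub>R\<^esub> a \<in> colon_ideal R N M z"
        using a by (simp add: colon_ideal_def a_minus_def)
    qed (use z in \<open>auto simp: colon_ideal_def smult_l_distr intro!: exI[of _ "\<zero>\<^bsub>R\<^esub>"]\<close>)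
    fix a x assume a: "a \<in> colon_ideal R N M z" and x: "x \<in> carrier R"
    thus xa: "x \<otimes>\<^bsub>R\<^esub> a \<in> colon_ideal R N M z" using z by (simp add: colon_ideal_def smult_assoc1)
    thus "a \<otimes>\<^bsub>R\<^esub> x \<in> colon_ideal R N M z" using a x by (simp add: colon_ideal_def R.m_comm)
  qed
qed

text \<open>The colon ideals of elements outside \<open>N\<close> are the annihilators of the nonzero elements of the
  quotient by \<open>N\<close>; so this says that a nonzero quotient has an associated prime. As usual,
  a maximal annihilator is prime.\<close>
lemma exists_prime_colon_ideal:
  fixes R (structure)
  assumes "noetherian_ring R" and N: "submodule R N M" and z: "z \<in> carrier M - N"
  shows "\<exists>y\<in>carrier M - N. primeideal (colon_ideal R N M y) R"
proof -
  interpret noetherian_ring R by (rule assms)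
  interpret N: submodule R N M by (rule N)
  interpret M: module R M by (rule N.module)
  let ?F = "colon_ideal R N M ` (carrier M - N)"
  have ne: "?F \<noteq> {}" using z by blast
  have id: "ideal I R" if "I \<in> ?F" for I using that colon_ideal_ideal[OF N] by auto
  obtain I where I: "I \<in> ?F" "\<forall>J\<in>?F. I \<subseteq> J \<longrightarrow> J = I"
    using maximal_ideal_in_family[OF ne id] by auto
  then obtain y where y: "y \<in> carrier M - N" "I = colon_ideal R N M y" by blast
  have "primeideal I R"
  proof (rule primeidealI[OF _ M.is_cring])
    show "ideal I R" using id I by blast
    show "carrier R \<noteq> I"
    proof
      assume "carrier R = I"
      hence "\<one> \<in> colon_ideal R N M y" using y by auto
      thus False using y by (simp add: colon_ideal_def)
    qed
    fix a b assume a: "a \<in> carrier R" and b: "b \<in> carrier R" and ab: "a \<otimes> b \<in> I"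
    show "a \<in> I \<or> b \<in> I"
    proof (cases "a \<in> I")
      case False
      hence ay: "a \<odot>\<^bsub>M\<^esub> y \<in> carrier M - N" using a y by (auto simp: colon_ideal_def)
      have "I \<subseteq> colon_ideal R N M (a \<odot>\<^bsub>M\<^esub> y)"
      proof
        fix r assume "r \<in> I"
        hence r: "r \<in> carrier R" "r \<odot>\<^bsub>M\<^esub> y \<in> N" using y by (auto simp: colon_ideal_def)
        have "r \<odot>\<^bsub>M\<^esub> (a \<odot>\<^bsub>M\<^esub> y) = a \<odot>\<^bsub>M\<^esub> (r \<odot>\<^bsub>M\<^esub> y)"
          using r a y by (simp add: M.smult_assoc1[symmetric] M.m_comm)
        thus "r \<in> colon_ideal R N M (a \<odot>\<^bsub>M\<^esub> y)" using r a by (simp add: colon_ideal_def)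
      qed
      hence "colon_ideal R N M (a \<odot>\<^bsub>M\<^esub> y) = I" using I(2) ay by blast
      moreover have "b \<in> colon_ideal R N M (a \<odot>\<^bsub>M\<^esub> y)"
        using ab a b y by (simp add: colon_ideal_def M.smult_assoc1[symmetric] M.m_comm)
      ultimately show ?thesis by simp
    qed simp
  qed
  thus ?thesis using y by blast
qed

section \<open>Families independent modulo a prime\<close>

text \<open>For a prime \<open>\<pp>\<close> this is linear independence over \<open>R/\<pp>\<close> of a family in \<open>{y \<in> M. \<pp> y = 0}\<close>. The
  condition is imposed on one member at a time, relative to the span of the others: homomorphisms
  then transport it by mapping spans to spans, without manipulating finite sums.\<close>
definition independent_mod ::
  "('r, 'b) ring_scheme \<Rightarrow> 'r set \<Rightarrow> ('r, 'm, 'd) module_scheme \<Rightarrow> ('i \<Rightarrow> 'm) \<Rightarrow> 'i set \<Rightarrow> bool" where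
  "independent_mod R \<pp> M x I \<longleftrightarrow>
    (\<forall>i\<in>I. x i \<in> carrier M \<and> (\<forall>a\<in>\<pp>. a \<odot>\<^bsub>M\<^esub> x i = \<zero>\<^bsub>M\<^esub>) \<and>
      (\<forall>r\<in>carrier R. r \<odot>\<^bsub>M\<^esub> x i \<in> module.span R M (x ` (I - {i})) \<longrightarrow> r \<in> \<pp>))"

lemma independent_mod_hom:
  assumes M: "module R M" and M': "module R M'" and h: "h \<in> module_hom R M M'"
    and inj: "inj_on h (carrier M)" and p: "\<pp> \<subseteq> carrier R" and ind: "independent_mod R \<pp> M x I"
  shows "independent_mod R \<pp> M' (h \<circ> x) I"
proof -
  interpret h: mod_hom R M M' h using M M' h by (simp add: mod_hom_def mod_hom_axioms_def)
  have x: "x ` J \<subseteq> carrier M" if "J \<subseteq> I" for J using ind that by (auto simp: independent_mod_def)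
  have span: "module.span R M' ((h \<circ> x) ` J) \<subseteq> h ` module.span R M (x ` J)" if "J \<subseteq> I" for J
  proof (rule module.span_is_subset[OF M'])
    have sub: "submodule R (module.span R M (x ` J)) M"
      by (rule module.span_is_submodule[OF M x[OF that]])
    interpret s: submodule R "module.span R M (x ` J)" M by (rule sub)
    have s_sub: "y \<in> carrier M" if "y \<in> module.span R M (x ` J)" for y using that s.subset by blast
    show "(h \<circ> x) ` J \<subseteq> h ` module.span R M (x ` J)"
      using module.in_own_span[OF M x[OF that]] by auto
    show "submodule R (h ` module.span R M (x ` J)) M'"
    proof (rule submodule.intro[OF M'])
      show "h ` module.span R M (x ` J) \<subseteq> carrier M'" using s_sub by auto
      show "\<zero>\<^bsub>M'\<^esub> \<in> h ` module.span R M (x ` J)" by (rule image_eqI[of _ _ "\<zero>\<^bsub>M\<^esub>"]) simp_all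
    next
      fix v w assume "v \<in> h ` module.span R M (x ` J)" "w \<in> h ` module.span R M (x ` J)"
      then obtain v' w' where "v = h v'" "w = h w'" "v' \<in> module.span R M (x ` J)" "w' \<in> module.span R M (x ` J)"
        by blast
      thus "v \<oplus>\<^bsub>M'\<^esub> w \<in> h ` module.span R M (x ` J)"
        using s_sub by (intro image_eqI[of _ _ "v' \<oplus>\<^bsub>M\<^esub> w'"]) simp_all
    next
      fix c v assume c: "c \<in> carrier R" and "v \<in> h ` module.span R M (x ` J)"
      then obtain v' where "v = h v'" "v' \<in> module.span R M (x ` J)" by blast
      thus "c \<odot>\<^bsub>M'\<^esub> v \<in> h ` module.span R M (x ` J)"
        using s_sub c by (intro image_eqI[of _ _ "c \<odot>\<^bsub>M\<^esub> v'"]) simp_all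
    qed
  qed
  show ?thesis
    unfolding independent_mod_def
  proof (intro ballI conjI impI)
    fix i assume i: "i \<in> I"
    have xi: "x i \<in> carrier M" using ind i by (simp add: independent_mod_def)
    thus "(h \<circ> x) i \<in> carrier M'" by simp
    show "a \<odot>\<^bsub>M'\<^esub> (h \<circ> x) i = \<zero>\<^bsub>M'\<^esub>" if a: "a \<in> \<pp>" for a
    proof -
      have "a \<odot>\<^bsub>M\<^esub> x i = \<zero>\<^bsub>M\<^esub>" using ind i a by (simp add: independent_mod_def)
      moreover have "a \<odot>\<^bsub>M'\<^esub> h (x i) = h (a \<odot>\<^bsub>M\<^esub> x i)" using a p xi by (auto simp: h.f_smult)
      ultimately show ?thesis by simp
    qed
    fix r assume r: "r \<in> carrier R" "r \<odot>\<^bsub>M'\<^esub> (h \<circ> x) i \<in> module.span R M' ((h \<circ> x) ` (I - {i}))"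
    then obtain y where y: "y \<in> module.span R M (x ` (I - {i}))" "r \<odot>\<^bsub>M'\<^esub> h (x i) = h y"
      using span[of "I - {i}"] by auto
    have "y \<in> carrier M" using y(1) module.span_is_subset2[OF M x[of "I - {i}"]] by blast
    hence "r \<odot>\<^bsub>M\<^esub> x i = y"
      using y(2) r(1) xi by (intro inj_onD[OF inj]) (simp_all add: h.f_smult)
    thus "r \<in> \<pp>" using ind i r(1) y(1) by (auto simp: independent_mod_def)
  qed
qed

lemma (in module) span_insert_subset:
  assumes X: "X \<subseteq> carrier M" and y: "y \<in> carrier M"
  shows "span (insert y X) \<subseteq> {v \<oplus>\<^bsub>M\<^esub> a \<odot>\<^bsub>M\<^esub> y |v a. v \<in> span X \<and> a \<in> carrier R}" (is "_ \<subseteq> ?S")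
proof (rule span_is_subset)
  interpret s: submodule R "span X" M by (rule span_is_submodule[OF X])
  have sub: "v \<in> carrier M" if "v \<in> span X" for v using that s.subset by blast
  show "insert y X \<subseteq> ?S"
  proof
    fix v assume "v \<in> insert y X"
    thus "v \<in> ?S"
    proof
      assume "v = y"
      thus ?thesis using y by (auto intro!: exI[of _ "\<zero>\<^bsub>M\<^esub>"] exI[of _ "\<one>\<^bsub>R\<^esub>"])
    next
      assume "v \<in> X"
      hence "v \<in> span X" using in_own_span[OF X] by blast
      thus ?thesis using y sub by (auto intro!: exI[of _ "v"] exI[of _ "\<zero>\<^bsub>R\<^esub>"])
    qed
  qed
  show "submodule R ?S M"
  proof (rule submodule.intro[OF module_axioms])
    show "?S \<subseteq> carrier M" using sub y by auto
    show "\<zero>\<^bsub>M\<^esub> \<in> ?S" using y by (auto intro!: exI[of _ "\<zero>\<^bsub>M\<^esub>"] exI[of _ "\<zero>\<^bsub>R\<^esub>"])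
  next
    fix v w assume "v \<in> ?S" "w \<in> ?S"
    then obtain v' a w' b where *: "v = v' \<oplus>\<^bsub>M\<^esub> a \<odot>\<^bsub>M\<^esub> y" "w = w' \<oplus>\<^bsub>M\<^esub> b \<odot>\<^bsub>M\<^esub> y"
      "v' \<in> span X" "w' \<in> span X" "a \<in> carrier R" "b \<in> carrier R" by blast
    hence "v \<oplus>\<^bsub>M\<^esub> w = (v' \<oplus>\<^bsub>M\<^esub> w') \<oplus>\<^bsub>M\<^esub> (a \<oplus>\<^bsub>R\<^esub> b) \<odot>\<^bsub>M\<^esub> y"
      using y sub[OF *(3)] sub[OF *(4)] by (simp add: smult_l_distr M.a_ac)
    thus "v \<oplus>\<^bsub>M\<^esub> w \<in> ?S" using * by blast
  next
    fix c v assume c: "c \<in> carrier R" and "v \<in> ?S"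
    then obtain v' a where *: "v = v' \<oplus>\<^bsub>M\<^esub> a \<odot>\<^bsub>M\<^esub> y" "v' \<in> span X" "a \<in> carrier R" by blast
    hence "c \<odot>\<^bsub>M\<^esub> v = c \<odot>\<^bsub>M\<^esub> v' \<oplus>\<^bsub>M\<^esub> (c \<otimes>\<^bsub>R\<^esub> a) \<odot>\<^bsub>M\<^esub> y"
      using y c sub[OF *(2)] by (simp add: smult_r_distr smult_assoc1)
    thus "c \<odot>\<^bsub>M\<^esub> v \<in> ?S" using * c by blast
  qed
qed

lemma independent_mod_insert:
  assumes M: "module R M" and ind: "independent_mod R \<pp> M x I"
    and y: "y \<in> carrier M" "\<And>a. a \<in> \<pp> \<Longrightarrow> a \<odot>\<^bsub>M\<^esub> y = \<zero>\<^bsub>M\<^esub>"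
    and out: "\<And>r. r \<in> carrier R \<Longrightarrow> r \<odot>\<^bsub>M\<^esub> y \<in> module.span R M (x ` I) \<Longrightarrow> r \<in> \<pp>"
  shows "independent_mod R \<pp> M (case_option y x) (insert None (Some ` I))"
proof -
  interpret module R M by (rule M)
  have x: "x ` J \<subseteq> carrier M" if "J \<subseteq> I" for J using ind that by (auto simp: independent_mod_def)
  have main: "r \<in> \<pp>" if i: "i \<in> I" and r: "r \<in> carrier R"
    and rs: "r \<odot>\<^bsub>M\<^esub> x i \<in> span (insert y (x ` (I - {i})))" for i r
  proof -
    have xi: "x i \<in> carrier M" using x i by auto
    obtain v a where v: "r \<odot>\<^bsub>M\<^esub> x i = v \<oplus>\<^bsub>M\<^esub> a \<odot>\<^bsub>M\<^esub> y" "v \<in> span (x ` (I - {i}))" "a \<in> carrier R"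
      using span_insert_subset[OF x[of "I - {i}"] y(1)] rs by blast
    have sI: "submodule R (span (x ` I)) M" by (rule span_is_submodule[OF x]) simp
    have vI: "v \<in> span (x ` I)" using v(2) span_is_monotone[of "x ` (I - {i})" "x ` I"] by blast
    have "x i \<in> span (x ` I)" using in_own_span[OF x] i by blast
    hence "r \<odot>\<^bsub>M\<^esub> x i \<in> span (x ` I)" by (rule submodule.smult_closed[OF sI r])
    moreover have vM: "v \<in> carrier M" using vI submodule.subset[OF sI] by blast
    ultimately have "a \<odot>\<^bsub>M\<^esub> y \<oplus>\<^bsub>M\<^esub> v \<in> span (x ` I)"
      using v(1) M.a_comm[OF vM smult_closed[OF v(3) y(1)]] by simp
    hence "a \<odot>\<^bsub>M\<^esub> y \<in> span (x ` I)"
      by (rule submodule_mod_eq[OF sI smult_closed[OF v(3) y(1)] vI])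
    hence "a \<in> \<pp>" using out v(3) by blast
    hence "r \<odot>\<^bsub>M\<^esub> x i = v" using v(1) y(2) vM by simp
    thus ?thesis using ind i r v(2) by (auto simp: independent_mod_def)
  qed
  have none: "case_option y x ` (insert None (Some ` I) - {None}) = x ` I"
    by (auto simp: image_iff)
  have some: "case_option y x ` (insert None (Some ` I) - {Some i}) = insert y (x ` (I - {i}))" for i
  proof -
    have "insert None (Some ` I) - {Some i} = insert None (Some ` (I - {i}))" by auto
    thus ?thesis by (simp add: image_image)
  qed
  show ?thesis
    unfolding independent_mod_def
  proof
    fix j assume "j \<in> insert None (Some ` I)"
    then consider "j = None" | i where "j = Some i" "i \<in> I" by blast
    thus "case_option y x j \<in> carrier M \<and> (\<forall>a\<in>\<pp>. a \<odot>\<^bsub>M\<^esub> case_option y x j = \<zero>\<^bsub>M\<^esub>) \<and>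
      (\<forall>r\<in>carrier R. r \<odot>\<^bsub>M\<^esub> case_option y x j
        \<in> span (case_option y x ` (insert None (Some ` I) - {j})) \<longrightarrow> r \<in> \<pp>)"
    proof cases
      case 1
      show ?thesis unfolding 1 none using y out by simp
    next
      case (2 i)
      have "x i \<in> carrier M" "\<forall>a\<in>\<pp>. a \<odot>\<^bsub>M\<^esub> x i = \<zero>\<^bsub>M\<^esub>"
        using ind 2(2) by (simp_all add: independent_mod_def)
      thus ?thesis unfolding 2(1) some option.case using main[OF 2(2)] by blast
    qed
  qed
qed

section \<open>Matlis duality\<close>

locale injective_cogenerator = module R E
  for R :: "('r, 'b) ring_scheme" (structure) and E :: "('r, 'e, 'c) module_scheme" +
  fixes e0
  assumes injective: "injective_module TYPE('r) R E"
    and e0_closed: "e0 \<in> carrier E" and e0_nonzero: "e0 \<noteq> \<zero>\<^bsub>E\<^esub>"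
    and e0_nonunits: "r \<in> carrier R \<Longrightarrow> r \<notin> Units R \<Longrightarrow> r \<odot>\<^bsub>E\<^esub> e0 = \<zero>\<^bsub>E\<^esub>"
begin

text \<open>A nonzero element of a quotient generates a cyclic module, which maps onto the residue field
  and hence into \<open>E\<close> with \<open>e0\<close> as the image of the generator: if \<open>r b \<in> N\<close> and \<open>b \<notin> N\<close> then \<open>r\<close> is not a
  unit, so \<open>r e0 = 0\<close>.\<close>
lemma separating_hom:
  assumes N: "submodule R N B" and b: "b \<in> carrier B" "b \<notin> N"
  shows "\<exists>g\<in>module_hom R B E. (\<forall>x\<in>N. g x = \<zero>\<^bsub>E\<^esub>) \<and> g b \<noteq> \<zero>\<^bsub>E\<^esub>"
proof -
  interpret N: submodule R N B by (rule N)
  interpret B: module R B by (rule N.module)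
  have "\<exists>g\<in>module_hom R B E. (\<forall>x\<in>N. g x = \<zero>\<^bsub>E\<^esub>) \<and> g b = e0"
  proof (rule extend_hom_point[OF injective N b(1) e0_closed])
    fix r assume r: "r \<in> carrier R" "r \<odot>\<^bsub>B\<^esub> b \<in> N"
    have "r \<notin> Units R"
    proof
      assume u: "r \<in> Units R"
      have "inv r \<odot>\<^bsub>B\<^esub> (r \<odot>\<^bsub>B\<^esub> b) \<in> N"
        by (rule N.smult_closed[OF Units_inv_closed[OF u] r(2)])
      hence "b \<in> N" using u r b by (simp add: B.smult_assoc1[symmetric])
      thus False using b by simp
    qed
    thus "r \<odot>\<^bsub>E\<^esub> e0 = \<zero>\<^bsub>E\<^esub>" by (rule e0_nonunits[OF r(1)])
  qed
  thus ?thesis using e0_nonzero by auto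
qed

text \<open>Separating \<open>a\<close> from \<open>I\<close> by a homomorphism \<open>R \<rightarrow> E\<close> and taking the image of \<open>1\<close>.\<close>
lemma faithful_mod_ideal:
  assumes I: "ideal I R" and a: "a \<in> carrier R - I"
  shows "\<exists>e\<in>carrier E. (\<forall>b\<in>I. b \<odot>\<^bsub>E\<^esub> e = \<zero>\<^bsub>E\<^esub>) \<and> a \<odot>\<^bsub>E\<^esub> e \<noteq> \<zero>\<^bsub>E\<^esub>"
proof -
  interpret I: ideal I R by (rule I)
  have "submodule R I (regular_module R)"
    by (rule submodule.intro[OF regular_module_module[OF is_cring]])
      (simp_all add: regular_module_def I.I_l_closed I.a_closed I.zero_closed subsetI I.Icarr)
  then obtain g where g: "g \<in> module_hom R (regular_module R) E" "\<forall>x\<in>I. g x = \<zero>\<^bsub>E\<^esub>" "g a \<noteq> \<zero>\<^bsub>E\<^esub>"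
    using separating_hom[of I "regular_module R" a] a by (auto simp: regular_module_def)
  have *: "g b = b \<odot>\<^bsub>E\<^esub> g \<one>" if "b \<in> carrier R" for b
    using module_hom_smult[OF g(1), of b \<one>] that by (simp add: regular_module_def)
  have "g \<one> \<in> carrier E" using module_hom_closed[OF g(1)] by (auto simp: regular_module_def)
  moreover have "\<forall>b\<in>I. b \<odot>\<^bsub>E\<^esub> g \<one> = \<zero>\<^bsub>E\<^esub>" using g(2) * I.Icarr by metis
  moreover have "a \<odot>\<^bsub>E\<^esub> g \<one> \<noteq> \<zero>\<^bsub>E\<^esub>" using g(3) * a by (metis DiffD1)
  ultimately show ?thesis by blast
qed

end

locale matlis_module = injective_cogenerator R E e0 + M: module R M
  for R :: "('r, 'b) ring_scheme" (structure) and E :: "('r, 'e, 'c) module_scheme" and e0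
    and M :: "('r, 'm, 'd) module_scheme"
begin

abbreviation D where "D \<equiv> matlis_dual R E M"
abbreviation DD where "DD \<equiv> matlis_bidual R E M"
abbreviation \<phi> where "\<phi> \<equiv> matlis_map R E M"

lemma dual_module: "module R D"
  unfolding matlis_dual_def by (rule hom_module_module[OF M.module_axioms module_axioms])

lemma bidual_module: "module R DD"
  unfolding matlis_bidual_def matlis_dual_def[of R E "matlis_dual R E M"]
  by (rule hom_module_module[OF dual_module module_axioms])

sublocale D: module R D by (rule dual_module)
sublocale DD: module R DD by (rule bidual_module)

lemma dual_hom: "f \<in> carrier D \<Longrightarrow> f \<in> module_hom R M E"
  by (simp add: matlis_dual_def hom_module_def)

lemma bidual_hom: "z \<in> carrier DD \<Longrightarrow> z \<in> module_hom R D E"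
  by (simp add: matlis_bidual_def matlis_dual_def[of R E D] hom_module_def)

lemma dual_closed: "f \<in> carrier D \<Longrightarrow> x \<in> carrier M \<Longrightarrow> f x \<in> carrier E"
  using dual_hom module_hom_closed by blast

lemma dual_ext: "\<lbrakk>f \<in> carrier D; g \<in> carrier D; \<And>x. x \<in> carrier M \<Longrightarrow> f x = g x\<rbrakk> \<Longrightarrow> f = g"
  by (auto simp: matlis_dual_def hom_module_def intro: extensionalityI)

lemma bidual_ext: "\<lbrakk>z \<in> carrier DD; w \<in> carrier DD; \<And>f. f \<in> carrier D \<Longrightarrow> z f = w f\<rbrakk> \<Longrightarrow> z = w"
  by (auto simp: matlis_bidual_def matlis_dual_def[of R E D] hom_module_def intro: extensionalityI)

lemma dual_add: "x \<in> carrier M \<Longrightarrow> (f \<oplus>\<^bsub>D\<^esub> g) x = f x \<oplus>\<^bsub>E\<^esub> g x"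
  and dual_smult: "x \<in> carrier M \<Longrightarrow> (a \<odot>\<^bsub>D\<^esub> f) x = a \<odot>\<^bsub>E\<^esub> f x"
  and dual_zero: "x \<in> carrier M \<Longrightarrow> \<zero>\<^bsub>D\<^esub> x = \<zero>\<^bsub>E\<^esub>"
  by (simp_all add: matlis_dual_def hom_module_def)

lemma bidual_add: "f \<in> carrier D \<Longrightarrow> (z \<oplus>\<^bsub>DD\<^esub> w) f = z f \<oplus>\<^bsub>E\<^esub> w f"
  and bidual_smult: "f \<in> carrier D \<Longrightarrow> (a \<odot>\<^bsub>DD\<^esub> z) f = a \<odot>\<^bsub>E\<^esub> z f"
  and bidual_zero: "f \<in> carrier D \<Longrightarrow> \<zero>\<^bsub>DD\<^esub> f = \<zero>\<^bsub>E\<^esub>"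
  by (simp_all add: matlis_bidual_def matlis_dual_def[of R E D] hom_module_def)

lemma restrict_dual: "g \<in> module_hom R M E \<Longrightarrow> restrict g (carrier M) \<in> carrier D"
  by (auto simp: matlis_dual_def hom_module_def module_hom_def)

lemma restrict_bidual: "z \<in> module_hom R D E \<Longrightarrow> restrict z (carrier D) \<in> carrier DD"
  by (auto simp: matlis_bidual_def matlis_dual_def[of R E D] hom_module_def module_hom_def)

lemma matlis_map_apply: "f \<in> carrier D \<Longrightarrow> \<phi> x f = f x"
  by (simp add: matlis_map_def)

lemma matlis_map_closed: "x \<in> carrier M \<Longrightarrow> \<phi> x \<in> carrier DD"
  unfolding matlis_map_def
  by (rule restrict_bidual) (auto simp: module_hom_def dual_closed dual_add dual_smult)

lemma matlis_map_hom: "\<phi> \<in> module_hom R M DD"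
  unfolding module_hom_def
proof (intro CollectI conjI allI impI)
  show "\<phi> \<in> carrier M \<rightarrow> carrier DD" using matlis_map_closed by blast
  fix x y assume "x \<in> carrier M \<and> y \<in> carrier M"
  thus "\<phi> (x \<oplus>\<^bsub>M\<^esub> y) = \<phi> x \<oplus>\<^bsub>DD\<^esub> \<phi> y"
    by (intro bidual_ext)
      (simp_all add: matlis_map_closed bidual_add matlis_map_apply module_hom_add[OF dual_hom])
next
  fix a x assume "a \<in> carrier R \<and> x \<in> carrier M"
  thus "\<phi> (a \<odot>\<^bsub>M\<^esub> x) = a \<odot>\<^bsub>DD\<^esub> \<phi> x"
    by (intro bidual_ext)
      (simp_all add: matlis_map_closed bidual_smult matlis_map_apply module_hom_smult[OF dual_hom])
qed

lemma matlis_map_inj: "inj_on \<phi> (carrier M)"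
proof (rule inj_onI, rule ccontr)
  fix x y assume x: "x \<in> carrier M" and y: "y \<in> carrier M" and eq: "\<phi> x = \<phi> y" and ne: "x \<noteq> y"
  have "submodule R {\<zero>\<^bsub>M\<^esub>} M" by (rule submodule.intro[OF M.module_axioms]) auto
  moreover have "x \<ominus>\<^bsub>M\<^esub> y \<notin> {\<zero>\<^bsub>M\<^esub>}" using x y ne by simp
  ultimately obtain g where g: "g \<in> module_hom R M E" "g (x \<ominus>\<^bsub>M\<^esub> y) \<noteq> \<zero>\<^bsub>E\<^esub>"
    using separating_hom[of "{\<zero>\<^bsub>M\<^esub>}" M "x \<ominus>\<^bsub>M\<^esub> y"] x y by auto
  have "\<phi> x (restrict g (carrier M)) = \<phi> y (restrict g (carrier M))" using eq by simp
  hence "g x = g y" using x y by (simp add: matlis_map_apply[OF restrict_dual[OF g(1)]])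
  moreover have "g x \<in> carrier E" "g y \<in> carrier E" using module_hom_closed[OF g(1)] x y by auto
  ultimately have "g (x \<ominus>\<^bsub>M\<^esub> y) = \<zero>\<^bsub>E\<^esub>"
    using module_hom_diff[OF M.module_axioms module_axioms g(1) x y] by simp
  thus False using g(2) by simp
qed

lemma range_submodule: "submodule R (\<phi> ` carrier M) DD"
proof -
  interpret p: mod_hom R M DD \<phi>
    using matlis_map_hom M.module_axioms DD.module_axioms by (simp add: mod_hom_def mod_hom_axioms_def)
  show ?thesis using p.im_is_submodule by (simp add: p.im_def)
qed

text \<open>Let \<open>Y\<close> be the row \<open>(y a)\<close>, \<open>a \<in> A\<close>, in \<open>M\<close>, where \<open>\<phi> (y a) = a z\<close>. If \<open>Y\<close> is not one of the rows
  \<open>(a x)\<close> with \<open>x \<in> M\<close>, then a homomorphism \<open>g\<close> from the power of \<open>M\<close> with exponent \<open>A\<close> to \<open>E\<close> separates it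
  from them. Let \<open>g a\<close>, in the dual of \<open>M\<close>, be the restriction of \<open>g\<close> to the coordinate \<open>a\<close>. Then
  \<open>\<Sum>a\<in>A. a (g a)\<close> vanishes, because \<open>g\<close> kills the rows \<open>(a x)\<close>, and
  applying \<open>z\<close> to it gives \<open>\<Sum>a\<in>A. (a z) (g a) = \<Sum>a\<in>A. g a (y a) = g Y \<noteq> 0\<close>.\<close>
lemma matlis_map_pure:
  assumes z: "z \<in> carrier DD" and A: "finite A" "A \<subseteq> carrier R"
    and az: "\<And>a. a \<in> A \<Longrightarrow> a \<odot>\<^bsub>DD\<^esub> z \<in> \<phi> ` carrier M"
  shows "\<exists>x\<in>carrier M. \<forall>a\<in>A. a \<odot>\<^bsub>DD\<^esub> z = \<phi> (a \<odot>\<^bsub>M\<^esub> x)"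
proof -
  have "\<forall>a\<in>A. \<exists>x. x \<in> carrier M \<and> a \<odot>\<^bsub>DD\<^esub> z = \<phi> x" using az by blast
  then obtain y where y: "\<And>a. a \<in> A \<Longrightarrow> y a \<in> carrier M" "\<And>a. a \<in> A \<Longrightarrow> a \<odot>\<^bsub>DD\<^esub> z = \<phi> (y a)"
    by metis
  define P where "P = power_module A M"
  have P: "module R P" unfolding P_def by (rule power_module_module[OF M.module_axioms])
  define N where "N = (\<lambda>x. \<lambda>a\<in>A. a \<odot>\<^bsub>M\<^esub> x) ` carrier M"
  define Y where "Y = (\<lambda>a\<in>A. y a)"
  have Y: "Y \<in> carrier P" using y by (auto simp: Y_def P_def power_module_def)
  have N: "submodule R N P"
  proof (rule submodule.intro[OF P])
    show "N \<subseteq> carrier P" using A by (auto simp: N_def P_def power_module_def)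
    show "\<zero>\<^bsub>P\<^esub> \<in> N"
      unfolding N_def P_def power_module_def
      using A by (intro image_eqI[of _ _ "\<zero>\<^bsub>M\<^esub>"]) (auto intro!: restrict_ext)
  next
    fix v w assume "v \<in> N" "w \<in> N"
    then obtain x x' where "x \<in> carrier M" "x' \<in> carrier M" "v = (\<lambda>a\<in>A. a \<odot>\<^bsub>M\<^esub> x)" "w = (\<lambda>a\<in>A. a \<odot>\<^bsub>M\<^esub> x')"
      unfolding N_def by blast
    thus "v \<oplus>\<^bsub>P\<^esub> w \<in> N"
      unfolding N_def P_def power_module_def
      using A by (intro image_eqI[of _ _ "x \<oplus>\<^bsub>M\<^esub> x'"]) (auto intro!: restrict_ext simp: M.smult_r_distr subset_iff)
  next
    fix c v assume "c \<in> carrier R" "v \<in> N"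
    then obtain x where "c \<in> carrier R" "x \<in> carrier M" "v = (\<lambda>a\<in>A. a \<odot>\<^bsub>M\<^esub> x)"
      unfolding N_def by blast
    thus "c \<odot>\<^bsub>P\<^esub> v \<in> N"
      unfolding N_def P_def power_module_def
      using A by (intro image_eqI[of _ _ "c \<odot>\<^bsub>M\<^esub> x"])
        (auto intro!: restrict_ext simp: M.smult_assoc1[symmetric] m_comm subset_iff)
  qed
  have "Y \<in> N"
  proof (rule ccontr)
    assume "Y \<notin> N"
    then obtain g where g: "g \<in> module_hom R P E" "\<forall>v\<in>N. g v = \<zero>\<^bsub>E\<^esub>" "g Y \<noteq> \<zero>\<^bsub>E\<^esub>"
      using separating_hom[OF N Y] by blast
    define cut where "cut F v = (\<lambda>a\<in>A. if a \<in> F then v a else \<zero>\<^bsub>M\<^esub>)" for F v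
    have cut_closed: "cut F v \<in> carrier P" if "v \<in> A \<rightarrow> carrier M" for F v
      using that by (auto simp: cut_def P_def power_module_def)
    have cut_insert: "cut (insert b F) v = cut F v \<oplus>\<^bsub>P\<^esub> cut {b} v" if "b \<notin> F" "v \<in> A \<rightarrow> carrier M" for b F v
      using that by (auto simp: cut_def P_def power_module_def Pi_def intro!: restrict_ext)
    have row: "(\<lambda>a. a \<odot>\<^bsub>M\<^esub> x) \<in> A \<rightarrow> carrier M" if "x \<in> carrier M" for x using that A by auto
    have yA: "y \<in> A \<rightarrow> carrier M" using y by blast
    \<comment> \<open>\<open>h\<close> is the partial sum of the functionals \<open>a (g a)\<close> over \<open>a \<in> F\<close>.\<close>
    have ind: "\<exists>h\<in>carrier D. (\<forall>x\<in>carrier M. h x = g (cut F (\<lambda>a. a \<odot>\<^bsub>M\<^esub> x))) \<and> z h = g (cut F y)"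
      if "F \<subseteq> A" for F
      using finite_subset[OF that A(1)] that
    proof (induction F)
      case empty
      have "cut {} v = \<zero>\<^bsub>P\<^esub>" for v by (simp add: cut_def P_def power_module_def)
      moreover have "z \<zero>\<^bsub>D\<^esub> = \<zero>\<^bsub>E\<^esub>" by (rule module_hom_zero[OF dual_module module_axioms bidual_hom[OF z]])
      ultimately show ?case
        using module_hom_zero[OF P module_axioms g(1)] dual_zero by (intro bexI[of _ "\<zero>\<^bsub>D\<^esub>"]) simp_all
    next
      case (insert b F)
      then obtain h where h: "h \<in> carrier D" "\<And>x. x \<in> carrier M \<Longrightarrow> h x = g (cut F (\<lambda>a. a \<odot>\<^bsub>M\<^esub> x))" "z h = g (cut F y)"
        by auto
      have b: "b \<in> A" "b \<in> carrier R" using insert.prems A by auto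
      define k where "k = (\<lambda>m\<in>carrier M. g (cut {b} (\<lambda>_. m)))"
      have k: "k \<in> carrier D"
        unfolding k_def
      proof (rule restrict_dual, unfold module_hom_def, intro CollectI conjI allI impI)
        show "(\<lambda>m. g (cut {b} (\<lambda>_. m))) \<in> carrier M \<rightarrow> carrier E"
          using module_hom_closed[OF g(1)] cut_closed by (auto simp: Pi_iff)
        fix m m' assume m: "m \<in> carrier M \<and> m' \<in> carrier M"
        have "cut {b} (\<lambda>_. m \<oplus>\<^bsub>M\<^esub> m') = cut {b} (\<lambda>_. m) \<oplus>\<^bsub>P\<^esub> cut {b} (\<lambda>_. m')"
          using m by (auto simp: cut_def P_def power_module_def intro!: restrict_ext)
        thus "g (cut {b} (\<lambda>_. m \<oplus>\<^bsub>M\<^esub> m')) = g (cut {b} (\<lambda>_. m)) \<oplus>\<^bsub>E\<^esub> g (cut {b} (\<lambda>_. m'))"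
          using m by (simp add: module_hom_add[OF g(1)] cut_closed)
      next
        fix r m assume m: "r \<in> carrier R \<and> m \<in> carrier M"
        have "cut {b} (\<lambda>_. r \<odot>\<^bsub>M\<^esub> m) = r \<odot>\<^bsub>P\<^esub> cut {b} (\<lambda>_. m)"
          using m by (auto simp: cut_def P_def power_module_def intro!: restrict_ext)
        thus "g (cut {b} (\<lambda>_. r \<odot>\<^bsub>M\<^esub> m)) = r \<odot>\<^bsub>E\<^esub> g (cut {b} (\<lambda>_. m))"
          using m by (simp add: module_hom_smult[OF g(1)] cut_closed)
      qed
      have k_eq: "k (v b) = g (cut {b} v)" if "v \<in> A \<rightarrow> carrier M" for v
      proof -
        have "cut {b} (\<lambda>_. v b) = cut {b} v" by (auto simp: cut_def intro!: restrict_ext)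
        thus ?thesis using that b by (auto simp: k_def)
      qed
      let ?h = "h \<oplus>\<^bsub>D\<^esub> b \<odot>\<^bsub>D\<^esub> k"
      have "?h x = g (cut (insert b F) (\<lambda>a. a \<odot>\<^bsub>M\<^esub> x))" if x: "x \<in> carrier M" for x
      proof -
        have "?h x = h x \<oplus>\<^bsub>E\<^esub> k (b \<odot>\<^bsub>M\<^esub> x)"
          using x b by (simp add: dual_add dual_smult module_hom_smult[OF dual_hom[OF k]])
        thus ?thesis
          unfolding cut_insert[OF insert.hyps(2) row[OF x]]
          using h(2)[OF x] k_eq[OF row[OF x]] row[OF x]
          by (simp add: module_hom_add[OF g(1)] cut_closed)
      qed
      moreover have "z ?h = g (cut (insert b F) y)"
      proof -
        have "z ?h = z h \<oplus>\<^bsub>E\<^esub> b \<odot>\<^bsub>E\<^esub> z k"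
          using h k b by (simp add: module_hom_add[OF bidual_hom[OF z]] module_hom_smult[OF bidual_hom[OF z]])
        also have "b \<odot>\<^bsub>E\<^esub> z k = (b \<odot>\<^bsub>DD\<^esub> z) k" using k by (simp add: bidual_smult)
        also have "\<dots> = k (y b)" using y(2)[OF b(1)] k by (simp add: matlis_map_apply)
        finally show ?thesis
          unfolding cut_insert[OF insert.hyps(2) yA]
          using h(3) k_eq[OF yA] yA
          by (simp add: module_hom_add[OF g(1)] cut_closed)
      qed
      moreover have "?h \<in> carrier D" using h k b by simp
      ultimately show ?case by blast
    qed
    obtain h where h: "h \<in> carrier D" "\<And>x. x \<in> carrier M \<Longrightarrow> h x = g (cut A (\<lambda>a. a \<odot>\<^bsub>M\<^esub> x))" "z h = g (cut A y)"
      using ind[of A] by auto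
    have cutA: "cut A v = restrict v A" for v by (auto simp: cut_def intro!: restrict_ext)
    have "h = \<zero>\<^bsub>D\<^esub>"
    proof (rule dual_ext[OF h(1)])
      fix x assume x: "x \<in> carrier M"
      hence "cut A (\<lambda>a. a \<odot>\<^bsub>M\<^esub> x) \<in> N" by (auto simp: cutA N_def)
      thus "h x = \<zero>\<^bsub>D\<^esub> x" using g(2) h(2)[OF x] x by (simp add: dual_zero)
    qed simp
    hence "z h = \<zero>\<^bsub>E\<^esub>" using module_hom_zero[OF dual_module module_axioms bidual_hom[OF z]] by simp
    thus False using h(3) g(3) by (simp add: cutA Y_def)
  qed
  then obtain x where x: "x \<in> carrier M" "Y = (\<lambda>a\<in>A. a \<odot>\<^bsub>M\<^esub> x)" unfolding N_def by blast
  have "y a = a \<odot>\<^bsub>M\<^esub> x" if "a \<in> A" for a using fun_cong[OF x(2), of a] that by (simp add: Y_def)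
  thus ?thesis using x(1) y(2) by auto
qed

end

section \<open>Large independent families in the bidual\<close>

text \<open>The independent family of Fichtenholz, Kantorovich and Hausdorff. The points of \<open>I\<close> are
  identified with pairs of a finite subset \<open>F\<close> of \<open>I\<close> and a finite set of finite subsets of \<open>I\<close>, and
  \<open>S T\<close> consists of the pairs whose second component contains \<open>T \<inter> F\<close>. A finite \<open>F\<close> which tells
  \<open>T\<close> from each member of \<open>\<T>\<close>, paired with \<open>{T \<inter> F}\<close>, is the required point.\<close>
lemma exists_independent_subsets:
  assumes inf: "infinite I"
  obtains S :: "'i set \<Rightarrow> 'i set" where
    "\<And>T \<T>. finite \<T> \<Longrightarrow> T \<notin> \<T> \<Longrightarrow> T \<subseteq> I \<Longrightarrow> \<T> \<subseteq> Pow I \<Longrightarrow> \<exists>i\<in>I. i \<in> S T \<and> (\<forall>T'\<in>\<T>. i \<notin> S T')"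
proof -
  have F: "|Fpow I| =o |I|" by (rule card_of_Fpow_infinite[OF inf])
  hence infF: "infinite (Fpow I)" using inf card_of_ordIso_finite by blast
  have "|Fpow (Fpow I)| =o |I|"
    using card_of_Fpow_infinite[OF infF] F ordIso_transitive by blast
  hence "|Fpow (Fpow I)| \<le>o |Fpow I|"
    using F ordIso_symmetric ordIso_transitive ordIso_imp_ordLeq by blast
  hence "|Fpow I \<times> Fpow (Fpow I)| =o |Fpow I|"
    using infF Fpow_not_empty by (intro card_of_Times_infinite[THEN conjunct1])
  hence "|Fpow I \<times> Fpow (Fpow I)| =o |I|" using F ordIso_transitive by blast
  then obtain h where h: "bij_betw h (Fpow I \<times> Fpow (Fpow I)) I"
    using card_of_ordIso by blast
  define S where "S T = {h (F, \<F>) |F \<F>. F \<in> Fpow I \<and> \<F> \<in> Fpow (Fpow I) \<and> T \<inter> F \<in> \<F>}" for T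
  have S: "h (F, \<F>) \<in> S T \<longleftrightarrow> T \<inter> F \<in> \<F>" if "F \<in> Fpow I" "\<F> \<in> Fpow (Fpow I)" for T F \<F>
  proof
    assume "h (F, \<F>) \<in> S T"
    then obtain F' \<F>' where *: "h (F, \<F>) = h (F', \<F>')" "F' \<in> Fpow I" "\<F>' \<in> Fpow (Fpow I)" "T \<inter> F' \<in> \<F>'"
      unfolding S_def by blast
    have "(F, \<F>) = (F', \<F>')"
      by (rule inj_onD[OF bij_betw_imp_inj_on[OF h] *(1)]) (use that * in auto)
    thus "T \<inter> F \<in> \<F>" using * by simp
  next
    assume "T \<inter> F \<in> \<F>"
    thus "h (F, \<F>) \<in> S T" unfolding S_def using that by blast
  qed
  show ?thesis
  proof (rule that[of S])
    fix T \<T> assume T: "finite \<T>" "T \<notin> \<T>" "T \<subseteq> I" "\<T> \<subseteq> Pow I"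
    have "\<forall>T'\<in>\<T>. \<exists>i\<in>I. (i \<in> T) \<noteq> (i \<in> T')"
    proof
      fix T' assume "T' \<in> \<T>"
      hence "T' \<noteq> T" "T' \<subseteq> I" using T(2,4) by auto
      thus "\<exists>i\<in>I. (i \<in> T) \<noteq> (i \<in> T')" using T(3) by auto
    qed
    then obtain d where d: "\<And>T'. T' \<in> \<T> \<Longrightarrow> d T' \<in> I \<and> (d T' \<in> T) \<noteq> (d T' \<in> T')" by metis
    define F where "F = d ` \<T>"
    have F: "F \<in> Fpow I" using d T by (auto simp: F_def Fpow_def)
    have \<F>: "{T \<inter> F} \<in> Fpow (Fpow I)" using F by (auto simp: Fpow_def)
    have "h (F, {T \<inter> F}) \<in> S T" using S[OF F \<F>] by simp
    moreover have "h (F, {T \<inter> F}) \<notin> S T'" if "T' \<in> \<T>" for T'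
    proof -
      have "d T' \<in> F" using that by (simp add: F_def)
      hence "T' \<inter> F \<noteq> T \<inter> F" using d[OF that] by blast
      thus ?thesis using S[OF F \<F>] by simp
    qed
    moreover have "h (F, {T \<inter> F}) \<in> I" by (rule bij_betw_apply[OF h SigmaI[OF F \<F>]])
    ultimately show "\<exists>i\<in>I. i \<in> S T \<and> (\<forall>T'\<in>\<T>. i \<notin> S T')" by blast
  qed
qed

context matlis_module
begin

lemma exists_dual_functional:
  assumes ind: "independent_mod R \<pp> M x I" and i: "i \<in> I"
    and e: "e \<in> carrier E" "\<And>a. a \<in> \<pp> \<Longrightarrow> a \<odot>\<^bsub>E\<^esub> e = \<zero>\<^bsub>E\<^esub>"
  shows "\<exists>f\<in>carrier D. f (x i) = e \<and> (\<forall>j\<in>I - {i}. f (x j) = \<zero>\<^bsub>E\<^esub>)"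
proof -
  have x: "x j \<in> carrier M" if "j \<in> I" for j using ind that by (simp add: independent_mod_def)
  let ?X = "x ` (I - {i})"
  have X: "?X \<subseteq> carrier M" using x by auto
  have "r \<odot>\<^bsub>E\<^esub> e = \<zero>\<^bsub>E\<^esub>" if "r \<in> carrier R" "r \<odot>\<^bsub>M\<^esub> x i \<in> module.span R M ?X" for r
    using ind i that e(2) unfolding independent_mod_def by blast
  then obtain g where g: "g \<in> module_hom R M E" "\<forall>y\<in>module.span R M ?X. g y = \<zero>\<^bsub>E\<^esub>" "g (x i) = e"
    using extend_hom_point[OF injective module.span_is_submodule[OF M.module_axioms X] x[OF i] e(1)]
    by blast
  have "g (x j) = \<zero>\<^bsub>E\<^esub>" if "j \<in> I - {i}" for j
    using g(2) module.in_own_span[OF M.module_axioms X] that by blast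
  thus ?thesis
    using g(3) x i by (intro bexI[OF _ restrict_dual[OF g(1)]]) auto
qed

text \<open>The sum of the \<open>f (x i)\<close> over \<open>i \<in> S\<close> makes sense on the submodule \<open>W\<close> of those \<open>f\<close> which vanish at almost all
  \<open>x i\<close>, and is extended to the whole dual. Every extension \<open>z\<close> satisfies \<open>\<pp> z = 0\<close>: multiples of elements of the dual by elements of \<open>\<pp>\<close> vanish at all \<open>x i\<close>, so they
  already lie in \<open>W\<close>, where the sum gives \<open>0\<close>.\<close>
lemma exists_partial_sum_functional:
  assumes p: "\<pp> \<subseteq> carrier R" and x: "\<And>i. i \<in> I \<Longrightarrow> x i \<in> carrier M"
    and px: "\<And>i a. i \<in> I \<Longrightarrow> a \<in> \<pp> \<Longrightarrow> a \<odot>\<^bsub>M\<^esub> x i = \<zero>\<^bsub>M\<^esub>"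
  shows "\<exists>z\<in>carrier DD. (\<forall>a\<in>\<pp>. a \<odot>\<^bsub>DD\<^esub> z = \<zero>\<^bsub>DD\<^esub>) \<and>
    (\<forall>i\<in>I. \<forall>f\<in>carrier D. (\<forall>j\<in>I - {i}. f (x j) = \<zero>\<^bsub>E\<^esub>) \<longrightarrow> z f = (if i \<in> S then f (x i) else \<zero>\<^bsub>E\<^esub>))"
proof -
  define supp where "supp f = {i \<in> I. f (x i) \<noteq> \<zero>\<^bsub>E\<^esub>}" for f :: "'m \<Rightarrow> 'e"
  define \<sigma> where "\<sigma> f = finsum E (\<lambda>i. f (x i)) (supp f \<inter> S)" for f
  define W where "W = {f \<in> carrier D. finite (supp f)}"
  have fx: "f (x i) \<in> carrier E" if "f \<in> carrier D" "i \<in> I" for f i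
    using that x dual_closed by blast
  have \<sigma>_eq: "\<sigma> f = finsum E (\<lambda>i. f (x i)) (F \<inter> S)"
    if "f \<in> carrier D" "finite F" "supp f \<subseteq> F" "F \<subseteq> I" for f F
    unfolding \<sigma>_def
    by (rule add.finprod_mono_neutral_cong_left) (use that fx in \<open>auto simp: supp_def\<close>)
  have supp_add: "supp (f \<oplus>\<^bsub>D\<^esub> g) \<subseteq> supp f \<union> supp g" if "f \<in> carrier D" "g \<in> carrier D" for f g
    using that x by (auto simp: supp_def dual_add)
  have supp_smult: "supp (a \<odot>\<^bsub>D\<^esub> f) \<subseteq> supp f" if "a \<in> carrier R" "f \<in> carrier D" for a f
    using that x by (auto simp: supp_def dual_smult)
  have suppI: "supp f \<subseteq> I" for f by (auto simp: supp_def)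
  have W: "submodule R W D"
  proof (rule submodule.intro[OF dual_module])
    show "W \<subseteq> carrier D" by (auto simp: W_def)
    have "supp \<zero>\<^bsub>D\<^esub> = {}" using x by (auto simp: supp_def dual_zero)
    thus "\<zero>\<^bsub>D\<^esub> \<in> W" by (simp add: W_def)
  next
    fix v w assume "v \<in> W" "w \<in> W"
    thus "v \<oplus>\<^bsub>D\<^esub> w \<in> W" using supp_add[of v w] finite_subset by (auto simp: W_def)
  next
    fix c v assume "c \<in> carrier R" "v \<in> W"
    thus "c \<odot>\<^bsub>D\<^esub> v \<in> W" using supp_smult[of c v] finite_subset by (auto simp: W_def)
  qed
  have \<sigma>: "\<sigma> \<in> module_hom R (D\<lparr>carrier := W\<rparr>) E"
    unfolding module_hom_def
  proof (intro CollectI conjI allI impI)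
    show "\<sigma> \<in> carrier (D\<lparr>carrier := W\<rparr>) \<rightarrow> carrier E"
      unfolding \<sigma>_def using fx suppI by (auto simp: W_def intro!: finsum_closed)
    fix f g assume "f \<in> carrier (D\<lparr>carrier := W\<rparr>) \<and> g \<in> carrier (D\<lparr>carrier := W\<rparr>)"
    hence f: "f \<in> carrier D" "finite (supp f)" and g: "g \<in> carrier D" "finite (supp g)"
      by (auto simp: W_def)
    let ?F = "supp f \<union> supp g"
    have F: "finite ?F" "?F \<subseteq> I" using f g suppI by auto
    have "\<sigma> (f \<oplus>\<^bsub>D\<^esub> g) = finsum E (\<lambda>i. (f \<oplus>\<^bsub>D\<^esub> g) (x i)) (?F \<inter> S)"
      by (rule \<sigma>_eq) (use f g F supp_add in auto)
    also have "\<dots> = finsum E (\<lambda>i. f (x i) \<oplus>\<^bsub>E\<^esub> g (x i)) (?F \<inter> S)"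
      by (rule finsum_cong') (use f g F fx x in \<open>auto simp: dual_add\<close>)
    also have "\<dots> = finsum E (\<lambda>i. f (x i)) (?F \<inter> S) \<oplus>\<^bsub>E\<^esub> finsum E (\<lambda>i. g (x i)) (?F \<inter> S)"
      by (rule finsum_addf) (use f g F fx in auto)
    also have "\<dots> = \<sigma> f \<oplus>\<^bsub>E\<^esub> \<sigma> g" using \<sigma>_eq[OF f(1) F(1) _ F(2)] \<sigma>_eq[OF g(1) F(1) _ F(2)] by simp
    finally show "\<sigma> (f \<oplus>\<^bsub>D\<lparr>carrier := W\<rparr>\<^esub> g) = \<sigma> f \<oplus>\<^bsub>E\<^esub> \<sigma> g" by simp
  next
    fix a f assume "a \<in> carrier R \<and> f \<in> carrier (D\<lparr>carrier := W\<rparr>)"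
    hence a: "a \<in> carrier R" and f: "f \<in> carrier D" "finite (supp f)" by (auto simp: W_def)
    have sI: "i \<in> I" if "i \<in> supp f" for i using that suppI by blast
    have "\<sigma> (a \<odot>\<^bsub>D\<^esub> f) = finsum E (\<lambda>i. (a \<odot>\<^bsub>D\<^esub> f) (x i)) (supp f \<inter> S)"
      by (rule \<sigma>_eq) (use f a supp_smult suppI in auto)
    also have "\<dots> = finsum E (\<lambda>i. a \<odot>\<^bsub>E\<^esub> f (x i)) (supp f \<inter> S)"
      by (rule finsum_cong') (use f a sI fx x in \<open>auto simp: dual_smult\<close>)
    also have "\<dots> = a \<odot>\<^bsub>E\<^esub> \<sigma> f"
      unfolding \<sigma>_def by (rule finsum_smult[symmetric]) (use f a sI fx in auto)
    finally show "\<sigma> (a \<odot>\<^bsub>D\<lparr>carrier := W\<rparr>\<^esub> f) = a \<odot>\<^bsub>E\<^esub> \<sigma> f" by simp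
  qed
  obtain g where g: "g \<in> module_hom R D E" "\<forall>f\<in>W. g f = \<sigma> f"
    using extend_hom[OF injective dual_module W \<sigma>] by blast
  define z where "z = restrict g (carrier D)"
  have z: "z \<in> carrier DD" unfolding z_def by (rule restrict_bidual[OF g(1)])
  have zW: "z f = \<sigma> f" if "f \<in> W" for f using that g(2) by (auto simp: z_def W_def)
  have "a \<odot>\<^bsub>DD\<^esub> z = \<zero>\<^bsub>DD\<^esub>" if a: "a \<in> \<pp>" for a
  proof (rule bidual_ext)
    have aR: "a \<in> carrier R" using a p by blast
    show "a \<odot>\<^bsub>DD\<^esub> z \<in> carrier DD" using aR z by simp
    fix f assume f: "f \<in> carrier D"
    have "(a \<odot>\<^bsub>D\<^esub> f) (x i) = \<zero>\<^bsub>E\<^esub>" if "i \<in> I" for i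
    proof -
      have "(a \<odot>\<^bsub>D\<^esub> f) (x i) = f (a \<odot>\<^bsub>M\<^esub> x i)"
        using x[OF that] aR f by (simp add: dual_smult module_hom_smult[OF dual_hom[OF f]])
      also have "\<dots> = \<zero>\<^bsub>E\<^esub>"
        using px[OF that a] module_hom_zero[OF M.module_axioms module_axioms dual_hom[OF f]] by simp
      finally show ?thesis .
    qed
    hence s: "supp (a \<odot>\<^bsub>D\<^esub> f) = {}" by (auto simp: supp_def)
    have "(a \<odot>\<^bsub>DD\<^esub> z) f = z (a \<odot>\<^bsub>D\<^esub> f)"
      using f aR by (simp add: bidual_smult module_hom_smult[OF bidual_hom[OF z]])
    also have "\<dots> = \<sigma> (a \<odot>\<^bsub>D\<^esub> f)" by (rule zW) (use f aR s in \<open>simp add: W_def\<close>)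
    also have "\<dots> = \<zero>\<^bsub>E\<^esub>" by (simp add: \<sigma>_def s)
    finally show "(a \<odot>\<^bsub>DD\<^esub> z) f = \<zero>\<^bsub>DD\<^esub> f" using f by (simp add: bidual_zero)
  qed simp
  moreover have "z f = (if i \<in> S then f (x i) else \<zero>\<^bsub>E\<^esub>)"
    if i: "i \<in> I" and f: "f \<in> carrier D" and 0: "\<forall>j\<in>I - {i}. f (x j) = \<zero>\<^bsub>E\<^esub>" for i f
  proof -
    have s: "supp f \<subseteq> {i}" using 0 by (auto simp: supp_def)
    hence "finite (supp f)" using finite_subset by blast
    hence "z f = \<sigma> f" using f by (intro zW) (simp add: W_def)
    also have "\<dots> = finsum E (\<lambda>i. f (x i)) ({i} \<inter> S)" by (rule \<sigma>_eq) (use f s i in auto)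
    also have "\<dots> = (if i \<in> S then f (x i) else \<zero>\<^bsub>E\<^esub>)" using fx[OF f i] by simp
    finally show ?thesis .
  qed
  ultimately show ?thesis using z by blast
qed

text \<open>In a relation between \<open>a (z T)\<close> and finitely many other \<open>z T'\<close>, a point \<open>i\<close> of \<open>S T\<close> outside
  all these \<open>S T'\<close> is chosen. A functional with value \<open>e\<close> at \<open>x i\<close> and \<open>0\<close> at the other \<open>x j\<close> turns the
  relation into \<open>a e = 0\<close>, for every \<open>e \<in> E\<close> with \<open>\<pp> e = 0\<close>; hence \<open>a \<in> \<pp>\<close>.\<close>
lemma independent_mod_bidual_Pow:
  assumes p: "ideal \<pp> R" and ind: "independent_mod R \<pp> M x I" and inf: "infinite I"
  shows "\<exists>z. independent_mod R \<pp> DD z (Pow I)"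
proof -
  interpret p: ideal \<pp> R by (rule p)
  have pR: "\<pp> \<subseteq> carrier R" using p.Icarr by blast
  have x: "x i \<in> carrier M" "\<And>a. a \<in> \<pp> \<Longrightarrow> a \<odot>\<^bsub>M\<^esub> x i = \<zero>\<^bsub>M\<^esub>" if "i \<in> I" for i
    using ind that by (simp_all add: independent_mod_def)
  obtain S where S: "\<And>T \<T>. finite \<T> \<Longrightarrow> T \<notin> \<T> \<Longrightarrow> T \<subseteq> I \<Longrightarrow> \<T> \<subseteq> Pow I \<Longrightarrow>
      \<exists>i\<in>I. i \<in> S T \<and> (\<forall>T'\<in>\<T>. i \<notin> S T')"
    using exists_independent_subsets[OF inf] by metis
  have "\<forall>T. \<exists>z. z \<in> carrier DD \<and> (\<forall>a\<in>\<pp>. a \<odot>\<^bsub>DD\<^esub> z = \<zero>\<^bsub>DD\<^esub>) \<and>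
    (\<forall>i\<in>I. \<forall>f\<in>carrier D. (\<forall>j\<in>I - {i}. f (x j) = \<zero>\<^bsub>E\<^esub>) \<longrightarrow> z f = (if i \<in> S T then f (x i) else \<zero>\<^bsub>E\<^esub>))"
    by (intro allI exists_partial_sum_functional[OF pR x, unfolded Bex_def])
  from choice[OF this] obtain z where zz: "\<forall>T. z T \<in> carrier DD \<and> (\<forall>a\<in>\<pp>. a \<odot>\<^bsub>DD\<^esub> z T = \<zero>\<^bsub>DD\<^esub>) \<and>
    (\<forall>i\<in>I. \<forall>f\<in>carrier D. (\<forall>j\<in>I - {i}. f (x j) = \<zero>\<^bsub>E\<^esub>) \<longrightarrow> z T f = (if i \<in> S T then f (x i) else \<zero>\<^bsub>E\<^esub>))"
    by (rule exE)
  have z: "\<And>T. z T \<in> carrier DD" "\<And>T a. a \<in> \<pp> \<Longrightarrow> a \<odot>\<^bsub>DD\<^esub> z T = \<zero>\<^bsub>DD\<^esub>"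
    "\<And>T i f. i \<in> I \<Longrightarrow> f \<in> carrier D \<Longrightarrow> (\<forall>j\<in>I - {i}. f (x j) = \<zero>\<^bsub>E\<^esub>) \<Longrightarrow>
      z T f = (if i \<in> S T then f (x i) else \<zero>\<^bsub>E\<^esub>)"
    using zz[rule_format] by auto
  have "a \<in> \<pp>" if T: "T \<subseteq> I" and a: "a \<in> carrier R"
    and span: "a \<odot>\<^bsub>DD\<^esub> z T \<in> module.span R DD (z ` (Pow I - {T}))" for T a
  proof (rule ccontr)
    assume "a \<notin> \<pp>"
    then obtain e where e: "e \<in> carrier E" "\<And>b. b \<in> \<pp> \<Longrightarrow> b \<odot>\<^bsub>E\<^esub> e = \<zero>\<^bsub>E\<^esub>" "a \<odot>\<^bsub>E\<^esub> e \<noteq> \<zero>\<^bsub>E\<^esub>"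
      using faithful_mod_ideal[OF p] a by blast
    obtain A where A: "finite A" "A \<subseteq> z ` (Pow I - {T})" "a \<odot>\<^bsub>DD\<^esub> z T \<in> DD.span A"
      using span unfolding DD.span_def by blast
    obtain \<T> where \<T>: "\<T> \<subseteq> Pow I - {T}" "finite \<T>" "A = z ` \<T>"
      using finite_subset_image[OF A(1,2)] by blast
    obtain i where i: "i \<in> I" "i \<in> S T" "\<And>T'. T' \<in> \<T> \<Longrightarrow> i \<notin> S T'"
      using S[OF \<T>(2) _ T] \<T>(1) by blast
    obtain f where f: "f \<in> carrier D" "f (x i) = e" "\<forall>j\<in>I - {i}. f (x j) = \<zero>\<^bsub>E\<^esub>"
      using exists_dual_functional[OF ind i(1) e(1,2)] by blast
    have "DD.span A \<subseteq> {w \<in> carrier DD. w f = \<zero>\<^bsub>E\<^esub>}"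
    proof (rule DD.span_is_subset)
      show "A \<subseteq> {w \<in> carrier DD. w f = \<zero>\<^bsub>E\<^esub>}" using \<T> i(3) z(1) z(3)[OF i(1) f(1,3)] by auto
      show "submodule R {w \<in> carrier DD. w f = \<zero>\<^bsub>E\<^esub>} DD"
        by (rule submodule.intro[OF bidual_module])
          (use f(1) in \<open>auto simp: bidual_add bidual_smult bidual_zero\<close>)
    qed
    hence "(a \<odot>\<^bsub>DD\<^esub> z T) f = \<zero>\<^bsub>E\<^esub>" using A(3) by blast
    thus False using z(3)[OF i(1) f(1,3)] i(2) f(1,2) e(3) by (simp add: bidual_smult)
  qed
  thus ?thesis
    using z(1,2) unfolding independent_mod_def by (intro exI[of _ z]) blast
qed

end

section \<open>Localization\<close>

lemma abelian_group_cong: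
  assumes "abelian_group G" "carrier H = carrier G" "ring.add H = ring.add G" "ring.zero H = ring.zero G"
  shows "abelian_group H"
proof -
  interpret abelian_group G by (rule assms)
  show ?thesis
  proof (rule abelian_groupI)
    fix x assume "x \<in> carrier H"
    thus "\<exists>y\<in>carrier H. y \<oplus>\<^bsub>H\<^esub> x = \<zero>\<^bsub>H\<^esub>"
      using l_neg a_inv_closed unfolding assms by blast
  qed (simp_all add: assms a_ac)
qed

locale localization = module R N
  for R :: "('r, 'b) ring_scheme" (structure) and N :: "('r, 'n, 'c) module_scheme" +
  fixes S
  assumes denoms_carrier: "S \<subseteq> carrier R" and one_denom: "\<one> \<in> S"
    and mult_denom: "\<lbrakk>s \<in> S; t \<in> S\<rbrakk> \<Longrightarrow> s \<otimes> t \<in> S"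
begin

abbreviation fr where "fr x s \<equiv> fraction R S N x s"
abbreviation rfr where "rfr a s \<equiv> fraction R S (regular_module R) a s"
abbreviation L where "L \<equiv> localization_module R S N"
abbreviation LR where "LR \<equiv> localization_ring R S"

lemma denom_closed [simp, intro]: "s \<in> S \<Longrightarrow> s \<in> carrier R"
  using denoms_carrier by blast

lemma regular_localization: "localization R (regular_module R) S"
  by (simp add: localization_def localization_axioms_def regular_module_module[OF is_cring]
      denoms_carrier one_denom mult_denom)

lemma fraction_rel_iff:
  "((x, s), (y, t)) \<in> fraction_rel R S N \<longleftrightarrow>
    x \<in> carrier N \<and> y \<in> carrier N \<and> s \<in> S \<and> t \<in> S \<and> (\<exists>u\<in>S. (u \<otimes> t) \<odot>\<^bsub>N\<^esub> x = (u \<otimes> s) \<odot>\<^bsub>N\<^esub> y)"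
proof -
  have "u \<odot>\<^bsub>N\<^esub> (t \<odot>\<^bsub>N\<^esub> x \<ominus>\<^bsub>N\<^esub> s \<odot>\<^bsub>N\<^esub> y) = \<zero>\<^bsub>N\<^esub> \<longleftrightarrow> (u \<otimes> t) \<odot>\<^bsub>N\<^esub> x = (u \<otimes> s) \<odot>\<^bsub>N\<^esub> y"
    if "u \<in> S" "x \<in> carrier N" "y \<in> carrier N" "s \<in> S" "t \<in> S" for u
    using that by (simp add: smult_diff_distr_r smult_assoc1)
  thus ?thesis unfolding fraction_rel_def by auto
qed

lemma fraction_rel_trans:
  assumes "((x, s), (y, t)) \<in> fraction_rel R S N" "((y, t), (z, r)) \<in> fraction_rel R S N"
  shows "((x, s), (z, r)) \<in> fraction_rel R S N"
proof -
  obtain u v where c: "x \<in> carrier N" "y \<in> carrier N" "z \<in> carrier N" "s \<in> S" "t \<in> S" "r \<in> S" "u \<in> S" "v \<in> S"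
    and u: "(u \<otimes> t) \<odot>\<^bsub>N\<^esub> x = (u \<otimes> s) \<odot>\<^bsub>N\<^esub> y" and v: "(v \<otimes> r) \<odot>\<^bsub>N\<^esub> y = (v \<otimes> t) \<odot>\<^bsub>N\<^esub> z"
    using assms unfolding fraction_rel_iff by blast
  have "((u \<otimes> v \<otimes> t) \<otimes> r) \<odot>\<^bsub>N\<^esub> x = (v \<otimes> r) \<odot>\<^bsub>N\<^esub> ((u \<otimes> t) \<odot>\<^bsub>N\<^esub> x)"
    using c by (simp add: smult_assoc1[symmetric] m_ac)
  also have "\<dots> = (u \<otimes> s) \<odot>\<^bsub>N\<^esub> ((v \<otimes> r) \<odot>\<^bsub>N\<^esub> y)"
    unfolding u using c by (simp add: smult_assoc1[symmetric] m_ac)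
  also have "\<dots> = ((u \<otimes> v \<otimes> t) \<otimes> s) \<odot>\<^bsub>N\<^esub> z"
    unfolding v using c by (simp add: smult_assoc1[symmetric] m_ac)
  finally show ?thesis
    using c mult_denom unfolding fraction_rel_iff by blast
qed

lemma fraction_rel_equiv: "equiv (carrier N \<times> S) (fraction_rel R S N)"
proof (rule equivI)
  show "fraction_rel R S N \<subseteq> (carrier N \<times> S) \<times> (carrier N \<times> S)"
    by (auto simp: fraction_rel_def)
  show "refl_on (carrier N \<times> S) (fraction_rel R S N)"
    using one_denom by (auto simp: refl_on_def fraction_rel_iff)
  show "sym (fraction_rel R S N)"
    by (auto simp: sym_def fraction_rel_iff) metis
  show "trans (fraction_rel R S N)"
    unfolding trans_def split_paired_All using fraction_rel_trans by blast
qed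

lemma fraction_eq_iff:
  assumes "x \<in> carrier N" "s \<in> S" "y \<in> carrier N" "t \<in> S"
  shows "fr x s = fr y t \<longleftrightarrow> (\<exists>u\<in>S. (u \<otimes> t) \<odot>\<^bsub>N\<^esub> x = (u \<otimes> s) \<odot>\<^bsub>N\<^esub> y)"
proof -
  have "fr x s = fr y t \<longleftrightarrow> ((x, s), (y, t)) \<in> fraction_rel R S N"
    unfolding fraction_def by (rule eq_equiv_class_iff[OF fraction_rel_equiv]) (use assms in auto)
  thus ?thesis using assms by (simp add: fraction_rel_iff)
qed

lemma carrier_localization: "carrier L = {fr x s |x s. x \<in> carrier N \<and> s \<in> S}"
  by (auto simp: localization_module_def quotient_def fraction_def)

lemma localization_cases:
  assumes "X \<in> carrier L"
  obtains x s where "X = fr x s" "x \<in> carrier N" "s \<in> S"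
  using assms unfolding carrier_localization by blast

lemma fraction_closed [simp]: "\<lbrakk>x \<in> carrier N; s \<in> S\<rbrakk> \<Longrightarrow> fr x s \<in> carrier L"
  unfolding carrier_localization by blast

lemma in_fraction:
  assumes "(y, t) \<in> fr x s" "x \<in> carrier N" "s \<in> S"
  obtains u where "u \<in> S" "y \<in> carrier N" "t \<in> S" "(u \<otimes> t) \<odot>\<^bsub>N\<^esub> x = (u \<otimes> s) \<odot>\<^bsub>N\<^esub> y"
  using assms unfolding fraction_def Image_singleton_iff fraction_rel_iff by blast

lemma self_in_fraction: "\<lbrakk>x \<in> carrier N; s \<in> S\<rbrakk> \<Longrightarrow> (x, s) \<in> fr x s"
  unfolding fraction_def Image_singleton_iff fraction_rel_iff using one_denom by blast

lemma fraction_cancel: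
  assumes "x \<in> carrier N" "s \<in> S" "r \<in> S"
  shows "fr (r \<odot>\<^bsub>N\<^esub> x) (r \<otimes> s) = fr x s"
  using assms one_denom by (auto simp: fraction_eq_iff mult_denom smult_assoc1[symmetric] m_ac)

lemma fraction_add:
  assumes c: "x \<in> carrier N" "s \<in> S" "y \<in> carrier N" "t \<in> S"
  shows "fr x s \<oplus>\<^bsub>L\<^esub> fr y t = fr (t \<odot>\<^bsub>N\<^esub> x \<oplus>\<^bsub>N\<^esub> s \<odot>\<^bsub>N\<^esub> y) (s \<otimes> t)"
proof -
  define F where "F p q = fr (snd q \<odot>\<^bsub>N\<^esub> fst p \<oplus>\<^bsub>N\<^esub> snd p \<odot>\<^bsub>N\<^esub> fst q) (snd p \<otimes> snd q)" for p q :: "'n \<times> 'r"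
  have eq: "F p q = F (x, s) (y, t)" if p: "p \<in> fr x s" and q: "q \<in> fr y t" for p q
  proof -
    obtain x' s' y' t' where pq: "p = (x', s')" "q = (y', t')" by (cases p, cases q)
    obtain u where u: "u \<in> S" "x' \<in> carrier N" "s' \<in> S" "(u \<otimes> s') \<odot>\<^bsub>N\<^esub> x = (u \<otimes> s) \<odot>\<^bsub>N\<^esub> x'"
      using p c unfolding pq by (elim in_fraction)
    obtain v where v: "v \<in> S" "y' \<in> carrier N" "t' \<in> S" "(v \<otimes> t') \<odot>\<^bsub>N\<^esub> y = (v \<otimes> t) \<odot>\<^bsub>N\<^esub> y'"
      using q c unfolding pq by (elim in_fraction)
    have "((u \<otimes> v) \<otimes> (s \<otimes> t)) \<odot>\<^bsub>N\<^esub> (t' \<odot>\<^bsub>N\<^esub> x') = (v \<otimes> t \<otimes> t') \<odot>\<^bsub>N\<^esub> ((u \<otimes> s) \<odot>\<^bsub>N\<^esub> x')"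
      using c u(1-3) v(1-3) by (simp add: smult_assoc1[symmetric] m_ac)
    also have "\<dots> = ((u \<otimes> v) \<otimes> (s' \<otimes> t')) \<odot>\<^bsub>N\<^esub> (t \<odot>\<^bsub>N\<^esub> x)"
      unfolding u(4)[symmetric] using c u(1-3) v(1-3) by (simp add: smult_assoc1[symmetric] m_ac)
    finally have 1: "((u \<otimes> v) \<otimes> (s \<otimes> t)) \<odot>\<^bsub>N\<^esub> (t' \<odot>\<^bsub>N\<^esub> x') = ((u \<otimes> v) \<otimes> (s' \<otimes> t')) \<odot>\<^bsub>N\<^esub> (t \<odot>\<^bsub>N\<^esub> x)" .
    have "((u \<otimes> v) \<otimes> (s \<otimes> t)) \<odot>\<^bsub>N\<^esub> (s' \<odot>\<^bsub>N\<^esub> y') = (u \<otimes> s \<otimes> s') \<odot>\<^bsub>N\<^esub> ((v \<otimes> t) \<odot>\<^bsub>N\<^esub> y')"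
      using c u(1-3) v(1-3) by (simp add: smult_assoc1[symmetric] m_ac)
    also have "\<dots> = ((u \<otimes> v) \<otimes> (s' \<otimes> t')) \<odot>\<^bsub>N\<^esub> (s \<odot>\<^bsub>N\<^esub> y)"
      unfolding v(4)[symmetric] using c u(1-3) v(1-3) by (simp add: smult_assoc1[symmetric] m_ac)
    finally have 2: "((u \<otimes> v) \<otimes> (s \<otimes> t)) \<odot>\<^bsub>N\<^esub> (s' \<odot>\<^bsub>N\<^esub> y') = ((u \<otimes> v) \<otimes> (s' \<otimes> t')) \<odot>\<^bsub>N\<^esub> (s \<odot>\<^bsub>N\<^esub> y)" .
    have "((u \<otimes> v) \<otimes> (s \<otimes> t)) \<odot>\<^bsub>N\<^esub> (t' \<odot>\<^bsub>N\<^esub> x' \<oplus>\<^bsub>N\<^esub> s' \<odot>\<^bsub>N\<^esub> y') =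
        ((u \<otimes> v) \<otimes> (s' \<otimes> t')) \<odot>\<^bsub>N\<^esub> (t \<odot>\<^bsub>N\<^esub> x \<oplus>\<^bsub>N\<^esub> s \<odot>\<^bsub>N\<^esub> y)"
      using c u(1-3) v(1-3) 1 2 by (simp add: smult_r_distr)
    moreover have "u \<otimes> v \<in> S" using u v mult_denom by blast
    ultimately show ?thesis
      unfolding F_def pq fst_conv snd_conv
      using c u(1-3) v(1-3) by (subst fraction_eq_iff) (auto simp: mult_denom)
  qed
  have "fr x s \<oplus>\<^bsub>L\<^esub> fr y t = (\<Union>p\<in>fr x s. \<Union>q\<in>fr y t. F p q)"
    by (simp add: localization_module_def F_def case_prod_beta)
  also have "\<dots> = F (x, s) (y, t)"
    using eq self_in_fraction c by blast
  finally show ?thesis by (simp add: F_def)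
qed

lemma fraction_smult:
  assumes c: "a \<in> carrier R" "s \<in> S" "x \<in> carrier N" "t \<in> S"
  shows "rfr a s \<odot>\<^bsub>L\<^esub> fr x t = fr (a \<odot>\<^bsub>N\<^esub> x) (s \<otimes> t)"
proof -
  interpret reg: localization R "regular_module R" S by (rule regular_localization)
  have reg: "carrier (regular_module R) = carrier R" "smult (regular_module R) = mult R"
    by (simp_all add: regular_module_def)
  define F where "F p q = fr (fst p \<odot>\<^bsub>N\<^esub> fst q) (snd p \<otimes> snd q)" for p :: "'r \<times> 'r" and q :: "'n \<times> 'r"
  have eq: "F p q = F (a, s) (x, t)" if p: "p \<in> rfr a s" and q: "q \<in> fr x t" for p q
  proof -
    obtain a' s' x' t' where pq: "p = (a', s')" "q = (x', t')" by (cases p, cases q)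
    obtain u where u: "u \<in> S" "a' \<in> carrier R" "s' \<in> S" "(u \<otimes> s') \<otimes> a = (u \<otimes> s) \<otimes> a'"
      using p c reg.in_fraction[of a' s' a s] unfolding pq reg by blast
    obtain v where v: "v \<in> S" "x' \<in> carrier N" "t' \<in> S" "(v \<otimes> t') \<odot>\<^bsub>N\<^esub> x = (v \<otimes> t) \<odot>\<^bsub>N\<^esub> x'"
      using q c unfolding pq by (elim in_fraction)
    have "((u \<otimes> v) \<otimes> (s \<otimes> t)) \<odot>\<^bsub>N\<^esub> (a' \<odot>\<^bsub>N\<^esub> x') = (u \<otimes> s \<otimes> a') \<odot>\<^bsub>N\<^esub> ((v \<otimes> t) \<odot>\<^bsub>N\<^esub> x')"
      using c u(1-3) v(1-3) by (simp add: smult_assoc1[symmetric] m_ac)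
    also have "\<dots> = ((u \<otimes> v) \<otimes> (s' \<otimes> t')) \<odot>\<^bsub>N\<^esub> (a \<odot>\<^bsub>N\<^esub> x)"
      unfolding u(4)[symmetric] v(4)[symmetric] using c u(1-3) v(1-3) by (simp add: smult_assoc1[symmetric] m_ac)
    finally have "((u \<otimes> v) \<otimes> (s \<otimes> t)) \<odot>\<^bsub>N\<^esub> (a' \<odot>\<^bsub>N\<^esub> x') = ((u \<otimes> v) \<otimes> (s' \<otimes> t')) \<odot>\<^bsub>N\<^esub> (a \<odot>\<^bsub>N\<^esub> x)" .
    moreover have "u \<otimes> v \<in> S" using u v mult_denom by blast
    ultimately show ?thesis
      unfolding F_def pq fst_conv snd_conv
      using c u(1-3) v(1-3) by (subst fraction_eq_iff) (auto simp: mult_denom)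
  qed
  have "rfr a s \<odot>\<^bsub>L\<^esub> fr x t = (\<Union>p\<in>rfr a s. \<Union>q\<in>fr x t. F p q)"
    by (simp add: localization_module_def F_def case_prod_beta)
  also have "\<dots> = F (a, s) (x, t)"
    using eq self_in_fraction[OF c(3,4)] reg.self_in_fraction[of a s] c unfolding reg by blast
  finally show ?thesis by (simp add: F_def)
qed

lemma zero_localization: "\<zero>\<^bsub>L\<^esub> = fr \<zero>\<^bsub>N\<^esub> \<one>"
  by (simp add: localization_module_def)

lemma fraction_zero: "s \<in> S \<Longrightarrow> fr \<zero>\<^bsub>N\<^esub> s = \<zero>\<^bsub>L\<^esub>"
  unfolding zero_localization using one_denom by (subst fraction_eq_iff) auto

lemma fraction_eq_zero:
  assumes "x \<in> carrier N" "s \<in> S"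
  shows "fr x s = \<zero>\<^bsub>L\<^esub> \<longleftrightarrow> (\<exists>u\<in>S. u \<odot>\<^bsub>N\<^esub> x = \<zero>\<^bsub>N\<^esub>)"
  unfolding zero_localization using assms one_denom by (subst fraction_eq_iff) auto

lemma localization_abelian_group: "abelian_group L"
proof (rule abelian_groupI)
  fix X Y assume XY: "X \<in> carrier L" "Y \<in> carrier L"
  show "X \<oplus>\<^bsub>L\<^esub> Y \<in> carrier L"
    using XY by (elim localization_cases) (simp add: fraction_add mult_denom)
  show "X \<oplus>\<^bsub>L\<^esub> Y = Y \<oplus>\<^bsub>L\<^esub> X"
    using XY by (elim localization_cases) (simp add: fraction_add M.a_comm m_comm)
  fix Z assume "Z \<in> carrier L"
  thus "X \<oplus>\<^bsub>L\<^esub> Y \<oplus>\<^bsub>L\<^esub> Z = X \<oplus>\<^bsub>L\<^esub> (Y \<oplus>\<^bsub>L\<^esub> Z)"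
    using XY by (elim localization_cases)
      (simp add: fraction_add mult_denom smult_r_distr smult_assoc1[symmetric] m_ac M.a_assoc)
next
  show "\<zero>\<^bsub>L\<^esub> \<in> carrier L" unfolding zero_localization by (simp add: one_denom)
next
  fix X assume X: "X \<in> carrier L"
  show "\<zero>\<^bsub>L\<^esub> \<oplus>\<^bsub>L\<^esub> X = X"
    unfolding zero_localization using X by (elim localization_cases) (simp add: fraction_add one_denom)
  obtain x s where x: "X = fr x s" "x \<in> carrier N" "s \<in> S" using X by (rule localization_cases)
  have "fr (\<ominus>\<^bsub>N\<^esub> x) s \<oplus>\<^bsub>L\<^esub> X = \<zero>\<^bsub>L\<^esub>"
    using x by (simp add: fraction_add smult_r_minus M.l_neg fraction_zero mult_denom)
  thus "\<exists>Y\<in>carrier L. Y \<oplus>\<^bsub>L\<^esub> X = \<zero>\<^bsub>L\<^esub>" using x by (intro bexI[of _ "fr (\<ominus>\<^bsub>N\<^esub> x) s"]) simp_all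
qed

lemma carrier_localization_ring: "carrier LR = {rfr a s |a s. a \<in> carrier R \<and> s \<in> S}"
  using localization.carrier_localization[OF regular_localization]
  by (simp add: localization_ring_def regular_module_def)

lemma localization_ring_cases:
  assumes "X \<in> carrier LR"
  obtains a s where "X = rfr a s" "a \<in> carrier R" "s \<in> S"
  using assms unfolding carrier_localization_ring by blast

lemma ring_fraction_closed [simp]: "\<lbrakk>a \<in> carrier R; s \<in> S\<rbrakk> \<Longrightarrow> rfr a s \<in> carrier LR"
  unfolding carrier_localization_ring by blast

lemma ring_fraction_add:
  "\<lbrakk>a \<in> carrier R; s \<in> S; b \<in> carrier R; t \<in> S\<rbrakk> \<Longrightarrow> rfr a s \<oplus>\<^bsub>LR\<^esub> rfr b t = rfr (t \<otimes> a \<oplus> s \<otimes> b) (s \<otimes> t)"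
  using localization.fraction_add[OF regular_localization, of a s b t]
  by (simp add: localization_ring_def regular_module_def)

lemma ring_fraction_mult:
  "\<lbrakk>a \<in> carrier R; s \<in> S; b \<in> carrier R; t \<in> S\<rbrakk> \<Longrightarrow> rfr a s \<otimes>\<^bsub>LR\<^esub> rfr b t = rfr (a \<otimes> b) (s \<otimes> t)"
  using localization.fraction_smult[OF regular_localization, of a s b t]
  by (simp add: localization_ring_def regular_module_def)

lemma ring_fraction_eq_iff:
  "\<lbrakk>a \<in> carrier R; s \<in> S; b \<in> carrier R; t \<in> S\<rbrakk> \<Longrightarrow>
    rfr a s = rfr b t \<longleftrightarrow> (\<exists>u\<in>S. (u \<otimes> t) \<otimes> a = (u \<otimes> s) \<otimes> b)"
  using localization.fraction_eq_iff[OF regular_localization, of a s b t]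
  by (simp add: regular_module_def)

lemma ring_fraction_cancel: "\<lbrakk>a \<in> carrier R; s \<in> S; r \<in> S\<rbrakk> \<Longrightarrow> rfr (r \<otimes> a) (r \<otimes> s) = rfr a s"
  using localization.fraction_cancel[OF regular_localization, of a s r]
  by (simp add: regular_module_def)

lemma one_localization_ring: "\<one>\<^bsub>LR\<^esub> = rfr \<one> \<one>"
  by (simp add: localization_ring_def)

lemma zero_localization_ring: "\<zero>\<^bsub>LR\<^esub> = rfr \<zero> \<one>"
  by (simp add: localization_ring_def localization_module_def) (simp add: regular_module_def)

lemma localization_ring_cring: "cring LR"
proof (rule cringI)
  show "abelian_group LR"
    by (rule abelian_group_cong[OF localization.localization_abelian_group[OF regular_localization]])
      (simp_all add: localization_ring_def)
  show "Group.comm_monoid LR"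
  proof (rule comm_monoidI)
    fix X Y assume XY: "X \<in> carrier LR" "Y \<in> carrier LR"
    show "X \<otimes>\<^bsub>LR\<^esub> Y \<in> carrier LR"
      using XY by (elim localization_ring_cases) (simp add: ring_fraction_mult mult_denom)
    show "X \<otimes>\<^bsub>LR\<^esub> Y = Y \<otimes>\<^bsub>LR\<^esub> X"
      using XY by (elim localization_ring_cases) (simp add: ring_fraction_mult mult_denom m_comm)
    fix Z assume "Z \<in> carrier LR"
    thus "X \<otimes>\<^bsub>LR\<^esub> Y \<otimes>\<^bsub>LR\<^esub> Z = X \<otimes>\<^bsub>LR\<^esub> (Y \<otimes>\<^bsub>LR\<^esub> Z)"
      using XY by (elim localization_ring_cases) (simp add: ring_fraction_mult mult_denom m_assoc)
  next
    show "\<one>\<^bsub>LR\<^esub> \<in> carrier LR" by (simp add: one_localization_ring one_denom)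
    fix X assume "X \<in> carrier LR"
    thus "\<one>\<^bsub>LR\<^esub> \<otimes>\<^bsub>LR\<^esub> X = X"
      by (elim localization_ring_cases) (simp add: one_localization_ring ring_fraction_mult one_denom)
  qed
  fix X Y Z assume "X \<in> carrier LR" "Y \<in> carrier LR" "Z \<in> carrier LR"
  then obtain a s b t c r where *: "X = rfr a s" "Y = rfr b t" "Z = rfr c r"
    "a \<in> carrier R" "b \<in> carrier R" "c \<in> carrier R" "s \<in> S" "t \<in> S" "r \<in> S"
    by (elim localization_ring_cases)
  have "(X \<oplus>\<^bsub>LR\<^esub> Y) \<otimes>\<^bsub>LR\<^esub> Z = rfr ((t \<otimes> a \<oplus> s \<otimes> b) \<otimes> c) (s \<otimes> t \<otimes> r)"
    using * by (simp add: ring_fraction_add ring_fraction_mult mult_denom)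
  also have "\<dots> = rfr (r \<otimes> ((t \<otimes> a \<oplus> s \<otimes> b) \<otimes> c)) (r \<otimes> (s \<otimes> t \<otimes> r))"
    using * by (simp add: ring_fraction_cancel mult_denom)
  also have "\<dots> = X \<otimes>\<^bsub>LR\<^esub> Z \<oplus>\<^bsub>LR\<^esub> Y \<otimes>\<^bsub>LR\<^esub> Z"
    using * by (simp add: ring_fraction_add ring_fraction_mult mult_denom l_distr r_distr m_ac)
  finally show "(X \<oplus>\<^bsub>LR\<^esub> Y) \<otimes>\<^bsub>LR\<^esub> Z = X \<otimes>\<^bsub>LR\<^esub> Z \<oplus>\<^bsub>LR\<^esub> Y \<otimes>\<^bsub>LR\<^esub> Z" .
qed

lemma localization_module_module: "module LR L"
proof (rule moduleI[OF localization_ring_cring localization_abelian_group])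
  fix A X assume "A \<in> carrier LR" "X \<in> carrier L"
  thus "A \<odot>\<^bsub>L\<^esub> X \<in> carrier L"
    by (elim localization_ring_cases localization_cases) (simp add: fraction_smult mult_denom)
next
  fix X assume "X \<in> carrier L"
  thus "\<one>\<^bsub>LR\<^esub> \<odot>\<^bsub>L\<^esub> X = X"
    by (elim localization_cases) (simp add: one_localization_ring fraction_smult one_denom)
next
  fix A B X assume "A \<in> carrier LR" "B \<in> carrier LR" "X \<in> carrier L"
  thus "(A \<otimes>\<^bsub>LR\<^esub> B) \<odot>\<^bsub>L\<^esub> X = A \<odot>\<^bsub>L\<^esub> (B \<odot>\<^bsub>L\<^esub> X)"
    by (elim localization_ring_cases localization_cases)
      (simp add: fraction_smult ring_fraction_mult mult_denom smult_assoc1 m_assoc)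
next
  fix A B X assume "A \<in> carrier LR" "B \<in> carrier LR" "X \<in> carrier L"
  then obtain a s b t x r where *: "A = rfr a s" "B = rfr b t" "X = fr x r"
    "a \<in> carrier R" "b \<in> carrier R" "x \<in> carrier N" "s \<in> S" "t \<in> S" "r \<in> S"
    by (elim localization_ring_cases localization_cases)
  have "(A \<oplus>\<^bsub>LR\<^esub> B) \<odot>\<^bsub>L\<^esub> X = fr ((t \<otimes> a \<oplus> s \<otimes> b) \<odot>\<^bsub>N\<^esub> x) (s \<otimes> t \<otimes> r)"
    using * by (simp add: ring_fraction_add fraction_smult mult_denom)
  also have "\<dots> = fr (r \<odot>\<^bsub>N\<^esub> ((t \<otimes> a \<oplus> s \<otimes> b) \<odot>\<^bsub>N\<^esub> x)) (r \<otimes> (s \<otimes> t \<otimes> r))"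
    using * by (simp add: fraction_cancel mult_denom)
  also have "\<dots> = A \<odot>\<^bsub>L\<^esub> X \<oplus>\<^bsub>L\<^esub> B \<odot>\<^bsub>L\<^esub> X"
    using * by (simp add: fraction_add fraction_smult mult_denom smult_l_distr smult_r_distr
        smult_assoc1[symmetric] m_ac)
  finally show "(A \<oplus>\<^bsub>LR\<^esub> B) \<odot>\<^bsub>L\<^esub> X = A \<odot>\<^bsub>L\<^esub> X \<oplus>\<^bsub>L\<^esub> B \<odot>\<^bsub>L\<^esub> X" .
next
  fix A X Y assume "A \<in> carrier LR" "X \<in> carrier L" "Y \<in> carrier L"
  then obtain a s x r y t where *: "A = rfr a s" "X = fr x r" "Y = fr y t"
    "a \<in> carrier R" "x \<in> carrier N" "y \<in> carrier N" "s \<in> S" "t \<in> S" "r \<in> S"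
    by (elim localization_ring_cases localization_cases)
  have "A \<odot>\<^bsub>L\<^esub> (X \<oplus>\<^bsub>L\<^esub> Y) = fr (a \<odot>\<^bsub>N\<^esub> (t \<odot>\<^bsub>N\<^esub> x \<oplus>\<^bsub>N\<^esub> r \<odot>\<^bsub>N\<^esub> y)) (s \<otimes> (r \<otimes> t))"
    using * by (simp add: fraction_add fraction_smult mult_denom)
  also have "\<dots> = fr (s \<odot>\<^bsub>N\<^esub> (a \<odot>\<^bsub>N\<^esub> (t \<odot>\<^bsub>N\<^esub> x \<oplus>\<^bsub>N\<^esub> r \<odot>\<^bsub>N\<^esub> y))) (s \<otimes> (s \<otimes> (r \<otimes> t)))"
    using * by (simp add: fraction_cancel mult_denom)
  also have "\<dots> = A \<odot>\<^bsub>L\<^esub> X \<oplus>\<^bsub>L\<^esub> A \<odot>\<^bsub>L\<^esub> Y"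
    using * by (simp add: fraction_add fraction_smult mult_denom smult_r_distr
        smult_assoc1[symmetric] m_ac)
  finally show "A \<odot>\<^bsub>L\<^esub> (X \<oplus>\<^bsub>L\<^esub> Y) = A \<odot>\<^bsub>L\<^esub> X \<oplus>\<^bsub>L\<^esub> A \<odot>\<^bsub>L\<^esub> Y" .
qed

end

section \<open>Modules over quotient rings\<close>

lemma carrier_Quot_cases:
  assumes "X \<in> carrier (R Quot I)"
  obtains a where "a \<in> carrier R" "X = I +>\<^bsub>R\<^esub> a"
  using assms by (auto simp: FactRing_def A_RCOSETS_def')

lemma (in ideal) coset_closed: "a \<in> carrier R \<Longrightarrow> I +> a \<in> carrier (R Quot I)"
  by (auto simp: FactRing_def A_RCOSETS_def')

lemma (in ideal) coset_mult:
  "\<lbrakk>a \<in> carrier R; b \<in> carrier R\<rbrakk> \<Longrightarrow> (I +> a) \<otimes>\<^bsub>R Quot I\<^esub> (I +> b) = I +> (a \<otimes> b)"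
  using ring_hom_mult[OF rcos_ring_hom] by simp

lemma (in ideal) coset_add:
  "\<lbrakk>a \<in> carrier R; b \<in> carrier R\<rbrakk> \<Longrightarrow> (I +> a) \<oplus>\<^bsub>R Quot I\<^esub> (I +> b) = I +> (a \<oplus> b)"
  using ring_hom_add[OF rcos_ring_hom] by simp

lemma (in ideal) coset_one: "\<one>\<^bsub>R Quot I\<^esub> = I +> \<one>"
  using ring_hom_one[OF rcos_ring_hom] by simp

lemma (in ideal) mem_coset_iff: "a \<in> carrier R \<Longrightarrow> b \<in> I +> a \<longleftrightarrow> (\<exists>h\<in>I. b = h \<oplus> a)"
  by (auto simp: a_r_coset_def')

lemma (in ideal) coset_self: "a \<in> carrier R \<Longrightarrow> a \<in> I +> a"
  using additive_subgroup.zero_closed[OF is_additive_subgroup] by (auto simp: mem_coset_iff intro!: bexI[of _ \<zero>])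

lemma (in ideal) coset_eq_zero_iff: "a \<in> carrier R \<Longrightarrow> I +> a = \<zero>\<^bsub>R Quot I\<^esub> \<longleftrightarrow> a \<in> I"
proof -
  assume a: "a \<in> carrier R"
  have "\<zero>\<^bsub>R Quot I\<^esub> = I" by (simp add: FactRing_def)
  thus ?thesis using a_coset_join2[OF a a_subgroup] coset_self[OF a] by auto
qed

lemma quotient_module_module:
  assumes "cring R" "ideal I R"
  shows "module R (quotient_module R I)"
proof -
  interpret cring R by (rule assms)
  interpret I: ideal I R by (rule assms)
  interpret Q: ring "R Quot I" by (rule I.quotient_is_ring)
  show ?thesis
  proof (rule moduleI[OF assms(1)])
    show "abelian_group (quotient_module R I)"
      by (rule abelian_group_cong[OF Q.is_abelian_group]) (simp_all add: quotient_module_def)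
  qed (auto simp: quotient_module_def I.coset_closed Q.l_distr Q.r_distr Q.m_assoc
      I.coset_add[symmetric] I.coset_mult[symmetric] I.coset_one[symmetric])
qed

lemma coset_scalars_smult:
  assumes N: "module L N" and P: "ideal P L" and ann: "\<And>a v. a \<in> P \<Longrightarrow> v \<in> carrier N \<Longrightarrow> a \<odot>\<^bsub>N\<^esub> v = \<zero>\<^bsub>N\<^esub>"
    and a: "a \<in> carrier L" and v: "v \<in> carrier N"
  shows "(P +>\<^bsub>L\<^esub> a) \<odot>\<^bsub>coset_scalars N\<^esub> v = a \<odot>\<^bsub>N\<^esub> v"
proof -
  interpret N: module L N by (rule N)
  interpret P: ideal P L by (rule P)
  have "b \<odot>\<^bsub>N\<^esub> v = a \<odot>\<^bsub>N\<^esub> v" if "b \<in> P +>\<^bsub>L\<^esub> a" for b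
    using that a v by (auto simp: P.mem_coset_iff N.smult_l_distr ann P.Icarr)
  hence "(THE w. \<exists>b\<in>P +>\<^bsub>L\<^esub> a. w = b \<odot>\<^bsub>N\<^esub> v) = a \<odot>\<^bsub>N\<^esub> v"
    using P.coset_self[OF a] by (intro the_equality) blast+
  thus ?thesis by (simp add: coset_scalars_def)
qed

lemma coset_scalars_module:
  assumes N: "module L N" and P: "ideal P L" and ann: "\<And>a v. a \<in> P \<Longrightarrow> v \<in> carrier N \<Longrightarrow> a \<odot>\<^bsub>N\<^esub> v = \<zero>\<^bsub>N\<^esub>"
  shows "module (L Quot P) (coset_scalars N)"
proof -
  interpret N: module L N by (rule N)
  interpret P: ideal P L by (rule P)
  note smult = coset_scalars_smult[OF assms]
  have c: "carrier (coset_scalars N) = carrier N" "ring.add (coset_scalars N) = ring.add N"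
    by (simp_all add: coset_scalars_def)
  show ?thesis
  proof (rule moduleI)
    show "cring (L Quot P)" by (rule P.quotient_is_cring[OF N.is_cring])
    show "abelian_group (coset_scalars N)"
      by (rule abelian_group_cong[OF N.abelian_group_axioms]) (simp_all add: coset_scalars_def)
    fix X v assume "X \<in> carrier (L Quot P)" "v \<in> carrier (coset_scalars N)"
    thus "X \<odot>\<^bsub>coset_scalars N\<^esub> v \<in> carrier (coset_scalars N)"
      unfolding c by (elim carrier_Quot_cases) (simp add: smult)
  next
    fix X Y v assume "X \<in> carrier (L Quot P)" "Y \<in> carrier (L Quot P)" "v \<in> carrier (coset_scalars N)"
    thus "(X \<oplus>\<^bsub>L Quot P\<^esub> Y) \<odot>\<^bsub>coset_scalars N\<^esub> v
        = X \<odot>\<^bsub>coset_scalars N\<^esub> v \<oplus>\<^bsub>coset_scalars N\<^esub> Y \<odot>\<^bsub>coset_scalars N\<^esub> v"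
      unfolding c by (elim carrier_Quot_cases) (simp add: smult P.coset_add N.smult_l_distr)
  next
    fix X v w assume "X \<in> carrier (L Quot P)" "v \<in> carrier (coset_scalars N)" "w \<in> carrier (coset_scalars N)"
    thus "X \<odot>\<^bsub>coset_scalars N\<^esub> (v \<oplus>\<^bsub>coset_scalars N\<^esub> w)
        = X \<odot>\<^bsub>coset_scalars N\<^esub> v \<oplus>\<^bsub>coset_scalars N\<^esub> X \<odot>\<^bsub>coset_scalars N\<^esub> w"
      unfolding c by (elim carrier_Quot_cases) (simp add: smult N.smult_r_distr)
  next
    fix X Y v assume "X \<in> carrier (L Quot P)" "Y \<in> carrier (L Quot P)" "v \<in> carrier (coset_scalars N)"
    thus "(X \<otimes>\<^bsub>L Quot P\<^esub> Y) \<odot>\<^bsub>coset_scalars N\<^esub> v = X \<odot>\<^bsub>coset_scalars N\<^esub> (Y \<odot>\<^bsub>coset_scalars N\<^esub> v)"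
      unfolding c by (elim carrier_Quot_cases) (simp add: smult P.coset_mult N.smult_assoc1)
  next
    fix v assume "v \<in> carrier (coset_scalars N)"
    thus "\<one>\<^bsub>L Quot P\<^esub> \<odot>\<^bsub>coset_scalars N\<^esub> v = v"
      unfolding c by (simp add: P.coset_one smult)
  qed
qed

section \<open>Localization at a prime\<close>

locale localization_at_prime = primeideal \<pp> R + N: module R N
  for R :: "('r, 'b) ring_scheme" (structure) and N :: "('r, 'n, 'c) module_scheme" and \<pp>
begin

lemma prime_denoms: "localization R N (carrier R - \<pp>)"
proof
  show "\<one> \<in> carrier R - \<pp>" using I_notcarr one_imp_carrier by auto
  show "\<And>s t. s \<in> carrier R - \<pp> \<Longrightarrow> t \<in> carrier R - \<pp> \<Longrightarrow> s \<otimes> t \<in> carrier R - \<pp>"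
    by (auto dest: I_prime)
qed auto

sublocale localization R N "carrier R - \<pp>" by (rule prime_denoms)

lemma extended_prime_eq: "extended_prime R \<pp> = {rfr a s |a s. a \<in> \<pp> \<and> s \<in> carrier R - \<pp>}" (is "_ = ?P")
  and extended_prime_ideal: "ideal (extended_prime R \<pp>) LR"
proof -
  interpret LR: cring LR by (rule localization_ring_cring)
  have gens: "(\<lambda>a. rfr a \<one>) ` \<pp> \<subseteq> carrier LR" using one_denom Icarr by auto
  show id: "ideal (extended_prime R \<pp>) LR"
    unfolding extended_prime_def by (rule LR.genideal_ideal[OF gens])
  have "ideal ?P LR"
  proof (rule idealI[OF LR.ring_axioms])
    show "subgroup ?P (add_monoid LR)"
    proof (rule LR.add.subgroupI)
      show "?P \<subseteq> carrier LR" using Icarr by auto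
      show "?P \<noteq> {}" using one_denom additive_subgroup.zero_closed[OF is_additive_subgroup] by blast
      fix X assume "X \<in> ?P"
      then obtain a s where X: "X = rfr a s" "a \<in> \<pp>" "s \<in> carrier R - \<pp>" by blast
      have "rfr (\<ominus> a) s \<oplus>\<^bsub>LR\<^esub> X = rfr \<zero> (s \<otimes> s)"
        using X Icarr by (simp add: ring_fraction_add r_minus l_neg)
      also have "\<dots> = \<zero>\<^bsub>LR\<^esub>"
        unfolding zero_localization_ring using X one_denom mult_denom
        by (subst ring_fraction_eq_iff) auto
      finally have "\<ominus>\<^bsub>LR\<^esub> X = rfr (\<ominus> a) s"
        using X Icarr by (intro LR.minus_equality) simp_all
      thus "\<ominus>\<^bsub>LR\<^esub> X \<in> ?P" using X additive_subgroup.a_inv_closed[OF is_additive_subgroup] by blast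
      fix Y assume "Y \<in> ?P"
      then obtain b t where Y: "Y = rfr b t" "b \<in> \<pp>" "t \<in> carrier R - \<pp>" by blast
      have "X \<oplus>\<^bsub>LR\<^esub> Y = rfr (t \<otimes> a \<oplus> s \<otimes> b) (s \<otimes> t)"
        using X Y Icarr by (simp add: ring_fraction_add)
      moreover have "t \<otimes> a \<oplus> s \<otimes> b \<in> \<pp>"
        using X Y by (intro additive_subgroup.a_closed[OF is_additive_subgroup] I_l_closed) auto
      ultimately show "X \<oplus>\<^bsub>LR\<^esub> Y \<in> ?P" using X Y mult_denom by blast
    qed
    fix X Y assume "X \<in> ?P" and Y: "Y \<in> carrier LR"
    then obtain a s where X: "X = rfr a s" "a \<in> \<pp>" "s \<in> carrier R - \<pp>" by blast
    obtain b t where Y: "Y = rfr b t" "b \<in> carrier R" "t \<in> carrier R - \<pp>"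
      using Y by (rule localization_ring_cases)
    have "Y \<otimes>\<^bsub>LR\<^esub> X = rfr (b \<otimes> a) (t \<otimes> s)" using X Y Icarr by (simp add: ring_fraction_mult)
    thus YX: "Y \<otimes>\<^bsub>LR\<^esub> X \<in> ?P" using X Y mult_denom I_l_closed by blast
    have "X \<otimes>\<^bsub>LR\<^esub> Y = Y \<otimes>\<^bsub>LR\<^esub> X" using X Y Icarr by (intro LR.m_comm) simp_all
    thus "X \<otimes>\<^bsub>LR\<^esub> Y \<in> ?P" using YX by simp
  qed
  hence "extended_prime R \<pp> \<subseteq> ?P"
    unfolding extended_prime_def using one_denom by (intro LR.genideal_minimal) auto
  moreover have "?P \<subseteq> extended_prime R \<pp>"
  proof
    fix X assume "X \<in> ?P"
    then obtain a s where X: "X = rfr a s" "a \<in> \<pp>" "s \<in> carrier R - \<pp>" by blast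
    have "X = rfr \<one> s \<otimes>\<^bsub>LR\<^esub> rfr a \<one>" using X Icarr one_denom by (simp add: ring_fraction_mult)
    moreover have "rfr a \<one> \<in> extended_prime R \<pp>"
      unfolding extended_prime_def using LR.genideal_self[OF gens] X by blast
    ultimately show "X \<in> extended_prime R \<pp>" using ideal.I_l_closed[OF id] X by simp
  qed
  ultimately show "extended_prime R \<pp> = ?P" by blast
qed

lemma fraction_in_extended_prime_iff:
  assumes "a \<in> carrier R" "s \<in> carrier R - \<pp>"
  shows "rfr a s \<in> extended_prime R \<pp> \<longleftrightarrow> a \<in> \<pp>"
proof
  assume "rfr a s \<in> extended_prime R \<pp>"
  then obtain b t where b: "rfr a s = rfr b t" "b \<in> \<pp>" "t \<in> carrier R - \<pp>"
    unfolding extended_prime_eq by blast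
  then obtain u where u: "u \<in> carrier R - \<pp>" "(u \<otimes> t) \<otimes> a = (u \<otimes> s) \<otimes> b"
    using ring_fraction_eq_iff[OF assms Icarr[OF b(2)] b(3)] b(1) by blast
  have "(u \<otimes> s) \<otimes> b \<in> \<pp>" using u assms b by (intro I_l_closed) auto
  hence "(u \<otimes> t) \<otimes> a \<in> \<pp>" using u by simp
  moreover have "u \<otimes> t \<in> carrier R - \<pp>" using u b mult_denom by blast
  ultimately show "a \<in> \<pp>" using I_prime assms by blast
qed (use assms in \<open>auto simp: extended_prime_eq\<close>)

lemma extended_prime_maximal: "maximalideal (extended_prime R \<pp>) LR"
proof (rule maximalidealI[OF extended_prime_ideal])
  interpret LR: cring LR by (rule localization_ring_cring)
  have "\<one>\<^bsub>LR\<^esub> \<notin> extended_prime R \<pp>"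
    using one_denom by (simp add: one_localization_ring fraction_in_extended_prime_iff)
  thus "carrier LR \<noteq> extended_prime R \<pp>" using LR.one_closed by blast
  fix J assume J: "ideal J LR" "extended_prime R \<pp> \<subseteq> J" "J \<subseteq> carrier LR"
  show "J = extended_prime R \<pp> \<or> J = carrier LR"
  proof (cases "J = extended_prime R \<pp>")
    case False
    then obtain X where X: "X \<in> J" "X \<notin> extended_prime R \<pp>" using J by blast
    obtain a s where a: "X = rfr a s" "a \<in> carrier R" "s \<in> carrier R - \<pp>"
      using X J by (blast elim: localization_ring_cases)
    hence a': "a \<in> carrier R - \<pp>" using X fraction_in_extended_prime_iff by blast
    have "rfr s a \<otimes>\<^bsub>LR\<^esub> X \<in> J" using ideal.I_l_closed[OF J(1) X(1)] a a' by simp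
    moreover have "rfr s a \<otimes>\<^bsub>LR\<^esub> X = rfr (s \<otimes> a) (a \<otimes> s)" using a a' by (simp add: ring_fraction_mult)
    moreover have "\<dots> = \<one>\<^bsub>LR\<^esub>"
      unfolding one_localization_ring using a a' one_denom mult_denom
      by (subst ring_fraction_eq_iff) (auto simp: m_comm)
    ultimately show ?thesis using ideal.one_imp_carrier[OF J(1)] by simp
  qed simp
qed

lemma residue_field_field: "field (residue_field R \<pp>)"
  unfolding residue_field_def
  by (rule maximalideal.quotient_is_field[OF extended_prime_maximal localization_ring_cring])

end

section \<open>The Bass number as a rank\<close>

definition annihilated_part :: "'r set \<Rightarrow> ('r, 'm, 'd) module_scheme \<Rightarrow> 'm set" where
  "annihilated_part I M = {y \<in> carrier M. \<forall>a\<in>I. a \<odot>\<^bsub>M\<^esub> y = \<zero>\<^bsub>M\<^esub>}"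

lemma annihilated_part_submodule:
  assumes "module R M" "I \<subseteq> carrier R"
  shows "submodule R (annihilated_part I M) M"
proof -
  interpret module R M by (rule assms)
  show ?thesis
  proof (rule submodule.intro[OF module_axioms])
    fix c v assume c: "c \<in> carrier R" "v \<in> annihilated_part I M"
    have "a \<odot>\<^bsub>M\<^esub> (c \<odot>\<^bsub>M\<^esub> v) = \<zero>\<^bsub>M\<^esub>" if a: "a \<in> I" for a
    proof -
      have "a \<in> carrier R" "v \<in> carrier M" using a assms(2) c by (auto simp: annihilated_part_def)
      hence "a \<odot>\<^bsub>M\<^esub> (c \<odot>\<^bsub>M\<^esub> v) = c \<odot>\<^bsub>M\<^esub> (a \<odot>\<^bsub>M\<^esub> v)"
        using c(1) by (simp add: smult_assoc1[symmetric] R.m_comm)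
      thus ?thesis using a c by (simp add: annihilated_part_def)
    qed
    thus "c \<odot>\<^bsub>M\<^esub> v \<in> annihilated_part I M" using c by (simp add: annihilated_part_def)
  next
    fix v w assume "v \<in> annihilated_part I M" "w \<in> annihilated_part I M"
    thus "v \<oplus>\<^bsub>M\<^esub> w \<in> annihilated_part I M"
      using assms(2) by (auto simp: annihilated_part_def smult_r_distr)
  qed (use assms(2) in \<open>auto simp: annihilated_part_def\<close>)
qed

text \<open>The properties which characterise \<open>K\<close> as the fraction field of \<open>R/\<pp>\<close>, and \<open>V\<close> as the
  localization of \<open>{y \<in> M. \<pp> y = 0}\<close>, up to isomorphism. Linear independence over \<open>K\<close> and over \<open>R/\<pp>\<close>
  are compared through them, rather than through equivalence classes of pairs.\<close>
locale fraction_space = primeideal \<pp> R + M: module R M + V: vectorspace K V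
  for R :: "('r, 'b) ring_scheme" (structure) and M :: "('r, 'm, 'd) module_scheme" and \<pp>
    and K :: "('k, 'g) ring_scheme" and V :: "('k, 'v, 'h) module_scheme" +
  fixes \<rho> :: "'r \<Rightarrow> 'k" and \<theta> :: "'m \<Rightarrow> 'v"
  assumes \<rho>_closed: "a \<in> carrier R \<Longrightarrow> \<rho> a \<in> carrier K"
    and \<rho>_mult: "\<lbrakk>a \<in> carrier R; b \<in> carrier R\<rbrakk> \<Longrightarrow> \<rho> (a \<otimes> b) = \<rho> a \<otimes>\<^bsub>K\<^esub> \<rho> b"
    and \<rho>_nonzero: "a \<in> carrier R - \<pp> \<Longrightarrow> \<rho> a \<noteq> \<zero>\<^bsub>K\<^esub>"
    and \<rho>_dense: "k \<in> carrier K \<Longrightarrow> \<exists>s\<in>carrier R - \<pp>. \<exists>a\<in>carrier R. \<rho> s \<otimes>\<^bsub>K\<^esub> k = \<rho> a"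
    and \<theta>_closed: "y \<in> annihilated_part \<pp> M \<Longrightarrow> \<theta> y \<in> carrier V"
    and \<theta>_add: "\<lbrakk>y \<in> annihilated_part \<pp> M; z \<in> annihilated_part \<pp> M\<rbrakk> \<Longrightarrow> \<theta> (y \<oplus>\<^bsub>M\<^esub> z) = \<theta> y \<oplus>\<^bsub>V\<^esub> \<theta> z"
    and \<theta>_smult: "\<lbrakk>a \<in> carrier R; y \<in> annihilated_part \<pp> M\<rbrakk> \<Longrightarrow> \<theta> (a \<odot>\<^bsub>M\<^esub> y) = \<rho> a \<odot>\<^bsub>V\<^esub> \<theta> y"
    and \<theta>_ker: "\<lbrakk>y \<in> annihilated_part \<pp> M; \<theta> y = \<zero>\<^bsub>V\<^esub>\<rbrakk> \<Longrightarrow> \<exists>s\<in>carrier R - \<pp>. s \<odot>\<^bsub>M\<^esub> y = \<zero>\<^bsub>M\<^esub>"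
    and \<theta>_dense: "v \<in> carrier V \<Longrightarrow> \<exists>s\<in>carrier R - \<pp>. \<exists>y\<in>annihilated_part \<pp> M. \<rho> s \<odot>\<^bsub>V\<^esub> v = \<theta> y"
begin

abbreviation T where "T \<equiv> annihilated_part \<pp> M"
abbreviation S where "S \<equiv> carrier R - \<pp>"

lemma S_mult: "\<lbrakk>s \<in> S; t \<in> S\<rbrakk> \<Longrightarrow> s \<otimes> t \<in> S"
  by (auto dest: I_prime)

lemma T_submodule: "submodule R T M"
  by (rule annihilated_part_submodule[OF M.module_axioms]) (use Icarr in blast)

interpretation T: submodule R T M by (rule T_submodule)

lemma \<theta>_zero: "\<theta> \<zero>\<^bsub>M\<^esub> = \<zero>\<^bsub>V\<^esub>"
proof -
  have "\<theta> \<zero>\<^bsub>M\<^esub> \<oplus>\<^bsub>V\<^esub> \<theta> \<zero>\<^bsub>M\<^esub> = \<theta> \<zero>\<^bsub>M\<^esub>" using \<theta>_add[of "\<zero>\<^bsub>M\<^esub>" "\<zero>\<^bsub>M\<^esub>"] by simp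
  thus ?thesis using \<theta>_closed[of "\<zero>\<^bsub>M\<^esub>"] by (simp add: V.M.add.l_cancel_one)
qed

lemma \<theta>_eq:
  assumes y: "y \<in> T" and z: "z \<in> T" and eq: "\<theta> y = \<theta> z"
  shows "\<exists>s\<in>S. s \<odot>\<^bsub>M\<^esub> y = s \<odot>\<^bsub>M\<^esub> z"
proof -
  have c: "y \<in> carrier M" "z \<in> carrier M" using y z T.subset by auto
  have d: "y \<ominus>\<^bsub>M\<^esub> z \<in> T" by (rule submodule_minus[OF T_submodule y z])
  have "(y \<ominus>\<^bsub>M\<^esub> z) \<oplus>\<^bsub>M\<^esub> z = y" using c by (simp add: a_minus_def M.M.add.m_assoc M.M.l_neg)
  hence "\<theta> (y \<ominus>\<^bsub>M\<^esub> z) \<oplus>\<^bsub>V\<^esub> \<theta> z = \<theta> z" using \<theta>_add[OF d z] eq by simp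
  hence "\<theta> (y \<ominus>\<^bsub>M\<^esub> z) = \<zero>\<^bsub>V\<^esub>" using \<theta>_closed[OF d] \<theta>_closed[OF z] by (simp add: V.M.add.r_cancel_one)
  then obtain s where s: "s \<in> S" "s \<odot>\<^bsub>M\<^esub> (y \<ominus>\<^bsub>M\<^esub> z) = \<zero>\<^bsub>M\<^esub>" using \<theta>_ker[OF d] by blast
  hence "s \<odot>\<^bsub>M\<^esub> y = s \<odot>\<^bsub>M\<^esub> z" using c by (simp add: M.smult_diff_distr_r)
  thus ?thesis using s by blast
qed

lemma span_in_T: "Y \<subseteq> T \<Longrightarrow> module.span R M Y \<subseteq> T"
  by (rule module.span_is_subset[OF M.module_axioms _ T_submodule])

text \<open>Clearing denominators. It suffices that the right-hand side is a subspace containing \<open>\<theta> ` Y\<close>.\<close>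
lemma span_image_subset:
  assumes Y: "Y \<subseteq> T"
  shows "module.span K V (\<theta> ` Y) \<subseteq> {v \<in> carrier V. \<exists>s\<in>S. \<exists>y\<in>module.span R M Y. \<rho> s \<odot>\<^bsub>V\<^esub> v = \<theta> y}" (is "_ \<subseteq> ?U")
proof (rule module.span_is_subset[OF V.module_axioms])
  have YM: "Y \<subseteq> carrier M" using Y T.subset by blast
  have sub: "submodule R (module.span R M Y) M" by (rule module.span_is_submodule[OF M.module_axioms YM])
  interpret s: submodule R "module.span R M Y" M by (rule sub)
  have sT: "y \<in> T" if "y \<in> module.span R M Y" for y using span_in_T[OF Y] that by blast
  have one: "\<one> \<in> S" using I_notcarr one_imp_carrier by auto
  show "\<theta> ` Y \<subseteq> ?U"
  proof
    fix v assume "v \<in> \<theta> ` Y"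
    then obtain y where y: "y \<in> Y" "v = \<theta> y" by blast
    have "\<rho> \<one> \<odot>\<^bsub>V\<^esub> v = \<theta> (\<one> \<odot>\<^bsub>M\<^esub> y)" using y Y \<theta>_smult[of \<one> y] by auto
    moreover have "\<one> \<odot>\<^bsub>M\<^esub> y \<in> module.span R M Y"
      using module.in_own_span[OF M.module_axioms YM] y by (intro s.smult_closed) auto
    moreover have "v \<in> carrier V" using y Y \<theta>_closed by auto
    ultimately show "v \<in> ?U" using one by blast
  qed
  show "submodule K ?U V"
  proof (rule submodule.intro[OF V.module_axioms])
    have "\<rho> \<one> \<odot>\<^bsub>V\<^esub> \<zero>\<^bsub>V\<^esub> = \<theta> \<zero>\<^bsub>M\<^esub>" using \<rho>_closed[of \<one>] by (simp add: \<theta>_zero)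
    thus "\<zero>\<^bsub>V\<^esub> \<in> ?U" using one s.zero_closed V.M.zero_closed by blast
  next
    fix v w assume "v \<in> ?U" "w \<in> ?U"
    then obtain s y t z where v: "v \<in> carrier V" "s \<in> S" "y \<in> module.span R M Y" "\<rho> s \<odot>\<^bsub>V\<^esub> v = \<theta> y"
      and w: "w \<in> carrier V" "t \<in> S" "z \<in> module.span R M Y" "\<rho> t \<odot>\<^bsub>V\<^esub> w = \<theta> z" by blast
    have st: "s \<in> carrier R" "t \<in> carrier R" using v w by auto
    have "\<rho> (s \<otimes> t) \<odot>\<^bsub>V\<^esub> v = \<rho> t \<odot>\<^bsub>V\<^esub> \<theta> y"
      using st v(1) unfolding m_comm[OF st] \<rho>_mult[OF st(2,1)] v(4)[symmetric]
      by (simp add: V.smult_assoc1 \<rho>_closed)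
    moreover have "\<rho> (s \<otimes> t) \<odot>\<^bsub>V\<^esub> w = \<rho> s \<odot>\<^bsub>V\<^esub> \<theta> z"
      using st w(1) unfolding \<rho>_mult[OF st] w(4)[symmetric]
      by (simp add: V.smult_assoc1 \<rho>_closed)
    ultimately have "\<rho> (s \<otimes> t) \<odot>\<^bsub>V\<^esub> (v \<oplus>\<^bsub>V\<^esub> w) = \<theta> (t \<odot>\<^bsub>M\<^esub> y \<oplus>\<^bsub>M\<^esub> s \<odot>\<^bsub>M\<^esub> z)"
      using st v(1) w(1) sT[OF v(3)] sT[OF w(3)]
      by (simp add: V.smult_r_distr \<rho>_closed \<theta>_add \<theta>_smult)
    moreover have "t \<odot>\<^bsub>M\<^esub> y \<oplus>\<^bsub>M\<^esub> s \<odot>\<^bsub>M\<^esub> z \<in> module.span R M Y" using v(3) w(3) st by simp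
    moreover have "s \<otimes> t \<in> S" using S_mult v(2) w(2) by blast
    moreover have "v \<oplus>\<^bsub>V\<^esub> w \<in> carrier V" using v w by simp
    ultimately show "v \<oplus>\<^bsub>V\<^esub> w \<in> ?U" by blast
  next
    fix k v assume k: "k \<in> carrier K" and "v \<in> ?U"
    then obtain s y where v: "v \<in> carrier V" "s \<in> S" "y \<in> module.span R M Y" "\<rho> s \<odot>\<^bsub>V\<^esub> v = \<theta> y" by blast
    obtain t a where t: "t \<in> S" "a \<in> carrier R" "\<rho> t \<otimes>\<^bsub>K\<^esub> k = \<rho> a" using \<rho>_dense[OF k] by blast
    have st: "s \<in> carrier R" "t \<in> carrier R" using v t by auto
    have "\<rho> (s \<otimes> t) \<odot>\<^bsub>V\<^esub> (k \<odot>\<^bsub>V\<^esub> v) = (\<rho> t \<otimes>\<^bsub>K\<^esub> k) \<odot>\<^bsub>V\<^esub> (\<rho> s \<odot>\<^bsub>V\<^esub> v)"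
      using st k v(1) by (simp add: \<rho>_mult \<rho>_closed V.smult_assoc1[symmetric] V.m_ac)
    also have "\<dots> = \<theta> (a \<odot>\<^bsub>M\<^esub> y)" unfolding t(3) v(4) using t(2) sT[OF v(3)] by (simp add: \<theta>_smult)
    finally have "\<rho> (s \<otimes> t) \<odot>\<^bsub>V\<^esub> (k \<odot>\<^bsub>V\<^esub> v) = \<theta> (a \<odot>\<^bsub>M\<^esub> y)" .
    moreover have "a \<odot>\<^bsub>M\<^esub> y \<in> module.span R M Y" using v(3) t(2) by simp
    moreover have "s \<otimes> t \<in> S" using S_mult v(2) t(1) by blast
    moreover have "k \<odot>\<^bsub>V\<^esub> v \<in> carrier V" using v k by simp
    ultimately show "k \<odot>\<^bsub>V\<^esub> v \<in> ?U" by blast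
  qed blast
qed

lemma image_span_subset:
  assumes Y: "Y \<subseteq> T"
  shows "\<theta> ` module.span R M Y \<subseteq> module.span K V (\<theta> ` Y)"
proof -
  have \<theta>Y: "\<theta> ` Y \<subseteq> carrier V" using Y \<theta>_closed by blast
  interpret s: submodule K "module.span K V (\<theta> ` Y)" V
    by (rule module.span_is_submodule[OF V.module_axioms \<theta>Y])
  have "module.span R M Y \<subseteq> {y \<in> T. \<theta> y \<in> module.span K V (\<theta> ` Y)}"
  proof (rule module.span_is_subset[OF M.module_axioms])
    show "Y \<subseteq> {y \<in> T. \<theta> y \<in> module.span K V (\<theta> ` Y)}"
      using Y module.in_own_span[OF V.module_axioms \<theta>Y] by blast
    show "submodule R {y \<in> T. \<theta> y \<in> module.span K V (\<theta> ` Y)} M"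
      by (rule submodule.intro[OF M.module_axioms])
        (use T.subset in \<open>auto simp: \<theta>_add \<theta>_smult \<theta>_zero \<rho>_closed\<close>)
  qed
  thus ?thesis by blast
qed

text \<open>After clearing denominators, a linear dependence over \<open>K\<close> among the \<open>\<theta> (x i)\<close> is a
  dependence among the \<open>x i\<close> with a coefficient outside \<open>\<pp>\<close>.\<close>
lemma independent_mod_ordLeq_basis:
  assumes ind: "independent_mod R \<pp> M x I" and B: "V.basis B"
  shows "|I| \<le>o |B|"
proof -
  have xT: "x i \<in> T" if "i \<in> I" for i using ind that by (auto simp: independent_mod_def annihilated_part_def)
  have key: "s \<in> \<pp>" if i: "i \<in> I" and s: "s \<in> carrier R" and y: "y \<in> module.span R M (x ` (I - {i}))"
    and eq: "\<rho> s \<odot>\<^bsub>V\<^esub> \<theta> (x i) = \<theta> y" for s i y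
  proof (rule ccontr)
    assume sp: "s \<notin> \<pp>"
    have yT: "y \<in> T" using span_in_T[of "x ` (I - {i})"] xT y by blast
    have "\<theta> (s \<odot>\<^bsub>M\<^esub> x i) = \<theta> y" using eq s xT[OF i] by (simp add: \<theta>_smult)
    then obtain u where u: "u \<in> S" "u \<odot>\<^bsub>M\<^esub> (s \<odot>\<^bsub>M\<^esub> x i) = u \<odot>\<^bsub>M\<^esub> y"
      using \<theta>_eq[OF _ yT] s xT[OF i] by blast
    have "x ` (I - {i}) \<subseteq> carrier M" using xT T.subset by blast
    then interpret s: submodule R "module.span R M (x ` (I - {i}))" M
      by (rule module.span_is_submodule[OF M.module_axioms])
    have xM: "x i \<in> carrier M" using xT[OF i] T.subset by blast
    have "(u \<otimes> s) \<odot>\<^bsub>M\<^esub> x i = u \<odot>\<^bsub>M\<^esub> y"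
      using u s xM by (simp add: M.smult_assoc1)
    moreover have "u \<odot>\<^bsub>M\<^esub> y \<in> module.span R M (x ` (I - {i}))" using u y by simp
    ultimately have "(u \<otimes> s) \<odot>\<^bsub>M\<^esub> x i \<in> module.span R M (x ` (I - {i}))" by simp
    moreover have "u \<otimes> s \<in> carrier R" using u s by simp
    ultimately have "u \<otimes> s \<in> \<pp>" using ind i unfolding independent_mod_def by blast
    moreover have "u \<otimes> s \<in> S" using S_mult u s sp by blast
    ultimately show False by blast
  qed
  have one: "\<one> \<in> S" using I_notcarr one_imp_carrier by auto
  have "inj_on (\<theta> \<circ> x) I"
  proof (rule inj_onI, rule ccontr)
    fix i j assume ij: "i \<in> I" "j \<in> I" "(\<theta> \<circ> x) i = (\<theta> \<circ> x) j" "i \<noteq> j"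
    have "\<rho> \<one> \<odot>\<^bsub>V\<^esub> \<theta> (x i) = \<theta> (\<one> \<odot>\<^bsub>M\<^esub> x j)"
      using ij(3) xT[OF ij(2)] by (simp only: \<theta>_smult[OF one_closed] o_def)
    hence "\<rho> \<one> \<odot>\<^bsub>V\<^esub> \<theta> (x i) = \<theta> (x j)"
      using M.smult_one[OF subsetD[OF T.subset xT[OF ij(2)]]] by simp
    moreover have "x ` (I - {i}) \<subseteq> carrier M" using xT T.subset by blast
    hence "x j \<in> module.span R M (x ` (I - {i}))"
      using module.in_own_span[OF M.module_axioms] ij by blast
    ultimately have "\<one> \<in> \<pp>" using key[OF ij(1) one_closed] by blast
    thus False using one by blast
  qed
  hence card: "|I| =o |(\<theta> \<circ> x) ` I|"
    using card_of_ordIso inj_on_imp_bij_betw by blast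
  have LV: "(\<theta> \<circ> x) ` I \<subseteq> carrier V" using xT \<theta>_closed by auto
  have "V.lin_indpt ((\<theta> \<circ> x) ` I)"
  proof
    assume "V.lin_dep ((\<theta> \<circ> x) ` I)"
    then obtain v where v: "v \<in> (\<theta> \<circ> x) ` I" "v \<in> module.span K V ((\<theta> \<circ> x) ` I - {v})"
      using V.lin_dep_obtain_span[OF _ LV] by blast
    then obtain i where i: "i \<in> I" "v = \<theta> (x i)" by auto
    have "(\<theta> \<circ> x) ` I - {v} \<subseteq> \<theta> ` (x ` (I - {i}))" using i by auto
    hence "v \<in> module.span K V (\<theta> ` (x ` (I - {i})))"
      using v(2) module.span_is_monotone[OF V.module_axioms] by blast
    moreover have "x ` (I - {i}) \<subseteq> T" using xT by auto
    ultimately obtain s y where s: "s \<in> S" "y \<in> module.span R M (x ` (I - {i}))" "\<rho> s \<odot>\<^bsub>V\<^esub> v = \<theta> y"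
      using span_image_subset by blast
    hence "s \<in> \<pp>" using key[OF i(1) _ s(2)] i(2) by blast
    thus False using s by blast
  qed
  from V.lin_indpt_ordLeq_basis[OF B this LV] card show ?thesis using ordIso_ordLeq_trans by blast
qed

text \<open>Each basis vector has a multiple by some \<open>\<rho> s\<close> with \<open>s \<notin> \<pp>\<close> which comes from \<open>M\<close>.\<close>
lemma basis_independent_mod:
  assumes B: "V.basis B"
  shows "\<exists>x. independent_mod R \<pp> M x B"
proof -
  have BV: "B \<subseteq> carrier V" and Bi: "V.lin_indpt B" using B by (auto simp: V.basis_def)
  have "\<forall>b\<in>B. \<exists>y. y \<in> T \<and> (\<exists>s\<in>S. \<rho> s \<odot>\<^bsub>V\<^esub> b = \<theta> y)" using \<theta>_dense BV by blast
  from bchoice[OF this] obtain x where x: "\<And>b. b \<in> B \<Longrightarrow> x b \<in> T" "\<And>b. b \<in> B \<Longrightarrow> \<exists>s\<in>S. \<rho> s \<odot>\<^bsub>V\<^esub> b = \<theta> (x b)"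
    by blast
  have "r \<in> \<pp>" if b: "b \<in> B" and r: "r \<in> carrier R" and rs: "r \<odot>\<^bsub>M\<^esub> x b \<in> module.span R M (x ` (B - {b}))" for b r
  proof (rule ccontr)
    assume rp: "r \<notin> \<pp>"
    obtain s where s: "s \<in> S" "\<rho> s \<odot>\<^bsub>V\<^esub> b = \<theta> (x b)" using x(2)[OF b] by blast
    have bV: "b \<in> carrier V" using b BV by blast
    have BV': "B - {b} \<subseteq> carrier V" using BV by blast
    interpret s: submodule K "module.span K V (B - {b})" V
      by (rule module.span_is_submodule[OF V.module_axioms BV'])
    have own: "c \<in> module.span K V (B - {b})" if "c \<in> B - {b}" for c
      using module.in_own_span[OF V.module_axioms BV'] that by blast
    have xT: "x ` (B - {b}) \<subseteq> T" using x by blast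
    have "\<theta> ` (x ` (B - {b})) \<subseteq> module.span K V (B - {b})"
    proof
      fix v assume "v \<in> \<theta> ` (x ` (B - {b}))"
      then obtain c where c: "c \<in> B - {b}" "v = \<theta> (x c)" by blast
      then obtain t where "t \<in> S" "\<rho> t \<odot>\<^bsub>V\<^esub> c = v" using x(2)[of c] by blast
      thus "v \<in> module.span K V (B - {b})" using own[OF c(1)] \<rho>_closed[of t] s.smult_closed by blast
    qed
    hence "module.span K V (\<theta> ` (x ` (B - {b}))) \<subseteq> module.span K V (B - {b})"
      by (rule module.span_is_subset[OF V.module_axioms _ s.submodule_axioms])
    hence "\<theta> (r \<odot>\<^bsub>M\<^esub> x b) \<in> module.span K V (B - {b})"
      using image_span_subset[OF xT] rs by blast
    moreover have "\<theta> (r \<odot>\<^bsub>M\<^esub> x b) = \<rho> (r \<otimes> s) \<odot>\<^bsub>V\<^esub> b"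
      using r s x(1)[OF b] bV \<theta>_smult[of r "x b"] s(2)[symmetric]
      by (simp add: \<rho>_mult \<rho>_closed V.smult_assoc1)
    ultimately have in_span: "\<rho> (r \<otimes> s) \<odot>\<^bsub>V\<^esub> b \<in> module.span K V (B - {b})" by simp
    have rs: "r \<otimes> s \<in> S" using S_mult r rp s by blast
    hence k: "\<rho> (r \<otimes> s) \<in> carrier K" "\<rho> (r \<otimes> s) \<noteq> \<zero>\<^bsub>K\<^esub>" using \<rho>_closed \<rho>_nonzero by auto
    have "b = inv\<^bsub>K\<^esub> \<rho> (r \<otimes> s) \<odot>\<^bsub>V\<^esub> (\<rho> (r \<otimes> s) \<odot>\<^bsub>V\<^esub> b)"
      by (rule V.mult_inverse[OF k(1) bV refl k(2)])
    moreover have "inv\<^bsub>K\<^esub> \<rho> (r \<otimes> s) \<in> carrier K" using k by simp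
    ultimately have "b \<in> module.span K V (B - {b})" using s.smult_closed in_span by metis
    thus False using V.lin_indpt_not_in_span[OF Bi BV b] by blast
  qed
  thus ?thesis
    using x(1) unfolding independent_mod_def annihilated_part_def by (intro exI[of _ x]) blast
qed

end

locale bass_setting = primeideal \<pp> R + M: module R M
  for R :: "('r, 'b) ring_scheme" (structure) and M :: "('r, 'm, 'd) module_scheme" and \<pp>
begin

abbreviation H where "H \<equiv> hom_module R (quotient_module R \<pp>) M"
abbreviation T where "T \<equiv> annihilated_part \<pp> M"

lemma quotient_module: "module R (quotient_module R \<pp>)"
  by (rule quotient_module_module[OF is_cring ideal_axioms])

lemma hom_module: "module R H"
  by (rule hom_module_module[OF quotient_module M.module_axioms])

lemma p_subset: "\<pp> \<subseteq> carrier R"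
  using Icarr by blast

lemma hom_coset:
  assumes f: "f \<in> carrier H" and r: "r \<in> carrier R"
  shows "f (\<pp> +> r) = r \<odot>\<^bsub>M\<^esub> f (\<pp> +> \<one>)"
proof -
  have "r \<odot>\<^bsub>quotient_module R \<pp>\<^esub> (\<pp> +> \<one>) = \<pp> +> r"
    using r by (simp add: quotient_module_def coset_mult)
  moreover have "\<pp> +> \<one> \<in> carrier (quotient_module R \<pp>)"
    using coset_closed[of \<one>] by (simp add: quotient_module_def)
  moreover have "f \<in> module_hom R (quotient_module R \<pp>) M" using f by (simp add: hom_module_def)
  ultimately show ?thesis using module_hom_smult[of f R "quotient_module R \<pp>" M r "\<pp> +> \<one>"] r by simp
qed

lemma hom_closed: "f \<in> carrier H \<Longrightarrow> r \<in> carrier R \<Longrightarrow> f (\<pp> +> r) \<in> carrier M"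
  using module_hom_closed[of f R "quotient_module R \<pp>" M] coset_closed[of r]
  by (auto simp: hom_module_def quotient_module_def)

lemma hom_ext:
  assumes f: "f \<in> carrier H" and g: "g \<in> carrier H" and eq: "f (\<pp> +> \<one>) = g (\<pp> +> \<one>)"
  shows "f = g"
proof (rule extensionalityI)
  show "f \<in> extensional (carrier (R Quot \<pp>))" "g \<in> extensional (carrier (R Quot \<pp>))"
    using f g by (auto simp: hom_module_def quotient_module_def)
  fix X assume "X \<in> carrier (R Quot \<pp>)"
  then obtain r where r: "r \<in> carrier R" "X = \<pp> +> r" by (rule carrier_Quot_cases)
  show "f X = g X" unfolding r(2) hom_coset[OF f r(1)] hom_coset[OF g r(1)] eq by (rule refl)
qed

lemma hom_ops:
  assumes "r \<in> carrier R"
  shows "(f \<oplus>\<^bsub>H\<^esub> g) (\<pp> +> r) = f (\<pp> +> r) \<oplus>\<^bsub>M\<^esub> g (\<pp> +> r)" "(a \<odot>\<^bsub>H\<^esub> f) (\<pp> +> r) = a \<odot>\<^bsub>M\<^esub> f (\<pp> +> r)"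
    "\<zero>\<^bsub>H\<^esub> (\<pp> +> r) = \<zero>\<^bsub>M\<^esub>"
  using coset_closed[OF assms] by (simp_all add: hom_module_def quotient_module_def)

lemma hom_annihilated:
  assumes f: "f \<in> carrier H"
  shows "f (\<pp> +> \<one>) \<in> T"
proof -
  have "a \<odot>\<^bsub>M\<^esub> f (\<pp> +> \<one>) = \<zero>\<^bsub>M\<^esub>" if a: "a \<in> \<pp>" for a
  proof -
    have "\<pp> +> a = \<pp> +> \<zero>"
      using coset_eq_zero_iff[of a] coset_eq_zero_iff[of \<zero>] a Icarr additive_subgroup.zero_closed[OF is_additive_subgroup]
      by auto
    hence "a \<odot>\<^bsub>M\<^esub> f (\<pp> +> \<one>) = \<zero> \<odot>\<^bsub>M\<^esub> f (\<pp> +> \<one>)"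
      using hom_coset[OF f, of a] hom_coset[OF f, of \<zero>] a Icarr by simp
    thus ?thesis using hom_closed[OF f one_closed] by simp
  qed
  thus ?thesis using hom_closed[OF f one_closed] by (simp add: annihilated_part_def)
qed

lemma annihilated_hom:
  assumes f: "f \<in> carrier H" and a: "a \<in> \<pp>"
  shows "a \<odot>\<^bsub>H\<^esub> f = \<zero>\<^bsub>H\<^esub>"
proof -
  interpret H: module R H by (rule hom_module)
  show ?thesis
  proof (rule hom_ext)
    show "(a \<odot>\<^bsub>H\<^esub> f) (\<pp> +> \<one>) = \<zero>\<^bsub>H\<^esub> (\<pp> +> \<one>)"
      using hom_annihilated[OF f] a by (simp add: hom_ops annihilated_part_def)
  qed (use f a Icarr in auto)
qed

text \<open>The homomorphism \<open>R/\<pp> \<rightarrow> M\<close> which sends \<open>1\<close> to \<open>y\<close>. The coset action on \<open>T\<close> evaluates it without a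
  choice of representatives.\<close>
definition hom_of :: "'m \<Rightarrow> 'r set \<Rightarrow> 'm" where
  "hom_of y = (\<lambda>X\<in>carrier (R Quot \<pp>). X \<odot>\<^bsub>coset_scalars (M\<lparr>carrier := T\<rparr>)\<^esub> y)"

lemma hom_of:
  assumes y: "y \<in> T"
  shows "hom_of y \<in> carrier H" "hom_of y (\<pp> +> \<one>) = y"
proof -
  let ?C = "coset_scalars (M\<lparr>carrier := T\<rparr>)"
  have T: "module R (M\<lparr>carrier := T\<rparr>)"
    by (rule M.submodule_is_module[OF annihilated_part_submodule[OF M.module_axioms p_subset]])
  have ann: "a \<odot>\<^bsub>M\<lparr>carrier := T\<rparr>\<^esub> v = \<zero>\<^bsub>M\<lparr>carrier := T\<rparr>\<^esub>" if "a \<in> \<pp>" "v \<in> carrier (M\<lparr>carrier := T\<rparr>)" for a v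
    using that by (simp add: annihilated_part_def)
  interpret C: module "R Quot \<pp>" ?C by (rule coset_scalars_module[OF T ideal_axioms ann])
  have yC: "y \<in> carrier ?C" using y by (simp add: coset_scalars_def)
  have TM: "carrier ?C \<subseteq> carrier M" by (auto simp: coset_scalars_def annihilated_part_def)
  have add: "ring.add ?C = ring.add M" by (simp add: coset_scalars_def)
  have smult: "(\<pp> +> r) \<odot>\<^bsub>?C\<^esub> v = r \<odot>\<^bsub>M\<^esub> v" if "r \<in> carrier R" "v \<in> carrier ?C" for r v
    using coset_scalars_smult[OF T ideal_axioms ann that(1), of v] that(2) by (simp add: coset_scalars_def)
  show "hom_of y (\<pp> +> \<one>) = y"
    unfolding hom_of_def using coset_closed[of \<one>] smult[OF one_closed yC] yC TM by auto
  have "hom_of y \<in> module_hom R (quotient_module R \<pp>) M"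
    unfolding module_hom_def
  proof (intro CollectI conjI allI impI)
    show "hom_of y \<in> carrier (quotient_module R \<pp>) \<rightarrow> carrier M"
      using TM C.smult_closed[OF _ yC] by (auto simp: hom_of_def quotient_module_def)
    fix X Y assume XY: "X \<in> carrier (quotient_module R \<pp>) \<and> Y \<in> carrier (quotient_module R \<pp>)"
    thus "hom_of y (X \<oplus>\<^bsub>quotient_module R \<pp>\<^esub> Y) = hom_of y X \<oplus>\<^bsub>M\<^esub> hom_of y Y"
      using C.smult_l_distr[of X Y y] yC by (simp add: hom_of_def quotient_module_def add)
  next
    fix r X assume rX: "r \<in> carrier R \<and> X \<in> carrier (quotient_module R \<pp>)"
    hence X: "X \<in> carrier (R Quot \<pp>)" and r: "r \<in> carrier R" by (simp_all add: quotient_module_def)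
    have "(\<pp> +> r) \<otimes>\<^bsub>R Quot \<pp>\<^esub> X \<in> carrier (R Quot \<pp>)" using X coset_closed[OF r] by simp
    thus "hom_of y (r \<odot>\<^bsub>quotient_module R \<pp>\<^esub> X) = r \<odot>\<^bsub>M\<^esub> hom_of y X"
      using C.smult_assoc1[OF coset_closed[OF r] X yC] X smult[OF r C.smult_closed[OF X yC]]
      by (simp add: hom_of_def quotient_module_def)
  qed
  thus "hom_of y \<in> carrier H" by (simp add: hom_module_def hom_of_def quotient_module_def)
qed

sublocale H: localization_at_prime R H \<pp>
  by (intro localization_at_prime.intro primeideal_axioms hom_module)

abbreviation K where "K \<equiv> residue_field R \<pp>"
abbreviation V where "V \<equiv> bass_space R \<pp> M"

definition residue :: "'r \<Rightarrow> ('r \<times> 'r) set set" where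
  "residue a = extended_prime R \<pp> +>\<^bsub>localization_ring R (carrier R - \<pp>)\<^esub> H.rfr a \<one>"

definition to_bass :: "'m \<Rightarrow> (('r set \<Rightarrow> 'm) \<times> 'r) set" where
  "to_bass y = H.fr (hom_of y) \<one>"

lemma extended_prime_annihilates:
  assumes "A \<in> extended_prime R \<pp>" "v \<in> carrier H.L"
  shows "A \<odot>\<^bsub>H.L\<^esub> v = \<zero>\<^bsub>H.L\<^esub>"
proof -
  obtain a s where a: "A = H.rfr a s" "a \<in> \<pp>" "s \<in> carrier R - \<pp>"
    using assms(1) unfolding H.extended_prime_eq by blast
  obtain f t where f: "v = H.fr f t" "f \<in> carrier H" "t \<in> carrier R - \<pp>"
    using assms(2) by (rule H.localization_cases)
  have "s \<otimes> t \<in> carrier R - \<pp>" using a f H.mult_denom by blast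
  thus ?thesis using a f Icarr
    by (simp add: H.fraction_smult annihilated_hom H.fraction_zero[OF \<open>s \<otimes> t \<in> carrier R - \<pp>\<close>])
qed

lemma bass_space_smult:
  assumes "A \<in> carrier H.LR" "v \<in> carrier H.L"
  shows "(extended_prime R \<pp> +>\<^bsub>H.LR\<^esub> A) \<odot>\<^bsub>V\<^esub> v = A \<odot>\<^bsub>H.L\<^esub> v"
  unfolding bass_space_def
  by (rule coset_scalars_smult[OF H.localization_module_module H.extended_prime_ideal
        extended_prime_annihilates assms])

lemma bass_space_vectorspace: "vectorspace K V"
proof (rule vectorspace.intro)
  show "module K V"
    unfolding bass_space_def residue_field_def
    by (rule coset_scalars_module[OF H.localization_module_module H.extended_prime_ideal
          extended_prime_annihilates])
  show "field K" by (rule H.residue_field_field)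
qed

lemma bass_space_fields: "carrier V = carrier H.L" "ring.add V = ring.add H.L" "\<zero>\<^bsub>V\<^esub> = \<zero>\<^bsub>H.L\<^esub>"
  by (simp_all add: bass_space_def coset_scalars_def)

lemma bass_fraction_space: "fraction_space R M \<pp> K V residue to_bass"
proof (intro fraction_space.intro fraction_space_axioms.intro primeideal_axioms M.module_axioms
    bass_space_vectorspace)
  interpret P: ideal "extended_prime R \<pp>" H.LR by (rule H.extended_prime_ideal)
  interpret Hm: module R H by (rule hom_module)
  have one: "\<one> \<in> carrier R - \<pp>" by (rule H.one_denom)
  have smult: "residue a \<odot>\<^bsub>V\<^esub> H.fr f t = H.fr (a \<odot>\<^bsub>H\<^esub> f) t"
    if "a \<in> carrier R" "f \<in> carrier H" "t \<in> carrier R - \<pp>" for a f t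
    unfolding residue_def using that one by (simp add: bass_space_smult H.fraction_smult)
  {
    fix a assume "a \<in> carrier R"
    thus "residue a \<in> carrier K"
      unfolding residue_def residue_field_def using one by (intro P.coset_closed) simp
  next
    fix a b assume "a \<in> carrier R" "b \<in> carrier R"
    thus "residue (a \<otimes> b) = residue a \<otimes>\<^bsub>K\<^esub> residue b"
      unfolding residue_def residue_field_def using one
      by (simp add: P.coset_mult H.ring_fraction_mult)
  next
    fix a assume a: "a \<in> carrier R - \<pp>"
    have "H.rfr a \<one> \<notin> extended_prime R \<pp>"
      using a one H.fraction_in_extended_prime_iff[of a \<one>] by blast
    moreover have "H.rfr a \<one> \<in> carrier H.LR" using a one by simp
    ultimately show "residue a \<noteq> \<zero>\<^bsub>K\<^esub>"
      unfolding residue_def residue_field_def using P.coset_eq_zero_iff by blast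
  next
    fix k assume "k \<in> carrier K"
    then obtain A where A: "A \<in> carrier H.LR" "k = extended_prime R \<pp> +>\<^bsub>H.LR\<^esub> A"
      unfolding residue_field_def by (rule carrier_Quot_cases)
    obtain a s where a: "A = H.rfr a s" "a \<in> carrier R" "s \<in> carrier R - \<pp>"
      using A(1) by (rule H.localization_ring_cases)
    have "H.rfr s \<one> \<otimes>\<^bsub>H.LR\<^esub> A = H.rfr (s \<otimes> a) (s \<otimes> \<one>)"
      using a one by (simp add: H.ring_fraction_mult)
    also have "\<dots> = H.rfr a \<one>" by (rule H.ring_fraction_cancel[OF a(2) one a(3)])
    finally have "residue s \<otimes>\<^bsub>K\<^esub> k = residue a"
      unfolding residue_def residue_field_def A(2) using a one A(1) P.coset_mult[of "H.rfr s \<one>" A] by simp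
    thus "\<exists>s\<in>carrier R - \<pp>. \<exists>a\<in>carrier R. residue s \<otimes>\<^bsub>K\<^esub> k = residue a" using a by blast
  next
    fix y assume y: "y \<in> T"
    show "to_bass y \<in> carrier V"
      unfolding to_bass_def bass_space_fields using hom_of[OF y] one by simp
  next
    fix y z assume y: "y \<in> T" and z: "z \<in> T"
    interpret T: submodule R T M by (rule annihilated_part_submodule[OF M.module_axioms p_subset])
    have yz: "y \<oplus>\<^bsub>M\<^esub> z \<in> T" using y z by simp
    have "hom_of (y \<oplus>\<^bsub>M\<^esub> z) = hom_of y \<oplus>\<^bsub>H\<^esub> hom_of z"
      by (rule hom_ext) (use hom_of[OF y] hom_of[OF z] hom_of[OF yz] in \<open>simp_all add: hom_ops\<close>)
    thus "to_bass (y \<oplus>\<^bsub>M\<^esub> z) = to_bass y \<oplus>\<^bsub>V\<^esub> to_bass z"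
      unfolding to_bass_def bass_space_fields using hom_of[OF y] hom_of[OF z] one by (simp add: H.fraction_add)
  next
    fix a y assume a: "a \<in> carrier R" and y: "y \<in> T"
    interpret T: submodule R T M by (rule annihilated_part_submodule[OF M.module_axioms p_subset])
    have ay: "a \<odot>\<^bsub>M\<^esub> y \<in> T" using a y by simp
    have "hom_of (a \<odot>\<^bsub>M\<^esub> y) = a \<odot>\<^bsub>H\<^esub> hom_of y"
      by (rule hom_ext) (use a hom_of[OF y] hom_of[OF ay] in \<open>simp_all add: hom_ops\<close>)
    thus "to_bass (a \<odot>\<^bsub>M\<^esub> y) = residue a \<odot>\<^bsub>V\<^esub> to_bass y"
      unfolding to_bass_def using smult[OF a hom_of(1)[OF y] one] by simp
  next
    fix y assume y: "y \<in> T" and 0: "to_bass y = \<zero>\<^bsub>V\<^esub>"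
    then obtain u where u: "u \<in> carrier R - \<pp>" "u \<odot>\<^bsub>H\<^esub> hom_of y = \<zero>\<^bsub>H\<^esub>"
      unfolding to_bass_def bass_space_fields using H.fraction_eq_zero[OF hom_of(1)[OF y] one] by blast
    have "u \<odot>\<^bsub>M\<^esub> y = (u \<odot>\<^bsub>H\<^esub> hom_of y) (\<pp> +> \<one>)" using hom_of(2)[OF y] by (simp add: hom_ops)
    also have "\<dots> = \<zero>\<^bsub>M\<^esub>" unfolding u(2) by (simp add: hom_ops)
    finally show "\<exists>s\<in>carrier R - \<pp>. s \<odot>\<^bsub>M\<^esub> y = \<zero>\<^bsub>M\<^esub>" using u by blast
  next
    fix v assume "v \<in> carrier V"
    then obtain f t where f: "v = H.fr f t" "f \<in> carrier H" "t \<in> carrier R - \<pp>"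
      unfolding bass_space_fields by (rule H.localization_cases)
    define y where "y = f (\<pp> +> \<one>)"
    have y: "y \<in> T" unfolding y_def by (rule hom_annihilated[OF f(2)])
    have "hom_of y = f"
      by (rule hom_ext[OF hom_of(1)[OF y] f(2)]) (unfold hom_of(2)[OF y], rule y_def)
    moreover have "residue t \<odot>\<^bsub>V\<^esub> v = H.fr (t \<odot>\<^bsub>H\<^esub> f) (t \<otimes> \<one>)"
      unfolding f(1) using smult[of t f t] f(2,3) by simp
    moreover have "\<dots> = H.fr f \<one>" by (rule H.fraction_cancel[OF f(2) one f(3)])
    ultimately have "residue t \<odot>\<^bsub>V\<^esub> v = to_bass y" by (simp add: to_bass_def)
    thus "\<exists>s\<in>carrier R - \<pp>. \<exists>y\<in>T. residue s \<odot>\<^bsub>V\<^esub> v = to_bass y" using f(3) y by blast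
  }
qed

end

text \<open>Any two bases of the Bass space are equipotent, so the basis which enters the definition of the
  dimension may be compared with arbitrary independent families.\<close>

lemma
  fixes R :: "('r, 'b) ring_scheme" and M :: "('r, 'm, 'd) module_scheme"
  assumes p: "primeideal \<pp> R" and M: "module R M"
  shows independent_mod_ordLeq_bass_number: "independent_mod R \<pp> M x I \<Longrightarrow> |I| \<le>o bass_number R \<pp> M"
    and exists_independent_mod_bass_number:
      "\<exists>(x :: _ \<Rightarrow> 'm) (I :: (('r set \<Rightarrow> 'm) \<times> 'r) set set). independent_mod R \<pp> M x I \<and> |I| =o bass_number R \<pp> M"
proof -
  interpret bass_setting R M \<pp> using p M by (simp add: bass_setting_def)
  interpret F: fraction_space R M \<pp> K V residue to_bass by (rule bass_fraction_space)
  define B where "B = (SOME B. vectorspace.basis K V B)"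
  have B: "vectorspace.basis K V B" unfolding B_def using F.V.basis_exists by (rule someI_ex)
  have bn: "bass_number R \<pp> M = |B|"
    by (simp add: bass_number_def cardinal_dim_def B_def)
  show "|I| \<le>o bass_number R \<pp> M" if "independent_mod R \<pp> M x I"
    unfolding bn by (rule F.independent_mod_ordLeq_basis[OF that B])
  show "\<exists>(x :: _ \<Rightarrow> 'm) (I :: (('r set \<Rightarrow> 'm) \<times> 'r) set set). independent_mod R \<pp> M x I \<and> |I| =o bass_number R \<pp> M"
    unfolding bn using F.basis_independent_mod[OF B] card_of_refl by blast
qed

section \<open>Reflexivity\<close>
lemma bass_number_mono:
  fixes R :: "('r, 'b) ring_scheme" and M :: "('r, 'm, 'd) module_scheme"
  assumes p: "primeideal \<pp> R" and M: "module R M" and M': "module R M'"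
    and h: "h \<in> module_hom R M M'" "inj_on h (carrier M)"
  shows "bass_number R \<pp> M \<le>o bass_number R \<pp> M'"
proof -
  obtain x :: "_ \<Rightarrow> 'm" and I :: "(('r set \<Rightarrow> 'm) \<times> 'r) set set" where x: "independent_mod R \<pp> M x I" "|I| =o bass_number R \<pp> M"
    using exists_independent_mod_bass_number[OF p M] by blast
  have "\<pp> \<subseteq> carrier R" using ideal.Icarr[OF primeideal.axioms(1)[OF p]] by blast
  hence "independent_mod R \<pp> M' (h \<circ> x) I" by (rule independent_mod_hom[OF M M' h _ x(1)])
  hence "|I| \<le>o bass_number R \<pp> M'" by (rule independent_mod_ordLeq_bass_number[OF p M'])
  thus ?thesis using x(2) ordIso_symmetric ordIso_ordLeq_trans by blast
qed

lemma module_hom_inv_into: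
  assumes M: "module R M" and h: "h \<in> module_hom R M N" and bij: "bij_betw h (carrier M) (carrier N)"
  shows "inv_into (carrier M) h \<in> module_hom R N M"
proof -
  interpret M: module R M by (rule M)
  let ?g = "inv_into (carrier M) h"
  have g: "?g y \<in> carrier M" "h (?g y) = y" if "y \<in> carrier N" for y
    using that bij_betw_inv_into_right[OF bij] bij_betw_apply[OF bij_betw_inv_into[OF bij]] by auto
  have gh: "?g (h x) = x" if "x \<in> carrier M" for x by (rule bij_betw_inv_into_left[OF bij that])
  show ?thesis
    unfolding module_hom_def
  proof (intro CollectI conjI allI impI)
    show "?g \<in> carrier N \<rightarrow> carrier M" using g by blast
    fix y z assume "y \<in> carrier N \<and> z \<in> carrier N"
    hence y: "y \<in> carrier N" and z: "z \<in> carrier N" by auto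
    have "y \<oplus>\<^bsub>N\<^esub> z = h (?g y \<oplus>\<^bsub>M\<^esub> ?g z)"
      using g[OF y] g[OF z] by (simp add: module_hom_add[OF h])
    thus "?g (y \<oplus>\<^bsub>N\<^esub> z) = ?g y \<oplus>\<^bsub>M\<^esub> ?g z" using gh g(1)[OF y] g(1)[OF z] by simp
  next
    fix r y assume "r \<in> carrier R \<and> y \<in> carrier N"
    hence r: "r \<in> carrier R" and y: "y \<in> carrier N" by auto
    have "r \<odot>\<^bsub>N\<^esub> y = h (r \<odot>\<^bsub>M\<^esub> ?g y)"
      using g[OF y] r by (simp add: module_hom_smult[OF h])
    thus "?g (r \<odot>\<^bsub>N\<^esub> y) = r \<odot>\<^bsub>M\<^esub> ?g y" using gh g(1)[OF y] r by simp
  qed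
qed

context matlis_module
begin

lemma reflexive_imp_bass_number_eq:
  assumes refl: "matlis_reflexive R E M" and p: "primeideal \<pp> R"
  shows "bass_number R \<pp> M =o bass_number R \<pp> DD"
proof -
  have bij: "bij_betw \<phi> (carrier M) (carrier DD)"
    using refl matlis_map_inj by (simp add: bij_betw_def matlis_reflexive_def)
  have "bass_number R \<pp> M \<le>o bass_number R \<pp> DD"
    by (rule bass_number_mono[OF p M.module_axioms bidual_module matlis_map_hom matlis_map_inj])
  moreover have "bass_number R \<pp> DD \<le>o bass_number R \<pp> M"
    by (rule bass_number_mono[OF p bidual_module M.module_axioms
          module_hom_inv_into[OF M.module_axioms matlis_map_hom bij]
          bij_betw_imp_inj_on[OF bij_betw_inv_into[OF bij]]])
  ultimately show ?thesis by (simp add: ordIso_iff_ordLeq)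
qed

text \<open>Equality of the two Bass numbers forbids independent families in the bidual which are larger
  than a maximal one in \<open>M\<close>. For an infinite Bass number the bidual always has one; for a finite one,
  the image of the family in \<open>M\<close> could be enlarged by \<open>z\<close> if the conclusion failed.\<close>
lemma bass_number_eq_imp_multiple_in_range:
  assumes p: "primeideal \<pp> R" and eq: "bass_number R \<pp> M =o bass_number R \<pp> DD"
    and z: "z \<in> carrier DD" "\<And>a. a \<in> \<pp> \<Longrightarrow> a \<odot>\<^bsub>DD\<^esub> z = \<zero>\<^bsub>DD\<^esub>"
  shows "\<exists>r\<in>carrier R - \<pp>. r \<odot>\<^bsub>DD\<^esub> z \<in> \<phi> ` carrier M"
proof (rule ccontr)
  assume contr: "\<not> ?thesis"
  have ideal: "ideal \<pp> R" using p by (rule primeideal.axioms(1))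
  have pR: "\<pp> \<subseteq> carrier R" using ideal.Icarr[OF ideal] by blast
  obtain x :: "_ \<Rightarrow> 'm" and I :: "(('r set \<Rightarrow> 'm) \<times> 'r) set set" where x: "independent_mod R \<pp> M x I" and I: "|I| =o bass_number R \<pp> M"
    using exists_independent_mod_bass_number[OF p M.module_axioms] by blast
  have le: "|J| \<le>o |I|" if "independent_mod R \<pp> DD w J" for w J
  proof -
    have "|J| \<le>o bass_number R \<pp> DD"
      by (rule independent_mod_ordLeq_bass_number[OF p bidual_module that])
    moreover have "bass_number R \<pp> DD =o |I|"
      by (rule ordIso_symmetric[OF ordIso_transitive[OF I eq]])
    ultimately show ?thesis by (rule ordLeq_ordIso_trans)
  qed
  show False
  proof (cases "finite I")
    case False
    then obtain w where "independent_mod R \<pp> DD w (Pow I)"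
      using independent_mod_bidual_Pow[OF ideal x] by blast
    from le[OF this] show False using card_of_Pow[of I] not_ordLess_ordLeq by blast
  next
    case True
    have ind: "independent_mod R \<pp> DD (\<phi> \<circ> x) I"
      by (rule independent_mod_hom[OF M.module_axioms bidual_module matlis_map_hom matlis_map_inj pR x])
    have "(\<phi> \<circ> x) ` I \<subseteq> \<phi> ` carrier M" using x by (auto simp: independent_mod_def)
    hence "module.span R DD ((\<phi> \<circ> x) ` I) \<subseteq> \<phi> ` carrier M"
      by (rule DD.span_is_subset[OF _ range_submodule])
    hence out: "r \<in> \<pp>" if "r \<in> carrier R" "r \<odot>\<^bsub>DD\<^esub> z \<in> module.span R DD ((\<phi> \<circ> x) ` I)" for r
      using that contr by blast
    have "|insert None (Some ` I)| \<le>o |I|"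
      by (rule le[OF independent_mod_insert[OF bidual_module ind z out]])
    then obtain f where "inj_on f (insert None (Some ` I))" "f ` insert None (Some ` I) \<subseteq> I"
      unfolding card_of_ordLeq[symmetric] by blast
    hence "card (insert None (Some ` I)) \<le> card I" using True by (rule card_inj_on_le)
    thus False using True by (simp add: card_image)
  qed
qed

text \<open>The prime \<open>\<pp>\<close> below is associated to \<open>DD/\<phi>(M)\<close>. By purity the class with annihilator
  \<open>\<pp>\<close> has a representative \<open>w\<close> which is itself killed by \<open>\<pp>\<close>, and the previous lemma provides a
  multiplier outside \<open>\<pp>\<close> which kills the class.\<close>
lemma bass_number_eq_imp_reflexive:
  assumes noeth: "noetherian_ring R"
    and eq: "\<And>\<pp>. primeideal \<pp> R \<Longrightarrow> bass_number R \<pp> M =o bass_number R \<pp> DD"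
  shows "matlis_reflexive R E M"
proof (rule ccontr)
  assume "\<not> matlis_reflexive R E M"
  then obtain z0 where "z0 \<in> carrier DD - \<phi> ` carrier M"
    unfolding matlis_reflexive_def using matlis_map_closed by blast
  from exists_prime_colon_ideal[OF noeth range_submodule this]
  obtain z \<pp> where z: "z \<in> carrier DD - \<phi> ` carrier M" and p: "primeideal \<pp> R"
    and pz: "\<pp> = colon_ideal R (\<phi> ` carrier M) DD z" by blast
  have ideal: "ideal \<pp> R" using p by (rule primeideal.axioms(1))
  obtain A where A: "A \<subseteq> carrier R" "finite A" "\<pp> = Idl A"
    using noetherian_ring.finetely_gen[OF noeth ideal] by blast
  have "A \<subseteq> \<pp>" unfolding A(3) by (rule genideal_self[OF A(1)])
  hence "a \<odot>\<^bsub>DD\<^esub> z \<in> \<phi> ` carrier M" if "a \<in> A" for a using that pz by (auto simp: colon_ideal_def)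
  then obtain x where x: "x \<in> carrier M" "\<And>a. a \<in> A \<Longrightarrow> a \<odot>\<^bsub>DD\<^esub> z = \<phi> (a \<odot>\<^bsub>M\<^esub> x)"
    using matlis_map_pure[OF _ A(2,1), of z] z by blast
  define w where "w = z \<ominus>\<^bsub>DD\<^esub> \<phi> x"
  have w: "w \<in> carrier DD" using z x matlis_map_closed by (simp add: w_def)
  have zero: "submodule R {\<zero>\<^bsub>DD\<^esub>} DD" by (rule submodule.intro[OF bidual_module]) auto
  have "a \<odot>\<^bsub>DD\<^esub> w = \<zero>\<^bsub>DD\<^esub>" if "a \<in> A" for a
  proof -
    have a: "a \<in> carrier R" using that A by blast
    have "a \<odot>\<^bsub>DD\<^esub> w = a \<odot>\<^bsub>DD\<^esub> z \<ominus>\<^bsub>DD\<^esub> a \<odot>\<^bsub>DD\<^esub> \<phi> x"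
      unfolding w_def using a z x(1) matlis_map_closed by (intro DD.smult_diff_distr_r) auto
    also have "\<dots> = \<zero>\<^bsub>DD\<^esub>"
      unfolding x(2)[OF that] module_hom_smult[OF matlis_map_hom a x(1)]
      using a x(1) matlis_map_closed by simp
    finally show ?thesis .
  qed
  hence "A \<subseteq> colon_ideal R {\<zero>\<^bsub>DD\<^esub>} DD w" using A(1) by (auto simp: colon_ideal_def)
  hence "\<pp> \<subseteq> colon_ideal R {\<zero>\<^bsub>DD\<^esub>} DD w"
    unfolding A(3) by (rule genideal_minimal[OF colon_ideal_ideal[OF zero w]])
  hence "a \<odot>\<^bsub>DD\<^esub> w = \<zero>\<^bsub>DD\<^esub>" if "a \<in> \<pp>" for a using that by (auto simp: colon_ideal_def)
  from bass_number_eq_imp_multiple_in_range[OF p eq[OF p] w this]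
  obtain r where r: "r \<in> carrier R" "r \<notin> \<pp>" "r \<odot>\<^bsub>DD\<^esub> w \<in> \<phi> ` carrier M" by blast
  have "r \<odot>\<^bsub>DD\<^esub> \<phi> x \<in> \<phi> ` carrier M"
    using x(1) r(1) by (intro submodule.smult_closed[OF range_submodule]) auto
  hence "r \<odot>\<^bsub>DD\<^esub> w \<oplus>\<^bsub>DD\<^esub> r \<odot>\<^bsub>DD\<^esub> \<phi> x \<in> \<phi> ` carrier M"
    using r(3) by (intro submodule.m_closed[OF range_submodule])
  moreover have "w \<oplus>\<^bsub>DD\<^esub> \<phi> x = z"
    using z matlis_map_closed[OF x(1)] by (simp add: w_def a_minus_def DD.M.add.m_assoc DD.M.l_neg)
  hence "r \<odot>\<^bsub>DD\<^esub> w \<oplus>\<^bsub>DD\<^esub> r \<odot>\<^bsub>DD\<^esub> \<phi> x = r \<odot>\<^bsub>DD\<^esub> z"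
    using DD.smult_r_distr[OF r(1) w matlis_map_closed[OF x(1)]] by simp
  ultimately have "r \<in> \<pp>" using r(1) by (simp add: pz colon_ideal_def)
  thus False using r(2) by blast
qed

end

text \<open>The witness is the image in \<open>E\<close> of the unit of the residue field.\<close>
lemma injective_hull_cogenerator:
  assumes R: "noetherian_local_ring R \<mm>" and E: "injective_hull R (quotient_module R \<mm>) E"
  shows "\<exists>e0. injective_cogenerator R E e0"
proof -
  interpret noetherian_local_ring R \<mm> by (rule R)
  interpret m: maximalideal \<mm> R by (rule maximal)
  let ?k = "quotient_module R \<mm>"
  obtain \<iota> where k: "module R ?k" and inj: "injective_module TYPE('a) R E"
    and \<iota>: "\<iota> \<in> module_hom R ?k E" "inj_on \<iota> (carrier ?k)"
    using E unfolding injective_hull_def by blast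
  have modE: "module R E" using inj by (simp add: injective_module_def)
  interpret E: module R E by (rule modE)
  interpret k: module R ?k by (rule k)
  let ?u = "\<mm> +>\<^bsub>R\<^esub> \<one>\<^bsub>R\<^esub>"
  have u: "?u \<in> carrier ?k" using m.coset_closed[OF one_closed] by (simp add: quotient_module_def)
  have zk: "\<zero>\<^bsub>?k\<^esub> = \<zero>\<^bsub>R Quot \<mm>\<^esub>" by (simp add: quotient_module_def)
  have \<iota>0: "\<iota> \<zero>\<^bsub>?k\<^esub> = \<zero>\<^bsub>E\<^esub>" by (rule module_hom_zero[OF k modE \<iota>(1)])
  have "\<one>\<^bsub>R\<^esub> \<notin> \<mm>" using m.I_notcarr m.one_imp_carrier by auto
  hence "?u \<noteq> \<zero>\<^bsub>?k\<^esub>" unfolding zk by (simp add: m.coset_eq_zero_iff)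
  hence ne: "\<iota> ?u \<noteq> \<zero>\<^bsub>E\<^esub>" using inj_onD[OF \<iota>(2) _ u k.M.zero_closed] \<iota>0 by auto
  have "r \<odot>\<^bsub>E\<^esub> \<iota> ?u = \<zero>\<^bsub>E\<^esub>" if r: "r \<in> carrier R" "r \<notin> Units R" for r
  proof -
    have "r \<odot>\<^bsub>?k\<^esub> ?u = \<mm> +>\<^bsub>R\<^esub> r" using r by (simp add: quotient_module_def m.coset_mult)
    also have "\<dots> = \<zero>\<^bsub>?k\<^esub>"
      unfolding zk using r(1) nonunit_in_maximal[OF r] by (simp add: m.coset_eq_zero_iff)
    finally have "\<iota> (r \<odot>\<^bsub>?k\<^esub> ?u) = \<zero>\<^bsub>E\<^esub>" by (simp add: \<iota>0)
    thus ?thesis using module_hom_smult[OF \<iota>(1) r(1) u] by simp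
  qed
  moreover have "\<iota> ?u \<in> carrier E" using module_hom_closed[OF \<iota>(1)] u by blast
  ultimately have "injective_cogenerator R E (\<iota> ?u)"
    using modE inj ne by (simp add: injective_cogenerator_def injective_cogenerator_axioms_def)
  thus ?thesis by blast
qed

theorem mainTheorem2:
  fixes R :: "('r, 'b) ring_scheme" and \<mm> :: "'r set"
    and E :: "('r, 'e, 'c) module_scheme" and M :: "('r, 'm, 'd) module_scheme"
  assumes "noetherian_local_ring R \<mm>"
    and "injective_hull R (quotient_module R \<mm>) E"
    and "module R M"
  shows "matlis_reflexive R E M \<longleftrightarrow>
    (\<forall>\<pp>. primeideal \<pp> R \<longrightarrow> bass_number R \<pp> M =o bass_number R \<pp> (matlis_bidual R E M))"
proof -
  obtain e0 where "injective_cogenerator R E e0"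
    using injective_hull_cogenerator[OF assms(1,2)] by blast
  then interpret matlis_module R E e0 M using assms(3) by (simp add: matlis_module_def)
  have "noetherian_ring R" using assms(1) by (simp add: noetherian_local_ring_def)
  thus ?thesis using reflexive_imp_bass_number_eq bass_number_eq_imp_reflexive by blast
qed

end
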